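(* Fix $\alpha\ge0$, $\eta,\theta>0$ and integers $1\le M\le N$. For $\epsilon>0$ let $q=e^{-\epsilon}$, $a=e^{-\alpha\epsilon}$ and let $\Lambda$ be distributed according to the plane-partition measure of the context with these parameters. Then as $\epsilon\to0^+$ the finite random array $\big(q^{\lambda^{(t)}_i}\big)_{-M+1\le t\le N-1,\,1\le i\le L_t}$ converges in distribution to a random array $\mathbf X=(x^{(t)}_i)_{-M+1\le t\le N-1,\,1\le i\le L_t}$ with the following properties: almost surely all entries lie in $(0,1)$, $x^{(t)}_1<\dots<x^{(t)}_{L_t}$ for each $t$, and the slices interlace: for $-M+1\le t\le-1$, $x^{(t+1)}_i<x^{(t)}_i<x^{(t+1)}_{i+1}$ for $1\le i\le L_t$; for $0\le t\le N-2$, $x^{(t)}_i<x^{(t+1)}_i<x^{(t)}_{i+1}$ for $1\le i\le L_{t+1}$, with the convention $x^{(t)}_{L_t+1}:=1$. Moreover for each $t$ the vector $x^{(t)}=(x^{(t)}_1,\dots,x^{(t)}_{L_t})$ has density on $\{0<x_1<\dots<x_{L_t}<1\}$ proportional to $$\prod_{1\le i<j\le L_t}(x_j^\eta-x_i^\eta)(x_j^\theta-x_i^\theta)\prod_{i=1}^{L_t}w_c(x_i),$$ $$w_c(x)=\begin{cases}x^{\alpha+\frac{\eta+\theta}{2}+|t|\eta-1}(1-x^\theta)^{N-(M-|t|)}&t\le0,\\ x^{\alpha+\frac{\eta+\theta}{2}+t\theta-1}(1-x^\theta)^{N-t-M}& t>0,\ N-t\ge M,\\ x^{\alpha+\frac{\eta+\theta}{2}+t\theta-1}(1-x^\eta)^{M-(N-t)}&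 t>0,\ N-t<M.\end{cases}$$
   Context: Fix $0<q<1$, $0\le a<1$, $\eta,\theta\ge0$, integers $1\le M\le N$. A partition is a non-increasing eventually-zero sequence of nonnegative integers, $|\lambda|=\sum\lambda_i$. A plane partition with base in the $M\times N$ rectangle is an array $\Lambda=(\Lambda_{i,j})_{1\le i\le M,1\le j\le N}$ of nonnegative integers with $\Lambda_{i,j}\ge\Lambda_{i+1,j}$, $\Lambda_{i,j}\ge\Lambda_{i,j+1}$. Its slice $\lambda^{(t)}$ ($-M\le t\le N$) is $(\Lambda_{k+|t|,k})_{k\ge1}$ if $t\le0$ and $(\Lambda_{k,k+t})_{k\ge1}$ if $t>0$ (out-of-range entries $0$). Left volume $=\sum_{t=-M}^{-1}|\lambda^{(t)}|$, central volume $=|\lambda^{(0)}|$, right volume $=\sum_{t=1}^N|\lambda^{(t)}|$; $\mathbb P(\Lambda)\propto q^{\eta\cdot\text{left vol}}(aq^{(\eta+\theta)/2})^{\text{central vol}}q^{\theta\cdot\text{right vol}}$. $L_t=M-|t|$ for $t\le0$ and $L_t=\min(N-t,M)$ for $t>0$. *)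

theory Defs
  imports "HOL-Probability.Probability"
begin

definition plane_partitions :: "nat \<Rightarrow> nat \<Rightarrow> (nat \<Rightarrow> nat \<Rightarrow> nat) set" where
  "plane_partitions M N =
     {\<Lambda>. (\<forall>i j. \<Lambda> i j \<noteq> 0 \<longrightarrow> 1 \<le> i \<and> i \<le> M \<and> 1 \<le> j \<and> j \<le> N) \<and>
          (\<forall>i j. 1 \<le> i \<longrightarrow> 1 \<le> j \<longrightarrow> \<Lambda> (Suc i) j \<le> \<Lambda> i j \<and> \<Lambda> i (Suc j) \<le> \<Lambda> i j)}"

text \<open>The slice lambda^(t), as a function of its part index k >= 1.\<close>
definition slice :: "(nat \<Rightarrow> nat \<Rightarrow> nat) \<Rightarrow> int \<Rightarrow> nat \<Rightarrow> nat" where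
  "slice \<Lambda> t k = (if t \<le> 0 then \<Lambda> (k + nat \<bar>t\<bar>) k else \<Lambda> k (k + nat t))"

text \<open>|lambda^(t)|; all nonzero parts have index k <= M, so summing over
  k in {1..M+N} gives the full sum over k >= 1.\<close>
definition slice_size :: "nat \<Rightarrow> nat \<Rightarrow> (nat \<Rightarrow> nat \<Rightarrow> nat) \<Rightarrow> int \<Rightarrow> nat" where
  "slice_size M N \<Lambda> t = (\<Sum>k\<in>{1..M+N}. slice \<Lambda> t k)"

definition left_vol :: "nat \<Rightarrow> nat \<Rightarrow> (nat \<Rightarrow> nat \<Rightarrow> nat) \<Rightarrow> nat" where
  "left_vol M N \<Lambda> = (\<Sum>t\<in>{- int M..-1}. slice_size M N \<Lambda> t)"

definition central_vol :: "nat \<Rightarrow> nat \<Rightarrow> (nat \<Rightarrow> nat \<Rightarrow> nat) \<Rightarrow> nat" where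
  "central_vol M N \<Lambda> = slice_size M N \<Lambda> 0"

definition right_vol :: "nat \<Rightarrow> nat \<Rightarrow> (nat \<Rightarrow> nat \<Rightarrow> nat) \<Rightarrow> nat" where
  "right_vol M N \<Lambda> = (\<Sum>t\<in>{1..int N}. slice_size M N \<Lambda> t)"

definition pp_weight :: "real \<Rightarrow> real \<Rightarrow> real \<Rightarrow> real \<Rightarrow> nat \<Rightarrow> nat \<Rightarrow> (nat \<Rightarrow> nat \<Rightarrow> nat) \<Rightarrow> real" where
  "pp_weight q a \<eta> \<theta> M N \<Lambda> =
     q powr (\<eta> * real (left_vol M N \<Lambda>)) *
     (a * q powr ((\<eta> + \<theta>) / 2)) ^ central_vol M N \<Lambda> *
     q powr (\<theta> * real (right_vol M N \<Lambda>))"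

definition Lt :: "nat \<Rightarrow> nat \<Rightarrow> int \<Rightarrow> nat" where
  "Lt M N t = (if t \<le> 0 then nat (int M - \<bar>t\<bar>) else min (nat (int N - t)) M)"

definition arr_idx :: "nat \<Rightarrow> nat \<Rightarrow> (int \<times> nat) set" where
  "arr_idx M N = {(t, i). - int M + 1 \<le> t \<and> t \<le> int N - 1 \<and> 1 \<le> i \<and> i \<le> Lt M N t}"

definition pp_array :: "real \<Rightarrow> nat \<Rightarrow> nat \<Rightarrow> (nat \<Rightarrow> nat \<Rightarrow> nat) \<Rightarrow> (int \<times> nat \<Rightarrow> real)" where
  "pp_array q M N \<Lambda> = restrict (\<lambda>(t, i). q ^ slice \<Lambda> t i) (arr_idx M N)"

definition pp_expect :: "real \<Rightarrow> real \<Rightarrow> real \<Rightarrow> real \<Rightarrow> nat \<Rightarrow> nat \<Rightarrow> ((int \<times> nat \<Rightarrow> real) \<Rightarrow> real) \<Rightarrow> real" where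
  "pp_expect \<epsilon> \<alpha> \<eta> \<theta> M N f =
     (let q = exp (- \<epsilon>); a = exp (- \<alpha> * \<epsilon>) in
       infsum (\<lambda>\<Lambda>. pp_weight q a \<eta> \<theta> M N \<Lambda> * f (pp_array q M N \<Lambda>)) (plane_partitions M N)
       / infsum (\<lambda>\<Lambda>. pp_weight q a \<eta> \<theta> M N \<Lambda>) (plane_partitions M N))"

definition xext :: "nat \<Rightarrow> nat \<Rightarrow> (int \<times> nat \<Rightarrow> real) \<Rightarrow> int \<Rightarrow> nat \<Rightarrow> real" where
  "xext M N x t i = (if i = Lt M N t + 1 then 1 else x (t, i))"

definition limit_array_ok :: "nat \<Rightarrow> nat \<Rightarrow> (int \<times> nat \<Rightarrow> real) \<Rightarrow> bool" where
  "limit_array_ok M N x \<longleftrightarrow>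
     (\<forall>p\<in>arr_idx M N. 0 < x p \<and> x p < 1) \<and>
     (\<forall>t i j. - int M + 1 \<le> t \<and> t \<le> int N - 1 \<and> 1 \<le> i \<and> i < j \<and> j \<le> Lt M N t \<longrightarrow>
        x (t, i) < x (t, j)) \<and>
     (\<forall>t i. - int M + 1 \<le> t \<and> t \<le> -1 \<and> 1 \<le> i \<and> i \<le> Lt M N t \<longrightarrow>
        x (t + 1, i) < x (t, i) \<and> x (t, i) < x (t + 1, i + 1)) \<and>
     (\<forall>t i. 0 \<le> t \<and> t \<le> int N - 2 \<and> 1 \<le> i \<and> i \<le> Lt M N (t + 1) \<longrightarrow>
        x (t, i) < x (t + 1, i) \<and> x (t + 1, i) < xext M N x t (i + 1))"

definition weyl_chamber :: "nat \<Rightarrow> (nat \<Rightarrow> real) set" where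
  "weyl_chamber L = {y. (\<forall>i\<in>{1..L}. 0 < y i \<and> y i < 1) \<and>
                       (\<forall>i\<in>{1..L}. \<forall>j\<in>{1..L}. i < j \<longrightarrow> y i < y j)}"

definition wc :: "real \<Rightarrow> real \<Rightarrow> real \<Rightarrow> nat \<Rightarrow> nat \<Rightarrow> int \<Rightarrow> real \<Rightarrow> real" where
  "wc \<alpha> \<eta> \<theta> M N t x =
     (if t \<le> 0 then
        x powr (\<alpha> + (\<eta> + \<theta>) / 2 + real_of_int \<bar>t\<bar> * \<eta> - 1) * (1 - x powr \<theta>) ^ (N - (M - nat \<bar>t\<bar>))
      else if int N - t \<ge> int M then
        x powr (\<alpha> + (\<eta> + \<theta>) / 2 + real_of_int t * \<theta> - 1) * (1 - x powr \<theta>) ^ (N - nat t - M)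
      else
        x powr (\<alpha> + (\<eta> + \<theta>) / 2 + real_of_int t * \<theta> - 1) * (1 - x powr \<eta>) ^ (M - (N - nat t)))"

definition slice_density :: "real \<Rightarrow> real \<Rightarrow> real \<Rightarrow> nat \<Rightarrow> nat \<Rightarrow> int \<Rightarrow> (nat \<Rightarrow> real) \<Rightarrow> real" where
  "slice_density \<alpha> \<eta> \<theta> M N t y =
     (\<Prod>(i, j)\<in>{(i, j). 1 \<le> i \<and> i < j \<and> j \<le> Lt M N t}.
        (y j powr \<eta> - y i powr \<eta>) * (y j powr \<theta> - y i powr \<theta>)) *
     (\<Prod>i\<in>{1..Lt M N t}. wc \<alpha> \<eta> \<theta> M N t (y i))"

end

theory Submission
  imports Defs "Jordan_Normal_Form.Determinant"
begin

text \<open>In the variables \<open>x = q^\<Lambda>\<close> the weight of a plane partition is a product of powers \<open>x^c\<close> with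
  \<open>c = \<eta>\<close>, \<open>\<alpha> + (\<eta> + \<theta>)/2\<close> or \<open>\<theta>\<close> according to the sign of the diagonal. If independent
  variables \<open>u\<close> with density \<open>c u^(c-1)\<close> on \<open>(0,1)\<close> are rounded to \<open>q^n\<close>, \<open>n = \<lfloor>log\<^sub>q u\<rfloor>\<close>, then \<open>n\<close>
  is exactly geometric with ratio \<open>q^c\<close>; hence the plane-partition measure is the law of the rounded
  array conditioned on being a plane partition, and by dominated convergence the limit is the law
  of the array \<open>u\<close> conditioned on being strictly increasing along rows and columns.

  For the marginal of a slice, the other slices are integrated out one by one from both ends.
  Each step integrates a Vandermonde determinant in \<open>x^\<gamma>\<close> times a weight over points interlacing with
  the next slice (a Dixon-Anderson integral): the determinant of the integrals over consecutive
  intervals is again a Vandermonde determinant, now in the next slice.\<close>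

section \<open>Determinants\<close>

text \<open>Why two different Vandermonde determinants arise: left of the centre the one-point
  weight u^(\<eta>-1) du is d(u^\<eta>)/\<eta>, so a chain started at the left end, where a slice
  has one entry, reproduces Vandermonde determinants in x^\<eta>; a chain started at the right end
  does so in x^\<theta>. Beyond the centre the weights no longer match the determinant, but there
  the intervals reach the fixed end 0, and an arbitrary positive exponent b can be handled. The
  obstacle is that neighbouring slices may differ in length by one: points and intervals match in
  number only after 0, 1 or both are added as fixed end points. This gives four kinds of steps, each
  needing its own polynomial basis or boundary convention. Constants are carried along only as
  positive numbers, since the density is claimed up to a factor. For the same reason the partition
  function is never evaluated: the normalisation of the geometric variables cancels in the quotient
  that defines the expectation. What the conditioning does require is that the limiting event has
  positive probability and that ties between entries are null.\<close>

abbreviation (input) mdet :: "'a::comm_ring_1 mat \<Rightarrow> 'a" where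
  "mdet \<equiv> Determinant.det"

lemma det_lower_triangular_prod:
  fixes A :: "'a :: idom mat"
  assumes "A \<in> carrier_mat n n" and "\<And>i j. i < j \<Longrightarrow> j < n \<Longrightarrow> A $$ (i, j) = 0"
  shows "mdet A = (\<Prod>i<n. A $$ (i, i))"
  using det_lower_triangular[of n A] assms
  by (simp add: diag_mat_def prod.list_conv_set_nth atLeast0LessThan)

lemma det_upper_triangular_prod:
  fixes A :: "'a :: idom mat"
  assumes "A \<in> carrier_mat n n" and "\<And>i j. j < i \<Longrightarrow> i < n \<Longrightarrow> A $$ (i, j) = 0"
  shows "mdet A = (\<Prod>i<n. A $$ (i, i))"
  using det_upper_triangular[of A n] assms
  by (auto simp: diag_mat_def prod.list_conv_set_nth atLeast0LessThan)

definition vandermonde :: "nat \<Rightarrow> (nat \<Rightarrow> real) \<Rightarrow> real" where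
  "vandermonde n u = (\<Prod>j<n. \<Prod>i<j. u j - u i)"

text \<open>The matrix of values is the monomial matrix times the matrix of coefficients. The degree
  bound makes the latter upper triangular, so only its diagonal enters the determinant.\<close>

lemma det_poly_basis_change:
  fixes p :: "nat \<Rightarrow> real poly"
  assumes deg: "\<And>j. j < n \<Longrightarrow> degree (p j) \<le> j"
  shows "mdet (mat n n (\<lambda>(i, j). poly (p j) (u i))) =
    mdet (mat n n (\<lambda>(i, j). u i ^ j)) * (\<Prod>j<n. coeff (p j) j)"
proof -
  define V where "V = mat n n (\<lambda>(i, j). u i ^ j)"
  define T where "T = mat n n (\<lambda>(k, j). coeff (p j) k)"
  have "mat n n (\<lambda>(i, j). poly (p j) (u i)) = V * T"
  proof (rule eq_matI)
    fix i j assume ij: "i < dim_row (V * T)" "j < dim_col (V * T)"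
    then have ij: "i < n" "j < n" by (auto simp: V_def T_def)
    have "poly (p j) (u i) = (\<Sum>k\<le>j. coeff (p j) k * u i ^ k)"
      unfolding poly_altdef
      by (rule sum.mono_neutral_left) (use deg[OF ij(2)] in \<open>auto simp: coeff_eq_0\<close>)
    also have "\<dots> = (\<Sum>k<n. coeff (p j) k * u i ^ k)"
      by (rule sum.mono_neutral_left) (use ij deg[OF ij(2)] in \<open>auto intro: coeff_eq_0\<close>)
    finally show "mat n n (\<lambda>(i, j). poly (p j) (u i)) $$ (i, j) = (V * T) $$ (i, j)"
      using ij by (simp add: V_def T_def scalar_prod_def atLeast0LessThan mult.commute)
  qed (auto simp: V_def T_def)
  moreover have "mdet (V * T) = mdet V * mdet T"
    by (rule det_mult) (auto simp: V_def T_def)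
  moreover have "mdet T = (\<Prod>j<n. coeff (p j) j)"
    by (subst det_upper_triangular_prod[where n = n])
      (auto simp: T_def intro!: coeff_eq_0 le_less_trans[OF deg])
  ultimately show ?thesis by (simp add: V_def)
qed

text \<open>The basis change is read backwards for the Newton polynomials with zeros u_0, ...,
  u_(j-1). Their value matrix is lower triangular with the factors of the Vandermonde product on its
  diagonal, and they are monic, so nothing is lost in the change.\<close>

lemma det_vandermonde:
  "mdet (mat n n (\<lambda>(i, j). u i ^ j)) = vandermonde n u"
proof -
  define p where "p j = (\<Prod>k<j. [:- u k, 1:])" for j
  have deg: "degree (p j) = j" for j
    unfolding p_def by (subst degree_prod_eq_sum_degree) auto
  have lc: "coeff (p j) j = 1" for j
    using lead_coeff_prod[of "\<lambda>k. [:- u k, 1:]" "{..<j}"] deg[of j] by (simp add: p_def)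
  have "mdet (mat n n (\<lambda>(i, j). poly (p j) (u i))) = (\<Prod>i<n. poly (p i) (u i))"
    by (subst det_lower_triangular_prod[where n = n]) (auto simp: p_def poly_prod)
  then show ?thesis
    using det_poly_basis_change[of n p u] deg lc
    by (simp add: p_def poly_prod vandermonde_def)
qed

lemma det_poly_basis:
  fixes p :: "nat \<Rightarrow> real poly"
  assumes "\<And>j. j < n \<Longrightarrow> degree (p j) \<le> j"
  shows "mdet (mat n n (\<lambda>(i, j). poly (p j) (u i))) =
    vandermonde n u * (\<Prod>j<n. coeff (p j) j)"
  using det_poly_basis_change[OF assms] det_vandermonde by simp

text \<open>In the integrals below the row factors carry the weight of a single point and the column
  factors carry the constants produced by taking primitives.\<close>

lemma det_scale:
  fixes A :: "nat \<Rightarrow> nat \<Rightarrow> real"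
  shows "mdet (mat n n (\<lambda>(i, j). r i * A i j * c j)) =
    (\<Prod>i<n. r i) * (\<Prod>j<n. c j) * mdet (mat n n (\<lambda>(i, j). A i j))"
proof -
  define R where "R = mat n n (\<lambda>(i, j). if i = j then r i else 0)"
  define B where "B = mat n n (\<lambda>(i, j). A i j)"
  define C where "C = mat n n (\<lambda>(i, j). if i = j then c j else 0)"
  have carrier: "R \<in> carrier_mat n n" "B \<in> carrier_mat n n" "C \<in> carrier_mat n n"
    by (auto simp: R_def B_def C_def)
  have "mat n n (\<lambda>(i, j). r i * A i j * c j) = R * (B * C)"
    by (rule eq_matI)
      (auto simp: R_def B_def C_def scalar_prod_def if_distrib[where f="\<lambda>x. x * _"]
        if_distrib[where f="\<lambda>x. _ * x"] cong: if_cong)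
  then have "mdet (mat n n (\<lambda>(i, j). r i * A i j * c j)) =
      mdet R * (mdet B * mdet C)"
    using det_mult[OF carrier(1) mult_carrier_mat[OF carrier(2,3)]] det_mult[OF carrier(2,3)] by simp
  moreover have "mdet R = (\<Prod>i<n. r i)"
    by (subst det_upper_triangular_prod[where n = n]) (auto simp: R_def)
  moreover have "mdet C = (\<Prod>j<n. c j)"
    by (subst det_upper_triangular_prod[where n = n]) (auto simp: C_def)
  ultimately show ?thesis by (simp add: B_def)
qed

text \<open>Increments over consecutive intervals arise from the values at the right end points
  through a bidiagonal matrix with unit diagonal; the first row fits this pattern because the
  primitives vanish at the left end.\<close>

lemma det_row_differences:
  fixes F :: "nat \<Rightarrow> nat \<Rightarrow> real"
  assumes "\<And>j. j < n \<Longrightarrow> F 0 j = 0"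
  shows "mdet (mat n n (\<lambda>(i, j). F (Suc i) j - F i j)) =
    mdet (mat n n (\<lambda>(i, j). F (Suc i) j))"
proof -
  define D where "D = mat n n (\<lambda>(i, k). if k = i then 1 else if Suc k = i then - 1 else 0 :: real)"
  define B where "B = mat n n (\<lambda>(i, j). F (Suc i) j)"
  have "mat n n (\<lambda>(i, j). F (Suc i) j - F i j) = D * B"
  proof (rule eq_matI)
    fix i j assume "i < dim_row (D * B)" "j < dim_col (D * B)"
    then have ij: "i < n" "j < n" by (auto simp: D_def B_def)
    have "(D * B) $$ (i, j) =
      (\<Sum>k\<in>{0..<n}. (if k = i then 1 else if Suc k = i then - 1 else 0) * F (Suc k) j)"
      using ij by (simp add: D_def B_def scalar_prod_def)
    also have "\<dots> = (\<Sum>k\<in>{0..<n}. (if k = i then F (Suc k) j else 0) - (if Suc k = i then F (Suc k) j else 0))"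
      by (rule sum.cong) auto
    also have "\<dots> = F (Suc i) j - (\<Sum>k\<in>{0..<n}. (if Suc k = i then F (Suc k) j else 0))"
      using ij by (simp add: sum_subtractf)
    also have "(\<Sum>k\<in>{0..<n}. (if Suc k = i then F (Suc k) j else 0)) = F i j"
    proof (cases i)
      case 0 then show ?thesis using assms ij by simp
    next
      case (Suc m) then show ?thesis using ij by simp
    qed
    finally show "mat n n (\<lambda>(i, j). F (Suc i) j - F i j) $$ (i, j) = (D * B) $$ (i, j)"
      using ij by simp
  qed (auto simp: D_def B_def)
  moreover have "mdet D = 1"
    by (subst det_lower_triangular_prod[where n = n]) (auto simp: D_def)
  ultimately show ?thesis
    using det_mult[of D n B] by (simp add: D_def B_def)
qed

text \<open>Mirror image for primitives that vanish at the right end. The bidiagonal matrix now has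
  diagonal -1, and the absolute value absorbs the sign (-1)^n.\<close>

lemma det_row_differences':
  fixes F :: "nat \<Rightarrow> nat \<Rightarrow> real"
  assumes "\<And>j. j < n \<Longrightarrow> F n j = 0"
  shows "\<bar>mdet (mat n n (\<lambda>(i, j). F (Suc i) j - F i j))\<bar> =
    \<bar>mdet (mat n n (\<lambda>(i, j). F i j))\<bar>"
proof -
  define D where "D = mat n n (\<lambda>(i, k). if k = i then - 1 else if k = Suc i then 1 else 0 :: real)"
  define B where "B = mat n n (\<lambda>(i, j). F i j)"
  have "mat n n (\<lambda>(i, j). F (Suc i) j - F i j) = D * B"
  proof (rule eq_matI)
    fix i j assume "i < dim_row (D * B)" "j < dim_col (D * B)"
    then have ij: "i < n" "j < n" by (auto simp: D_def B_def)
    have "(D * B) $$ (i, j) =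
      (\<Sum>k\<in>{0..<n}. (if k = i then - 1 else if k = Suc i then 1 else 0) * F k j)"
      using ij by (simp add: D_def B_def scalar_prod_def)
    also have "\<dots> = (\<Sum>k\<in>{0..<n}. (if k = Suc i then F k j else 0) - (if k = i then F k j else 0))"
      by (rule sum.cong) auto
    also have "\<dots> = (if Suc i < n then F (Suc i) j else 0) - F i j"
      using ij by (simp add: sum_subtractf)
    also have "\<dots> = F (Suc i) j - F i j"
      using ij assms[of j] by (cases "Suc i = n") auto
    finally show "mat n n (\<lambda>(i, j). F (Suc i) j - F i j) $$ (i, j) = (D * B) $$ (i, j)"
      using ij by simp
  qed (auto simp: D_def B_def)
  moreover have "mdet D = (\<Prod>i<n. - 1)"
    by (subst det_upper_triangular_prod[where n = n]) (auto simp: D_def)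
  ultimately show ?thesis
    using det_mult[of D n B] by (simp add: D_def B_def abs_mult power_abs)
qed

text \<open>Laplace expansion along the last row. This is how integrating out n + 1 points leaves a
  determinant in only n points: at the end point 1 all primitives but one vanish.\<close>

lemma det_single_entry_last_row:
  fixes G :: "nat \<Rightarrow> nat \<Rightarrow> real"
  assumes "\<And>j. j < n \<Longrightarrow> G n (Suc j) = 0"
  shows "\<bar>mdet (mat (Suc n) (Suc n) (\<lambda>(i, j). G i j))\<bar> =
    \<bar>G n 0\<bar> * \<bar>mdet (mat n n (\<lambda>(i, j). G i (Suc j)))\<bar>"
proof -
  let ?A = "mat (Suc n) (Suc n) (\<lambda>(i, j). G i j)"
  have "mdet ?A = (\<Sum>j<Suc n. ?A $$ (n, j) * cofactor ?A n j)"
    by (rule laplace_expansion_row) auto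
  also have "\<dots> = (\<Sum>j\<in>{0}. ?A $$ (n, j) * cofactor ?A n j)"
  proof (rule sum.mono_neutral_right)
    show "\<forall>j\<in>{..<Suc n} - {0}. ?A $$ (n, j) * cofactor ?A n j = 0"
    proof
      fix j assume "j \<in> {..<Suc n} - {0}"
      then obtain j' where "j = Suc j'" "j' < n" by (cases j) auto
      then show "?A $$ (n, j) * cofactor ?A n j = 0" using assms by simp
    qed
  qed auto
  also have "\<dots> = G n 0 * cofactor ?A n 0" by simp
  also have "mat_delete ?A n 0 = mat n n (\<lambda>(i, j). G i (Suc j))"
    by (rule eq_matI) (auto simp: mat_delete_def)
  then have "cofactor ?A n 0 = (- 1) ^ n * mdet (mat n n (\<lambda>(i, j). G i (Suc j)))"
    by (simp add: cofactor_def)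
  finally show ?thesis by (simp add: abs_mult power_abs)
qed

section \<open>Integrals over interlacing points\<close>

abbreviation (input) lebPi :: "'i set \<Rightarrow> ('i \<Rightarrow> real) measure" where
  "lebPi J \<equiv> PiM J (\<lambda>_. lborel)"

lemma product_sigma_finite_lborel: "product_sigma_finite (\<lambda>_. lborel)"
  by (simp add: product_sigma_finite_def lborel.sigma_finite_measure_axioms)

text \<open>Row i of the matrix depends on the coordinate \<open>e i\<close> alone, so each term of
  the Leibniz formula is a product of functions of separate variables and Fubini applies to it
  factor by factor. The injection \<open>e\<close> places the n variables inside a larger index set,
  later the set of all positions of the array.\<close>

lemma
  fixes g :: "nat \<Rightarrow> nat \<Rightarrow> real \<Rightarrow> real" and e :: "nat \<Rightarrow> 'i"
  assumes e: "inj_on e {..<n}"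
    and g: "\<And>i j. i < n \<Longrightarrow> j < n \<Longrightarrow> integrable lborel (g i j)"
  shows integrable_det:
      "integrable (lebPi (e ` {..<n}))
         (\<lambda>y. mdet (mat n n (\<lambda>(i, j). g i j (y (e i)))))" (is ?A)
    and integral_det:
      "(\<integral>y. mdet (mat n n (\<lambda>(i, j). g i j (y (e i)))) \<partial>lebPi (e ` {..<n})) =
        mdet (mat n n (\<lambda>(i, j). \<integral>x. g i j x \<partial>lborel))" (is ?B)
proof -
  interpret product_sigma_finite "\<lambda>_::'i. lborel :: real measure"
    by (rule product_sigma_finite_lborel)
  define K where "K = e ` {..<n}"
  define e' where "e' = the_inv_into {..<n} e"
  have e': "e' (e i) = i" if "i < n" for i
    using the_inv_into_f_f[OF e] that by (simp add: e'_def)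
  have K: "finite K" by (simp add: K_def)
  have prod_eq: "(\<Prod>i = 0..<n. h i (y (e i))) = (\<Prod>k\<in>K. h (e' k) (y k))"
    for h :: "nat \<Rightarrow> real \<Rightarrow> real" and y
    unfolding K_def using e by (subst prod.reindex) (auto simp: e' atLeast0LessThan)
  have prod_eq': "(\<Prod>i = 0..<n. h i) = (\<Prod>k\<in>K. h (e' k))" for h :: "nat \<Rightarrow> real"
    unfolding K_def using e by (subst prod.reindex) (auto simp: e' atLeast0LessThan)
  have det: "mdet (mat n n (\<lambda>(i, j). g i j (y (e i)))) =
     (\<Sum>p | p permutes {0..<n}. of_int (sign p) * (\<Prod>k\<in>K. g (e' k) (p (e' k)) (y k)))" for y
  proof -
    have "mdet (mat n n (\<lambda>(i, j). g i j (y (e i)))) =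
     (\<Sum>p | p permutes {0..<n}. of_int (sign p) * (\<Prod>i = 0..<n. g i (p i) (y (e i))))"
      by (subst det_def'[where n = n])
        (auto intro!: sum.cong prod.cong arg_cong2[where f = "(*)"] simp: permutes_in_image)
    also have "\<dots> = (\<Sum>p | p permutes {0..<n}. of_int (sign p) * (\<Prod>k\<in>K. g (e' k) (p (e' k)) (y k)))"
      by (intro sum.cong refl arg_cong2[where f = "(*)"]) (rule prod_eq)
    finally show ?thesis .
  qed
  have int: "integrable lborel (g (e' k) (p (e' k)))" if p: "p permutes {0..<n}" and k: "k \<in> K" for p k
  proof -
    obtain i where i: "i < n" "k = e i" using k by (auto simp: K_def)
    then have "p i < n" using permutes_in_image[OF p, of i] by simp
    then show ?thesis using i g by (simp add: e')
  qed
  show ?A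
    unfolding det K_def[symmetric]
    by (intro Bochner_Integration.integrable_sum integrable_mult_right product_integrable_prod K) (auto intro: int)
  have "(\<integral>y. mdet (mat n n (\<lambda>(i, j). g i j (y (e i)))) \<partial>lebPi K) =
     (\<Sum>p | p permutes {0..<n}. of_int (sign p) *
        (\<integral>y. (\<Prod>k\<in>K. g (e' k) (p (e' k)) (y k)) \<partial>lebPi K))"
    unfolding det
    by (subst Bochner_Integration.integral_sum)
      (auto intro!: integrable_mult_right product_integrable_prod K int)
  also have "\<dots> = (\<Sum>p | p permutes {0..<n}. of_int (sign p) *
        (\<Prod>k\<in>K. \<integral>x. g (e' k) (p (e' k)) x \<partial>lborel))"
    by (intro sum.cong refl arg_cong2[where f = "(*)"] product_integral_prod K) (auto intro: int)
  also have "\<dots> = (\<Sum>p | p permutes {0..<n}. of_int (sign p) *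
        (\<Prod>i = 0..<n. \<integral>x. g i (p i) x \<partial>lborel))"
    by (intro sum.cong refl arg_cong2[where f = "(*)"]) (rule prod_eq'[symmetric])
  also have "\<dots> = mdet (mat n n (\<lambda>(i, j). \<integral>x. g i j x \<partial>lborel))"
    by (subst det_def'[where n = n])
      (auto intro!: sum.cong prod.cong arg_cong2[where f = "(*)"] simp: permutes_in_image)
  finally show ?B by (simp add: K_def)
qed

text \<open>Since \<open>\<Phi>\<close> is nonnegative on the box, the signs of \<open>c\<close> and of the determinant never have to be
  tracked.\<close>

lemma nn_integral_interlacing_det:
  fixes f :: "nat \<Rightarrow> real \<Rightarrow> real" and e :: "nat \<Rightarrow> 'i"
  assumes e: "inj_on e {..<n}" and c: "c \<noteq> 0"
    and int: "\<And>i j. i < n \<Longrightarrow> j < n \<Longrightarrow>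
      set_integrable lborel {a i<..<a (Suc i)} (f j) \<and>
      (LINT x:{a i<..<a (Suc i)}|lborel. f j x) = F (Suc i) j - F i j"
    and det: "\<And>y. (\<And>i. i < n \<Longrightarrow> a i < y (e i) \<and> y (e i) < a (Suc i)) \<Longrightarrow>
      mdet (mat n n (\<lambda>(i, j). f j (y (e i)))) = c * \<Phi> y \<and> 0 \<le> \<Phi> y"
  shows "(\<integral>\<^sup>+y. ennreal ((\<Prod>i<n. indicator {a i<..<a (Suc i)} (y (e i))) * \<Phi> y) \<partial>lebPi (e ` {..<n})) =
    ennreal (\<bar>mdet (mat n n (\<lambda>(i, j). F (Suc i) j - F i j))\<bar> / \<bar>c\<bar>)"
proof -
  let ?P = "lebPi (e ` {..<n})"
  let ?I = "\<lambda>y. (\<Prod>i<n. indicator {a i<..<a (Suc i)} (y (e i)) :: real)"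
  \<comment> \<open>The restriction of each coordinate to its interval is moved into its own row, so
    that the box integral becomes an integral over the full product space.\<close>
  define g where "g i j x = indicator {a i<..<a (Suc i)} x * f j x" for i j x
  have g: "integrable lborel (g i j)" "(\<integral>x. g i j x \<partial>lborel) = F (Suc i) j - F i j"
    if "i < n" "j < n" for i j
    using int[OF that] by (auto simp: set_integrable_def set_lebesgue_integral_def g_def[abs_def])
  have eq: "mdet (mat n n (\<lambda>(i, j). g i j (y (e i)))) = c * (?I y * \<Phi> y)" for y
  proof -
    have *: "mdet (mat n n (\<lambda>(i, j). g i j (y (e i)))) =
       ?I y * mdet (mat n n (\<lambda>(i, j). f j (y (e i))))"
      using det_scale[of n "\<lambda>i. indicator {a i<..<a (Suc i)} (y (e i))" "\<lambda>i j. f j (y (e i))" "\<lambda>_. 1"]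
      by (simp add: g_def)
    show ?thesis
    proof (cases "\<forall>i<n. a i < y (e i) \<and> y (e i) < a (Suc i)")
      case True
      then show ?thesis unfolding * using det[of y] by simp
    next
      case False
      then obtain k where "k < n" "y (e k) \<notin> {a k<..<a (Suc k)}" by auto
      then have I0: "?I y = 0" by (auto intro!: prod_zero simp: indicator_def)
      show ?thesis unfolding * I0 by simp
    qed
  qed
  have pos: "0 \<le> ?I y * \<Phi> y" for y
  proof (cases "\<forall>i<n. a i < y (e i) \<and> y (e i) < a (Suc i)")
    case True
    then show ?thesis using det[of y] by (auto intro!: mult_nonneg_nonneg prod_nonneg)
  next
    case False
    then obtain k where "k < n" "y (e k) \<notin> {a k<..<a (Suc k)}" by auto
    then have I0: "?I y = 0" by (auto intro!: prod_zero simp: indicator_def)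
    show ?thesis unfolding I0 by simp
  qed
  have "integrable ?P (\<lambda>y. c * (?I y * \<Phi> y))"
    using integrable_det[OF e, of g] g(1) unfolding eq by blast
  then have intI: "integrable ?P (\<lambda>y. ?I y * \<Phi> y)"
    using c by simp
  have "c * (\<integral>y. ?I y * \<Phi> y \<partial>?P) = mdet (mat n n (\<lambda>(i, j). \<integral>x. g i j x \<partial>lborel))"
    using integral_det[OF e, of g] g(1) unfolding eq by simp
  also have "mat n n (\<lambda>(i, j). \<integral>x. g i j x \<partial>lborel) = mat n n (\<lambda>(i, j). F (Suc i) j - F i j)"
    by (rule eq_matI) (auto simp: g)
  finally have "\<bar>c * (\<integral>y. ?I y * \<Phi> y \<partial>?P)\<bar> = \<bar>mdet (mat n n (\<lambda>(i, j). F (Suc i) j - F i j))\<bar>"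
    by (rule arg_cong)
  moreover have "0 \<le> (\<integral>y. ?I y * \<Phi> y \<partial>?P)"
    by (rule Bochner_Integration.integral_nonneg) (rule pos)
  ultimately have "\<bar>c\<bar> * (\<integral>y. ?I y * \<Phi> y \<partial>?P) = \<bar>mdet (mat n n (\<lambda>(i, j). F (Suc i) j - F i j))\<bar>"
    unfolding abs_mult by (simp only: abs_of_nonneg)
  then have "(\<integral>y. ?I y * \<Phi> y \<partial>?P) = \<bar>mdet (mat n n (\<lambda>(i, j). F (Suc i) j - F i j))\<bar> / \<bar>c\<bar>"
    using c by (simp add: field_simps)
  then show ?thesis
    using nn_integral_eq_integral[OF intI] pos by simp
qed

text \<open>For b < 1 the integrand is unbounded near 0. Integrability on (0,1) follows from the
  fundamental theorem for nonnegative functions, with the primitive x^b / b and its one-sided limits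
  0 and 1/b.\<close>

lemma set_integrable_powr:
  fixes b :: real
  assumes "0 < b" "0 \<le> l" "u \<le> 1"
  shows "set_integrable lborel {l<..<u} (\<lambda>x. x powr (b - 1))"
proof -
  have "set_integrable lborel (einterval (ereal 0) (ereal 1)) (\<lambda>x. x powr (b - 1))"
  proof (rule interval_integral_FTC_nonneg(1)[where F = "\<lambda>x. x powr b / b" and A = 0 and B = "1/b"])
    show "((((\<lambda>x. x powr b / b) \<circ> real_of_ereal) \<longlongrightarrow> 0) (at_right (ereal 0)))"
      unfolding ereal_tendsto_simps using assms
      by (auto intro!: tendsto_eq_intros tendsto_powr2[where a=0, simplified] eventually_at_rightI[of 0 1])
    show "((((\<lambda>x. x powr b / b) \<circ> real_of_ereal) \<longlongrightarrow> 1/b) (at_left (ereal 1)))"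
      unfolding ereal_tendsto_simps using assms
      by (auto intro!: tendsto_eq_intros)
    show "DERIV (\<lambda>x. x powr b / b) x :> x powr (b - 1)" if "ereal 0 < ereal x" "ereal x < ereal 1" for x
      using that assms by (auto intro!: derivative_eq_intros)
    show "isCont (\<lambda>x. x powr (b - 1)) x" if "ereal 0 < ereal x" "ereal x < ereal 1" for x
      using that by (auto intro!: continuous_intros)
  qed auto
  then have "set_integrable lborel {0<..<1} (\<lambda>x. x powr (b - 1))"
    by (simp add: einterval_eq)
  then show ?thesis
    by (rule set_integrable_subset) (use assms in auto)
qed

lemma set_integrable_dominated_powr:
  fixes f :: "real \<Rightarrow> real"
  assumes "0 < b" "0 \<le> l" "u \<le> 1" and [measurable]: "f \<in> borel_measurable borel"
    and bd: "\<And>x. l < x \<Longrightarrow> x < u \<Longrightarrow> \<bar>f x\<bar> \<le> B * x powr (b - 1)"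
  shows "set_integrable lborel {l<..<u} f"
proof -
  have "set_integrable lborel {l<..<u} (\<lambda>x. B * x powr (b - 1))"
    using set_integrable_powr[OF assms(1-3)] by simp
  then show ?thesis
    by (rule set_integrable_bound)
      (auto simp: set_borel_measurable_def intro!: AE_I2 order_trans[OF bd])
qed

text \<open>The derivative is asked for only inside the interval and continuity up to its ends,
  because primitives such as x^b with b < 1 are not differentiable at 0. The gauge integral allows
  this, and the assumed integrability identifies it with the Lebesgue integral.\<close>

lemma set_integral_FTC_Ioo:
  fixes f F :: "real \<Rightarrow> real"
  assumes "l < u" and int: "set_integrable lborel {l<..<u} f"
    and F: "\<And>x. l < x \<Longrightarrow> x < u \<Longrightarrow> (F has_field_derivative f x) (at x)"
    and cont: "continuous_on {l..u} F"
  shows "(LINT x:{l<..<u}|lborel. f x) = F u - F l"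
proof -
  have "(f has_integral (F u - F l)) {l..u}"
    using assms by (intro fundamental_theorem_of_calculus_interior)
      (auto simp: has_real_derivative_iff_has_vector_derivative[symmetric])
  then have "(f has_integral (F u - F l)) {l<..<u}"
    by (simp add: has_integral_Icc_iff_Ioo)
  moreover have "(f has_integral (LINT x:{l<..<u}|lborel. f x)) {l<..<u}"
    using set_borel_integral_eq_integral[OF int] by (simp add: has_integral_iff)
  ultimately show ?thesis by (rule has_integral_unique[symmetric])
qed

text \<open>The end points \<open>a\<close> mix entries of the neighbouring slice with the fixed
  ends 0 and 1, so that one form of integral serves all interlacing patterns.\<close>

abbreviation (input) box_integral ::
  "(nat \<Rightarrow> 'i) \<Rightarrow> nat \<Rightarrow> (nat \<Rightarrow> real) \<Rightarrow> real \<Rightarrow> (real \<Rightarrow> real) \<Rightarrow> ennreal" where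
  "box_integral e n a \<gamma> w \<equiv> (\<integral>\<^sup>+y. ennreal ((\<Prod>i<n. indicator {a i<..<a (Suc i)} (y (e i))) *
     (vandermonde n (\<lambda>i. y (e i) powr \<gamma>) * (\<Prod>i<n. w (y (e i))))) \<partial>lebPi (e ` {..<n}))"

section \<open>Order of interlacing points and positivity of Vandermonde products\<close>

lemma chain_less:
  fixes a :: "nat \<Rightarrow> real"
  assumes "\<And>i. i < n \<Longrightarrow> a i < a (Suc i)" "i < j" "j \<le> n"
  shows "a i < a j"
proof -
  have "a i < a (i + Suc d)" if "i + Suc d \<le> n" for d
    using that
  proof (induction d)
    case (Suc d)
    then show ?case using assms(1)[of "i + Suc d"] by fastforce
  qed (use assms(1)[of i] in auto)
  from this[of "j - Suc i"] show ?thesis using assms by auto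
qed

lemma chain_le:
  fixes a :: "nat \<Rightarrow> real"
  assumes "\<And>i. i < n \<Longrightarrow> a i < a (Suc i)" "i \<le> j" "j \<le> n"
  shows "a i \<le> a j"
  using chain_less[of n a i j, OF assms(1)] assms by (cases "i = j") auto

lemma interlacing_less:
  fixes a z :: "nat \<Rightarrow> real"
  assumes "\<And>i. i < n \<Longrightarrow> a i < z i \<and> z i < a (Suc i)" "i < j" "j < n"
  shows "z i < z j"
proof -
  have "a k < a (Suc k)" if "k < n" for k using assms(1)[OF that] by linarith
  then have "a (Suc i) \<le> a j" using assms by (intro chain_le[of n]) auto
  then show ?thesis using assms(1)[of i] assms(1)[of j] assms(2,3) by linarith
qed

lemma vandermonde_pos:
  assumes "\<And>i j. i < j \<Longrightarrow> j < n \<Longrightarrow> u i < u j"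
  shows "0 < vandermonde n u"
  unfolding vandermonde_def using assms by (auto intro!: prod_pos)

lemma vandermonde_Suc: "vandermonde (Suc n) u = vandermonde n u * (\<Prod>i<n. u n - u i)"
  by (simp add: vandermonde_def)

text \<open>In the following three integrals the polynomials multiplying the weight are chosen with
  primitives that vanish at the fixed end points, so the determinant of the increments collapses
  to a Vandermonde determinant in the free points.\<close>

lemma nn_integral_interlacing_right:
  fixes \<gamma> :: real and K n :: nat
  assumes \<gamma>: "0 < \<gamma>"
  obtains C where "0 < C" and
    "\<And>a (e :: nat \<Rightarrow> 'i). inj_on e {..<n} \<Longrightarrow> (\<And>i. i < n \<Longrightarrow> a i < a (Suc i)) \<Longrightarrow> 0 \<le> a 0 \<Longrightarrow> a n \<le> 1 \<Longrightarrow>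
      box_integral e n a \<gamma> (\<lambda>u. u powr (\<gamma> - 1) * (a n powr \<gamma> - u powr \<gamma>) ^ K) =
      ennreal (C * (vandermonde n (\<lambda>i. a i powr \<gamma>) * (\<Prod>i<n. (a n powr \<gamma> - a i powr \<gamma>) ^ Suc K)))"
proof
  \<comment> \<open>Product of the leading coefficients of the polynomials (c - x)^j, the basis used
    here; only its absolute value 1 survives.\<close>
  define s :: real where "s = (\<Prod>j<n. (-1) ^ j)"
  have s: "s \<noteq> 0" "\<bar>s\<bar> = 1" by (auto simp: s_def abs_prod power_abs)
  \<comment> \<open>One factor per column: up to sign, the primitive of x^(\<gamma>-1) (c -
    x^\<gamma>)^(K+j) is (c - x^\<gamma>)^(K+j+1) divided by \<gamma> (K+j+1).\<close>
  define C where "C = (\<Prod>j<n. 1 / (\<gamma> * real (K + j + 1)))"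
  show C: "0 < C" unfolding C_def using \<gamma> by (auto intro!: prod_pos divide_pos_pos mult_pos_pos)
  fix a :: "nat \<Rightarrow> real" and e :: "nat \<Rightarrow> 'i"
  assume e: "inj_on e {..<n}" and a: "\<And>i. i < n \<Longrightarrow> a i < a (Suc i)" and a0: "0 \<le> a 0" and a1: "a n \<le> 1"
  define c where "c = a n powr \<gamma>"
  have a_less: "a i < a j" if "i < j" "j \<le> n" for i j using chain_less[of n a i j, OF a] that by simp
  have a_pos: "0 \<le> a i" "a i \<le> a n" if "i \<le> n" for i
    using chain_le[of n a 0 i, OF a] chain_le[of n a i n, OF a] that a0 by auto
  have c: "0 \<le> c" "c \<le> 1"
    using a1 a_pos[of n] \<gamma> by (auto simp: c_def powr_le1)
  have le_c: "x powr \<gamma> \<le> c" if "0 \<le> x" "x \<le> a n" for x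
    unfolding c_def using that \<gamma> by (intro powr_mono2) auto
  define f where "f j x = x powr (\<gamma> - 1) * (c - x powr \<gamma>) ^ (K + j)" for j x
  define G where "G j x = - (1 / (\<gamma> * real (K + j + 1))) * (c - x powr \<gamma>) ^ (K + j + 1)" for j x
  have det_pow: "mdet (mat n n (\<lambda>(i, j). (c - u i) ^ j)) = vandermonde n u * s" for u
  proof -
    have "mdet (mat n n (\<lambda>(i, j). poly ([:c, -1:] ^ j) (u i))) =
        vandermonde n u * (\<Prod>j<n. coeff ([:c, -1:] ^ j) j)"
      by (rule det_poly_basis) (simp add: degree_power_eq)
    moreover have "coeff ([:c, -1:] ^ j) j = (- 1) ^ j" for j
      using lead_coeff_power[of "[:c, -1:]" j] by (simp add: degree_power_eq)
    ultimately show ?thesis by (simp add: s_def)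
  qed
  have "box_integral e n a \<gamma> (\<lambda>u. u powr (\<gamma> - 1) * (c - u powr \<gamma>) ^ K) =
      ennreal (\<bar>mdet (mat n n (\<lambda>(i, j). G j (a (Suc i)) - G j (a i)))\<bar> / \<bar>s\<bar>)"
  proof (rule nn_integral_interlacing_det[OF e s(1), where f = f])
    fix i j assume ij: "i < n" "j < n"
    have int: "set_integrable lborel {a i<..<a (Suc i)} (f j)"
    proof (rule set_integrable_dominated_powr[OF \<gamma>, where B = 1])
      show "0 \<le> a i" "a (Suc i) \<le> 1" using a_pos[of i] a_pos[of "Suc i"] ij a1 by auto
      show "f j \<in> borel_measurable borel" unfolding f_def by measurable
      fix x assume x: "a i < x" "x < a (Suc i)"
      then have "0 \<le> x" "x \<le> a n" using a_pos[of i] a_pos[of "Suc i"] ij by auto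
      then have "x powr \<gamma> \<le> c" by (rule le_c)
      then have "\<bar>c - x powr \<gamma>\<bar> ^ (K + j) \<le> 1"
        using c powr_ge_zero[of x \<gamma>] by (intro power_le_one) linarith+
      then show "\<bar>f j x\<bar> \<le> 1 * x powr (\<gamma> - 1)"
        by (auto simp: f_def abs_mult power_abs intro!: mult_left_le)
    qed
    have "(LINT x:{a i<..<a (Suc i)}|lborel. f j x) = G j (a (Suc i)) - G j (a i)"
    proof (rule set_integral_FTC_Ioo[OF a[OF ij(1)] int])
      show "continuous_on {a i..a (Suc i)} (G j)"
        unfolding G_def using a_pos[of i] ij \<gamma>
        by (intro continuous_intros continuous_on_powr') auto
      fix x assume "a i < x" "x < a (Suc i)"
      then have "0 < x" using a_pos[of i] ij by auto
      then have "((\<lambda>x. (c - x powr \<gamma>) ^ Suc (K + j)) has_field_derivative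
          real (Suc (K + j)) * (c - x powr \<gamma>) ^ (K + j) * (- (\<gamma> * x powr (\<gamma> - 1)))) (at x)"
        by (auto intro!: derivative_eq_intros simp del: power_Suc)
      from DERIV_cmult[OF this, of "- (1 / (\<gamma> * real (K + j + 1)))"]
      show "(G j has_field_derivative f j x) (at x)"
        unfolding G_def f_def using \<gamma> by (simp add: mult_ac)
    qed
    then show "set_integrable lborel {a i<..<a (Suc i)} (f j) \<and>
      (LINT x:{a i<..<a (Suc i)}|lborel. f j x) = G j (a (Suc i)) - G j (a i)"
      using int by simp
  next
    fix y :: "'i \<Rightarrow> real"
    assume y: "\<And>i. i < n \<Longrightarrow> a i < y (e i) \<and> y (e i) < a (Suc i)"
    have y_less: "y (e i) < y (e j)" if "i < j" "j < n" for i j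
      using interlacing_less[of n a "\<lambda>i. y (e i)"] y that by blast
    have y_pos: "0 < y (e i)" "y (e i) \<le> a n" if "i < n" for i
      using y[OF that] a_pos[of i] a_pos[of "Suc i"] that by auto
    have "mdet (mat n n (\<lambda>(i, j). f j (y (e i)))) =
        s * (vandermonde n (\<lambda>i. y (e i) powr \<gamma>) *
          (\<Prod>i<n. y (e i) powr (\<gamma> - 1) * (c - y (e i) powr \<gamma>) ^ K))"
      using det_scale[of n "\<lambda>i. y (e i) powr (\<gamma> - 1) * (c - y (e i) powr \<gamma>) ^ K"
          "\<lambda>i j. (c - y (e i) powr \<gamma>) ^ j" "\<lambda>_. 1"] det_pow[of "\<lambda>i. y (e i) powr \<gamma>"]
      by (simp add: f_def power_add mult_ac)
    moreover have "0 \<le> vandermonde n (\<lambda>i. y (e i) powr \<gamma>)"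
      using y_less y_pos \<gamma> by (intro vandermonde_pos[THEN less_imp_le] powr_less_mono2) (auto intro: less_imp_le)
    moreover have "0 \<le> (\<Prod>i<n. y (e i) powr (\<gamma> - 1) * (c - y (e i) powr \<gamma>) ^ K)"
      using le_c y_pos by (auto intro!: prod_nonneg mult_nonneg_nonneg simp: less_imp_le)
    ultimately show "mdet (mat n n (\<lambda>(i, j). f j (y (e i)))) =
        s * (vandermonde n (\<lambda>i. y (e i) powr \<gamma>) *
          (\<Prod>i<n. y (e i) powr (\<gamma> - 1) * (c - y (e i) powr \<gamma>) ^ K)) \<and>
        0 \<le> vandermonde n (\<lambda>i. y (e i) powr \<gamma>) *
          (\<Prod>i<n. y (e i) powr (\<gamma> - 1) * (c - y (e i) powr \<gamma>) ^ K)"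
      by simp
  qed
  also have "\<bar>mdet (mat n n (\<lambda>(i, j). G j (a (Suc i)) - G j (a i)))\<bar> =
      \<bar>mdet (mat n n (\<lambda>(i, j). G j (a i)))\<bar>"
    by (rule det_row_differences') (simp add: G_def c_def)
  \<comment> \<open>The power K + 1 common to row i comes out as the new one-point weight; what
    remains is again the matrix of powers of c - x^\<gamma>.\<close>
  also have "mdet (mat n n (\<lambda>(i, j). G j (a i))) =
      (\<Prod>i<n. (c - a i powr \<gamma>) ^ Suc K) * (\<Prod>j<n. - (1 / (\<gamma> * real (K + j + 1)))) *
        (vandermonde n (\<lambda>i. a i powr \<gamma>) * s)"
    using det_scale[of n "\<lambda>i. (c - a i powr \<gamma>) ^ Suc K"
          "\<lambda>i j. (c - a i powr \<gamma>) ^ j" "\<lambda>j. - (1 / (\<gamma> * real (K + j + 1)))"] det_pow[of "\<lambda>i. a i powr \<gamma>"]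
    by (simp add: G_def power_add mult_ac)
  also have "\<bar>\<dots>\<bar> = C * (vandermonde n (\<lambda>i. a i powr \<gamma>) * (\<Prod>i<n. (c - a i powr \<gamma>) ^ Suc K))"
  proof -
    have "0 \<le> vandermonde n (\<lambda>i. a i powr \<gamma>)"
      using a_less a_pos \<gamma> by (intro vandermonde_pos[THEN less_imp_le] powr_less_mono2) auto
    moreover have "0 \<le> (\<Prod>i<n. (c - a i powr \<gamma>) ^ Suc K)"
      using le_c a_pos by (intro prod_nonneg ballI zero_le_power) auto
    moreover have "\<bar>\<Prod>j<n. - (1 / (\<gamma> * real (K + j + 1)))\<bar> = C"
      unfolding C_def abs_prod using \<gamma> by (intro prod.cong) auto
    ultimately show ?thesis using s(2) by (simp only: abs_mult abs_of_nonneg) simp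
  qed
  finally show "box_integral e n a \<gamma> (\<lambda>u. u powr (\<gamma> - 1) * (a n powr \<gamma> - u powr \<gamma>) ^ K) =
      ennreal (C * (vandermonde n (\<lambda>i. a i powr \<gamma>) * (\<Prod>i<n. (a n powr \<gamma> - a i powr \<gamma>) ^ Suc K)))"
    using s(2) by (simp add: c_def)
qed

text \<open>With the lower end at 0 monomials suffice: x^(b + \<gamma> j) vanishes there, so only
  the values at the upper ends \<open>a (Suc i)\<close> survive. Integration raises the exponent
  from b - 1 to b and leaves a factor 1/(b + \<gamma> j) in column j. The exponent b need not be
  related to \<gamma>.\<close>

lemma nn_integral_interlacing_left:
  fixes \<gamma> b :: real and n :: nat
  assumes \<gamma>: "0 < \<gamma>" and b: "0 < b"
  obtains C where "0 < C" and
    "\<And>a (e :: nat \<Rightarrow> 'i). inj_on e {..<n} \<Longrightarrow> (\<And>i. i < n \<Longrightarrow> a i < a (Suc i)) \<Longrightarrow> a 0 = 0 \<Longrightarrow> a n \<le> 1 \<Longrightarrow>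
      box_integral e n a \<gamma> (\<lambda>u. u powr (b - 1)) =
      ennreal (C * (vandermonde n (\<lambda>i. a (Suc i) powr \<gamma>) * (\<Prod>i<n. a (Suc i) powr b)))"
proof
  define C where "C = (\<Prod>j<n. 1 / (b + \<gamma> * real j))"
  have den: "0 < b + \<gamma> * real j" for j using \<gamma> b by (auto intro!: add_pos_nonneg)
  show C: "0 < C" unfolding C_def using den by (auto intro!: prod_pos)
  fix a :: "nat \<Rightarrow> real" and e :: "nat \<Rightarrow> 'i"
  assume e: "inj_on e {..<n}" and a: "\<And>i. i < n \<Longrightarrow> a i < a (Suc i)" and a0: "a 0 = 0" and a1: "a n \<le> 1"
  have a_less: "a i < a j" if "i < j" "j \<le> n" for i j using chain_less[of n a i j, OF a] that by simp
  have a_pos: "0 \<le> a i" "a i \<le> a n" if "i \<le> n" for i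
    using chain_le[of n a 0 i, OF a] chain_le[of n a i n, OF a] that a0 by auto
  have a_Suc_pos: "0 < a (Suc i)" if "i < n" for i
    using a[OF that] a_pos[of i] that by auto
  define f where "f j x = x powr (b + \<gamma> * real j - 1)" for j x
  define G where "G j x = x powr (b + \<gamma> * real j) * (1 / (b + \<gamma> * real j))" for j x
  have powr_split: "x powr (d + \<gamma> * real j) = x powr d * (x powr \<gamma>) ^ j" if "0 < x" for x d j
    using that by (simp add: powr_add powr_powr flip: powr_realpow)
  have "box_integral e n a \<gamma> (\<lambda>u. u powr (b - 1)) =
      ennreal (\<bar>mdet (mat n n (\<lambda>(i, j). G j (a (Suc i)) - G j (a i)))\<bar> / \<bar>1\<bar>)"
  proof (rule nn_integral_interlacing_det[OF e, where f = f])
    fix i j assume ij: "i < n" "j < n"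
    have int: "set_integrable lborel {a i<..<a (Suc i)} (f j)"
      unfolding f_def by (rule set_integrable_powr[OF den])
        (use a_pos[of i] a_pos[of "Suc i"] ij a1 in auto)
    have "(LINT x:{a i<..<a (Suc i)}|lborel. f j x) = G j (a (Suc i)) - G j (a i)"
    proof (rule set_integral_FTC_Ioo[OF a[OF ij(1)] int])
      show "continuous_on {a i..a (Suc i)} (G j)"
        unfolding G_def using a_pos[of i] ij den
        by (intro continuous_intros continuous_on_powr') auto
      fix x assume "a i < x" "x < a (Suc i)"
      then have "0 < x" using a_pos[of i] ij by auto
      then show "(G j has_field_derivative f j x) (at x)"
        unfolding G_def f_def using den[of j]
        by (auto intro!: derivative_eq_intros)
    qed
    then show "set_integrable lborel {a i<..<a (Suc i)} (f j) \<and>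
      (LINT x:{a i<..<a (Suc i)}|lborel. f j x) = G j (a (Suc i)) - G j (a i)"
      using int by simp
  next
    fix y :: "'i \<Rightarrow> real"
    assume y: "\<And>i. i < n \<Longrightarrow> a i < y (e i) \<and> y (e i) < a (Suc i)"
    have y_less: "y (e i) < y (e j)" if "i < j" "j < n" for i j
      using interlacing_less[of n a "\<lambda>i. y (e i)"] y that by blast
    have y_pos: "0 < y (e i)" if "i < n" for i
      using y[OF that] a_pos[of i] that by auto
    have "mat n n (\<lambda>(i, j). f j (y (e i))) =
        mat n n (\<lambda>(i, j). y (e i) powr (b - 1) * (y (e i) powr \<gamma>) ^ j * 1)"
      by (rule eq_matI) (auto simp: f_def y_pos diff_add_eq powr_split[of _ "b - 1", symmetric])
    then have "mdet (mat n n (\<lambda>(i, j). f j (y (e i)))) =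
        1 * (vandermonde n (\<lambda>i. y (e i) powr \<gamma>) * (\<Prod>i<n. y (e i) powr (b - 1)))"
      using det_scale[of n "\<lambda>i. y (e i) powr (b - 1)" "\<lambda>i j. (y (e i) powr \<gamma>) ^ j" "\<lambda>_. 1"]
        det_vandermonde[of n "\<lambda>i. y (e i) powr \<gamma>"] by (simp add: mult_ac)
    moreover have "0 \<le> vandermonde n (\<lambda>i. y (e i) powr \<gamma>)"
      using y_less y_pos \<gamma> by (intro vandermonde_pos[THEN less_imp_le] powr_less_mono2) (auto intro: less_imp_le)
    moreover have "0 \<le> (\<Prod>i<n. y (e i) powr (b - 1))"
      by (auto intro!: prod_nonneg)
    ultimately show "mdet (mat n n (\<lambda>(i, j). f j (y (e i)))) =
        1 * (vandermonde n (\<lambda>i. y (e i) powr \<gamma>) * (\<Prod>i<n. y (e i) powr (b - 1))) \<and>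
        0 \<le> vandermonde n (\<lambda>i. y (e i) powr \<gamma>) * (\<Prod>i<n. y (e i) powr (b - 1))"
      by simp
  qed simp
  also have "mdet (mat n n (\<lambda>(i, j). G j (a (Suc i)) - G j (a i))) =
      mdet (mat n n (\<lambda>(i, j). G j (a (Suc i))))"
    by (rule det_row_differences) (simp add: G_def a0)
  also have "mat n n (\<lambda>(i, j). G j (a (Suc i))) =
     mat n n (\<lambda>(i, j). a (Suc i) powr b * (a (Suc i) powr \<gamma>) ^ j * (1 / (b + \<gamma> * real j)))"
    by (rule eq_matI) (auto simp: G_def powr_split a_Suc_pos)
  also have "mdet \<dots> =
      (\<Prod>i<n. a (Suc i) powr b) * C * vandermonde n (\<lambda>i. a (Suc i) powr \<gamma>)"
    by (simp only: det_scale det_vandermonde C_def)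
  also have "\<bar>\<dots>\<bar> = C * (vandermonde n (\<lambda>i. a (Suc i) powr \<gamma>) * (\<Prod>i<n. a (Suc i) powr b))"
  proof -
    have "0 \<le> vandermonde n (\<lambda>i. a (Suc i) powr \<gamma>)"
      using a_less a_Suc_pos \<gamma> by (intro vandermonde_pos[THEN less_imp_le] powr_less_mono2) (auto simp: less_imp_le)
    moreover have "0 \<le> (\<Prod>i<n. a (Suc i) powr b)"
      by (intro prod_nonneg) auto
    ultimately show ?thesis using C by (simp only: abs_mult abs_of_nonneg less_imp_le) simp
  qed
  finally show "box_integral e n a \<gamma> (\<lambda>u. u powr (b - 1)) =
      ennreal (C * (vandermonde n (\<lambda>i. a (Suc i) powr \<gamma>) * (\<Prod>i<n. a (Suc i) powr b)))"
    by simp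
qed


text \<open>With both ends fixed, not every column can have a primitive vanishing at 0 and at 1,
  since the weight \<open>w\<close> itself is positive and has total mass B > 0. Column 0 therefore
  keeps \<open>w\<close>, and the other n columns are the derivatives of x^(b + \<gamma> k) (1 -
  x^\<gamma>)^(K+1), which do vanish at both ends. The determinant then loses a row and a column at
  the price of the factor B.\<close>

lemma nn_integral_interlacing_both:
  fixes \<gamma> b :: real and K n :: nat
  assumes \<gamma>: "0 < \<gamma>" and b: "0 < b"
  obtains C where "0 < C" and
    "\<And>a (e :: nat \<Rightarrow> 'i). inj_on e {..<Suc n} \<Longrightarrow> (\<And>i. i < Suc n \<Longrightarrow> a i < a (Suc i)) \<Longrightarrow>
      a 0 = 0 \<Longrightarrow> a (Suc n) = 1 \<Longrightarrow>
      box_integral e (Suc n) a \<gamma> (\<lambda>u. u powr (b - 1) * (1 - u powr \<gamma>) ^ K) =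
      ennreal (C * (vandermonde n (\<lambda>i. a (Suc i) powr \<gamma>) *
          (\<Prod>i<n. a (Suc i) powr b * (1 - a (Suc i) powr \<gamma>) ^ Suc K)))"
proof
  define w where "w x = x powr (b - 1) * (1 - x powr \<gamma>) ^ K" for x
  define B where "B = (LBINT x=0..1. w x)"
  define d where "d j = b + \<gamma> * real j" for j
  have d: "0 < d j" for j unfolding d_def using \<gamma> b by (auto intro!: add_pos_nonneg)
  define d' where "d' j = d j + \<gamma> * real (Suc K)" for j
  have d': "0 < d' j" for j unfolding d'_def using d[of j] \<gamma> by (auto intro!: add_pos_nonneg)
  \<comment> \<open>Chosen so that \<open>w x * poly (p (Suc k)) (x powr \<gamma>)\<close> is the
    derivative of x^(d k) (1 - x^\<gamma>)^(K+1): differentiation gives the bracket d k (1 -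
    x^\<gamma>) - \<gamma> (K+1) x^\<gamma> = d k - d' k x^\<gamma>.\<close>
  define p where "p j = (case j of 0 \<Rightarrow> 1 | Suc k \<Rightarrow> monom (d k) k - monom (d' k) (Suc k))" for j
  define s where "s = (\<Prod>j<Suc n. coeff (p j) j)"
  have coeff_p: "coeff (p j) j \<noteq> 0" for j
    using d'[of "j - 1"] by (auto simp: p_def split: nat.split)
  then have s: "s \<noteq> 0" by (simp add: s_def)
  have pow_bound: "0 \<le> (1 - x powr \<gamma>)" "(1 - x powr \<gamma>) \<le> 1" if "0 \<le> x" "x \<le> 1" for x
    using that \<gamma> by (auto simp: powr_le1)
  have w_meas: "w \<in> borel_measurable borel" unfolding w_def by measurable
  have w_bound: "\<bar>w x\<bar> \<le> x powr (b - 1)" if "0 \<le> x" "x \<le> 1" for x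
    using pow_bound[OF that] by (auto simp: w_def abs_mult power_abs intro!: mult_left_le power_le_one)
  have w_int: "set_integrable lborel {l<..<u} w" if "0 \<le> l" "u \<le> 1" for l u
    using that w_bound
    by (intro set_integrable_dominated_powr[OF b, where B = 1] w_meas) auto
  have B_pos: "0 < B"
  proof -
    have B: "B = (\<integral>x. indicator {0<..<1} x * w x \<partial>lborel)"
      by (simp add: B_def interval_integral_Ioo set_lebesgue_integral_def zero_ereal_def one_ereal_def)
    have w_pos: "0 < w x" if "0 < x" "x < 1" for x
      using that \<gamma> powr_less_mono2[of \<gamma> x 1] by (auto simp: w_def)
    have nn: "AE x in lborel. 0 \<le> indicator {0<..<1} x * w x"
      using w_pos by (intro AE_I2) (auto simp: indicator_def less_imp_le)
    have int: "integrable lborel (\<lambda>x. indicator {0<..<1} x * w x)"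
      using w_int[of 0 1] by (simp add: set_integrable_def)
    have "B \<noteq> 0"
    proof
      assume "B = 0"
      then have "AE x in lborel. indicator {0<..<1} x * w x = 0"
        using integral_nonneg_eq_0_iff_AE[OF int nn] B by simp
      then have "AE x in lborel. x \<notin> {0<..<1::real}"
        by eventually_elim (use w_pos in \<open>force simp: indicator_def\<close>)
      then have "emeasure lborel {0<..<1::real} = 0"
        by (subst (asm) AE_iff_measurable[OF _ refl]) (auto simp: greaterThanLessThan_def greaterThan_def lessThan_def Int_def)
      then show False by simp
    qed
    moreover have "0 \<le> B" unfolding B using nn by (rule integral_nonneg_AE)
    ultimately show ?thesis by simp
  qed
  define C where "C = B / \<bar>s\<bar>"
  show C: "0 < C" unfolding C_def using B_pos s by simp
  fix a :: "nat \<Rightarrow> real" and e :: "nat \<Rightarrow> 'i"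
  assume e: "inj_on e {..<Suc n}" and a: "\<And>i. i < Suc n \<Longrightarrow> a i < a (Suc i)" and a0: "a 0 = 0" and a1: "a (Suc n) = 1"
  have a_less: "a i < a j" if "i < j" "j \<le> Suc n" for i j
    using chain_less[of "Suc n" a i j, OF a] that by simp
  have a_pos: "0 \<le> a i" "a i \<le> 1" if "i \<le> Suc n" for i
    using chain_le[of "Suc n" a 0 i, OF a] chain_le[of "Suc n" a i "Suc n", OF a] that a0 a1 by auto
  define f where "f j x = w x * poly (p j) (x powr \<gamma>)" for j x
  define G where "G j x = (case j of 0 \<Rightarrow> (LBINT t=0..x. w t)
    | Suc k \<Rightarrow> x powr d k * (1 - x powr \<gamma>) ^ Suc K)" for j x
  have powr_split: "x powr (d j + t) = x powr (b + t) * (x powr \<gamma>) ^ j" if "0 < x" for x t j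
    using that by (simp add: powr_add powr_powr d_def mult_ac flip: powr_realpow)
  have deg: "degree (p j) \<le> j" for j
    by (auto simp: p_def split: nat.split intro!: degree_diff_le order_trans[OF degree_monom_le])
  have det_p: "mdet (mat (Suc n) (Suc n) (\<lambda>(i, j). poly (p j) (u i))) = vandermonde (Suc n) u * s" for u
    unfolding s_def by (rule det_poly_basis) (rule deg)
  have "box_integral e (Suc n) a \<gamma> w =
      ennreal (\<bar>mdet (mat (Suc n) (Suc n) (\<lambda>(i, j). G j (a (Suc i)) - G j (a i)))\<bar> / \<bar>s\<bar>)"
  proof (rule nn_integral_interlacing_det[OF e s, where f = f])
    fix i j assume ij: "i < Suc n" "j < Suc n"
    have ai: "0 \<le> a i" "a (Suc i) \<le> 1" using a_pos[of i] a_pos[of "Suc i"] ij by auto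
    show "set_integrable lborel {a i<..<a (Suc i)} (f j) \<and>
      (LINT x:{a i<..<a (Suc i)}|lborel. f j x) = G j (a (Suc i)) - G j (a i)"
    proof (cases j)
      case 0
      have "(LBINT t=ereal 0..ereal (a i). w t) + (LBINT t=ereal (a i)..ereal (a (Suc i)). w t) =
          (LBINT t=ereal 0..ereal (a (Suc i)). w t)"
        using ai a[OF ij(1)] w_int
        by (intro interval_integral_sum) (auto simp: interval_lebesgue_integrable_def einterval_eq min_def max_def)
      moreover have "(LBINT t=ereal (a i)..ereal (a (Suc i)). w t) = (LINT x:{a i<..<a (Suc i)}|lborel. w x)"
        using a[OF ij(1)] by (simp add: interval_integral_Ioo)
      ultimately have "(LINT x:{a i<..<a (Suc i)}|lborel. w x) = G 0 (a (Suc i)) - G 0 (a i)"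
        by (simp add: G_def zero_ereal_def)
      moreover have "f 0 = w" by (simp add: f_def p_def fun_eq_iff)
      ultimately show ?thesis using 0 w_int[OF ai] by simp
    next
      case (Suc k)
      have fj: "f j x = w x * (d k * (x powr \<gamma>) ^ k - d' k * (x powr \<gamma>) ^ Suc k)" for x
        by (simp add: f_def Suc p_def poly_monom)
      have int: "set_integrable lborel {a i<..<a (Suc i)} (f j)"
      proof (rule set_integrable_dominated_powr[OF b ai, where B = "d k + d' k"])
        show "f j \<in> borel_measurable borel" unfolding fj[abs_def] using w_meas by measurable
        fix x assume x: "a i < x" "x < a (Suc i)"
        then have x: "0 \<le> x" "x \<le> 1" using ai by auto
        have "(x powr \<gamma>) ^ m \<le> 1" for m using x \<gamma> by (auto intro!: power_le_one simp: powr_le1)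
        then have "\<bar>d k * (x powr \<gamma>) ^ k\<bar> \<le> d k * 1" "\<bar>d' k * (x powr \<gamma>) ^ Suc k\<bar> \<le> d' k * 1"
          unfolding abs_mult using d[of k] d'[of k] by (auto intro!: mult_mono simp del: power_Suc)
        then have "\<bar>d k * (x powr \<gamma>) ^ k - d' k * (x powr \<gamma>) ^ Suc k\<bar> \<le> d k + d' k"
          by linarith
        then have "\<bar>w x\<bar> * \<bar>d k * (x powr \<gamma>) ^ k - d' k * (x powr \<gamma>) ^ Suc k\<bar> \<le> x powr (b - 1) * (d k + d' k)"
          using w_bound[OF x] by (intro mult_mono) auto
        then show "\<bar>f j x\<bar> \<le> (d k + d' k) * x powr (b - 1)"
          by (simp add: fj abs_mult mult.commute)
      qed
      have "(LINT x:{a i<..<a (Suc i)}|lborel. f j x) = G j (a (Suc i)) - G j (a i)"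
      proof (rule set_integral_FTC_Ioo[OF a[OF ij(1)] int])
        show "continuous_on {a i..a (Suc i)} (G j)"
          unfolding G_def Suc using ai d \<gamma> b
          by (simp del: power_Suc) (intro continuous_intros continuous_on_powr', auto)
        fix x assume "a i < x" "x < a (Suc i)"
        then have x: "0 < x" using ai by auto
        have "((\<lambda>x. x powr d k * (1 - x powr \<gamma>) ^ Suc K) has_field_derivative
            (d k * x powr (d k - 1)) * (1 - x powr \<gamma>) ^ Suc K +
            (real (Suc K) * (1 - x powr \<gamma>) ^ K * (- (\<gamma> * x powr (\<gamma> - 1)))) * x powr d k) (at x)"
          using x by (auto intro!: derivative_eq_intros simp del: power_Suc)
        moreover have "(d k * x powr (d k - 1)) * (1 - x powr \<gamma>) ^ Suc K +
            (real (Suc K) * (1 - x powr \<gamma>) ^ K * (- (\<gamma> * x powr (\<gamma> - 1)))) * x powr d k = f j x"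
        proof -
          have 1: "x powr (d k - 1) = x powr (b - 1) * (x powr \<gamma>) ^ k"
            using powr_split[OF x, of k "- 1"] by simp
          have "x powr (\<gamma> - 1) * x powr d k = x powr \<gamma> * x powr (d k - 1)"
            by (simp add: algebra_simps flip: powr_add)
          then have 2: "x powr (\<gamma> - 1) * x powr d k = x powr (b - 1) * (x powr \<gamma>) ^ Suc k"
            by (simp add: 1 mult_ac)
          have "(d k * x powr (d k - 1)) * (1 - x powr \<gamma>) ^ Suc K +
            (real (Suc K) * (1 - x powr \<gamma>) ^ K * (- (\<gamma> * x powr (\<gamma> - 1)))) * x powr d k =
            (1 - x powr \<gamma>) ^ K * (d k * (1 - x powr \<gamma>) * x powr (d k - 1)
              - \<gamma> * real (Suc K) * (x powr (\<gamma> - 1) * x powr d k))"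
            by (simp add: algebra_simps)
          also have "\<dots> = f j x"
            unfolding 1 2 fj w_def d'_def by (simp add: algebra_simps)
          finally show ?thesis .
        qed
        ultimately show "(G j has_field_derivative f j x) (at x)"
          by (simp add: G_def[abs_def] Suc del: power_Suc)
      qed
      then show ?thesis using int by simp
    qed
  next
    fix y :: "'i \<Rightarrow> real"
    assume y: "\<And>i. i < Suc n \<Longrightarrow> a i < y (e i) \<and> y (e i) < a (Suc i)"
    have y_less: "y (e i) < y (e j)" if "i < j" "j < Suc n" for i j
      using interlacing_less[of "Suc n" a "\<lambda>i. y (e i)"] y that by blast
    have y_pos: "0 < y (e i)" "y (e i) \<le> 1" if "i < Suc n" for i
      using y[OF that] a_pos[of i] a_pos[of "Suc i"] that by auto
    have "mdet (mat (Suc n) (Suc n) (\<lambda>(i, j). f j (y (e i)))) =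
        s * (vandermonde (Suc n) (\<lambda>i. y (e i) powr \<gamma>) * (\<Prod>i<Suc n. w (y (e i))))"
      using det_scale[of "Suc n" "\<lambda>i. w (y (e i))"
          "\<lambda>i j. poly (p j) (y (e i) powr \<gamma>)" "\<lambda>_. 1"] det_p[of "\<lambda>i. y (e i) powr \<gamma>"]
      unfolding f_def by (simp del: prod.lessThan_Suc)
    moreover have "0 \<le> vandermonde (Suc n) (\<lambda>i. y (e i) powr \<gamma>)"
      using y_less y_pos \<gamma> by (intro vandermonde_pos[THEN less_imp_le] powr_less_mono2) (auto intro: less_imp_le)
    moreover have "0 \<le> (\<Prod>i<Suc n. w (y (e i)))"
      using y_pos pow_bound by (intro prod_nonneg) (auto simp: w_def less_imp_le intro!: mult_nonneg_nonneg)
    ultimately show "mdet (mat (Suc n) (Suc n) (\<lambda>(i, j). f j (y (e i)))) =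
        s * (vandermonde (Suc n) (\<lambda>i. y (e i) powr \<gamma>) * (\<Prod>i<Suc n. w (y (e i)))) \<and>
        0 \<le> vandermonde (Suc n) (\<lambda>i. y (e i) powr \<gamma>) * (\<Prod>i<Suc n. w (y (e i)))"
      by (simp del: prod.lessThan_Suc)
  qed
  also have "mdet (mat (Suc n) (Suc n) (\<lambda>(i, j). G j (a (Suc i)) - G j (a i))) =
      mdet (mat (Suc n) (Suc n) (\<lambda>(i, j). G j (a (Suc i))))"
    by (rule det_row_differences) (use d in \<open>auto simp: G_def a0 zero_ereal_def less_imp_neq split: nat.split\<close>)
  \<comment> \<open>The last row belongs to the end point 1, where only column 0 is nonzero; its
    entry there is the total mass B.\<close>
  also have "\<bar>\<dots>\<bar> = \<bar>G 0 (a (Suc n))\<bar> * \<bar>mdet (mat n n (\<lambda>(i, j). G (Suc j) (a (Suc i))))\<bar>"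
    by (rule det_single_entry_last_row) (simp add: G_def a1)
  also have "G 0 (a (Suc n)) = B"
    by (simp add: G_def a1 B_def one_ereal_def)
  also have "mat n n (\<lambda>(i, j). G (Suc j) (a (Suc i))) =
     mat n n (\<lambda>(i, j). (a (Suc i) powr b * (1 - a (Suc i) powr \<gamma>) ^ Suc K) * (a (Suc i) powr \<gamma>) ^ j * 1)"
  proof (rule eq_matI)
    fix i j assume "i < dim_row (mat n n (\<lambda>(i, j). (a (Suc i) powr b * (1 - a (Suc i) powr \<gamma>) ^ Suc K) * (a (Suc i) powr \<gamma>) ^ j * 1))"
      "j < dim_col (mat n n (\<lambda>(i, j). (a (Suc i) powr b * (1 - a (Suc i) powr \<gamma>) ^ Suc K) * (a (Suc i) powr \<gamma>) ^ j * 1))"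
    then have ij: "i < n" "j < n" by auto
    then have "0 < a (Suc i)" using a[of i] a_pos[of i] by auto
    then show "mat n n (\<lambda>(i, j). G (Suc j) (a (Suc i))) $$ (i, j) =
      mat n n (\<lambda>(i, j). (a (Suc i) powr b * (1 - a (Suc i) powr \<gamma>) ^ Suc K) * (a (Suc i) powr \<gamma>) ^ j * 1) $$ (i, j)"
      using ij powr_split[of "a (Suc i)" j 0] by (simp add: G_def)
  qed auto
  also have "mdet \<dots> =
      (\<Prod>i<n. a (Suc i) powr b * (1 - a (Suc i) powr \<gamma>) ^ Suc K) * vandermonde n (\<lambda>i. a (Suc i) powr \<gamma>)"
    by (simp only: det_scale det_vandermonde) simp
  also have "\<bar>B\<bar> * \<bar>\<dots>\<bar> / \<bar>s\<bar> = C * (vandermonde n (\<lambda>i. a (Suc i) powr \<gamma>) *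
      (\<Prod>i<n. a (Suc i) powr b * (1 - a (Suc i) powr \<gamma>) ^ Suc K))"
  proof -
    have "0 \<le> vandermonde n (\<lambda>i. a (Suc i) powr \<gamma>)"
      using a_less a_pos \<gamma> by (intro vandermonde_pos[THEN less_imp_le] powr_less_mono2) auto
    moreover have "0 \<le> (\<Prod>i<n. a (Suc i) powr b * (1 - a (Suc i) powr \<gamma>) ^ Suc K)"
      using pow_bound a_pos by (intro prod_nonneg ballI mult_nonneg_nonneg zero_le_power) auto
    ultimately show ?thesis using B_pos
      by (simp only: abs_mult abs_of_nonneg less_imp_le C_def) (simp only: times_divide_eq_left mult_ac)
  qed
  finally show "box_integral e (Suc n) a \<gamma> (\<lambda>u. u powr (b - 1) * (1 - u powr \<gamma>) ^ K) =
      ennreal (C * (vandermonde n (\<lambda>i. a (Suc i) powr \<gamma>) *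
          (\<Prod>i<n. a (Suc i) powr b * (1 - a (Suc i) powr \<gamma>) ^ Suc K)))"
    by (simp only: w_def)
qed

section \<open>One step of the interlacing chain\<close>

text \<open>Zero-based counterpart of \<open>weyl_chamber\<close>, adapted to the index range of the
  determinants.\<close>

definition chamber :: "nat \<Rightarrow> (nat \<Rightarrow> real) \<Rightarrow> bool" where
  "chamber n z \<longleftrightarrow> (\<forall>i<n. 0 < z i \<and> z i < 1) \<and> (\<forall>j<n. \<forall>i<j. z i < z j)"

definition unit_entries :: "nat \<Rightarrow> (nat \<Rightarrow> real) \<Rightarrow> bool" where
  "unit_entries n z \<longleftrightarrow> (\<forall>i<n. 0 < z i \<and> z i < 1)"

text \<open>Here y has n entries and z has m. The upper bound is imposed only where y has a next
  entry, so the pattern covers n = m as well as n = m + 1; where the next entry is missing, the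
  bound 1 of \<open>unit_entries\<close> takes its place.\<close>

definition interlaced :: "nat \<Rightarrow> nat \<Rightarrow> (nat \<Rightarrow> real) \<Rightarrow> (nat \<Rightarrow> real) \<Rightarrow> bool" where
  "interlaced n m y z \<longleftrightarrow> (\<forall>i<m. y i < z i \<and> (Suc i < n \<longrightarrow> z i < y (Suc i)))"

definition linked :: "nat \<Rightarrow> nat \<Rightarrow> (nat \<Rightarrow> real) \<Rightarrow> (nat \<Rightarrow> real) \<Rightarrow> bool" where
  "linked n m y z \<longleftrightarrow> unit_entries n y \<and> unit_entries m z \<and> interlaced n m y z"

text \<open>The function that is reproduced, with another weight, when a slice is integrated out.
  The indicator of the chamber makes the step identities true for every argument, both sides being 0
  outside.\<close>

definition slice_potential :: "real \<Rightarrow> (real \<Rightarrow> real) \<Rightarrow> nat \<Rightarrow> (nat \<Rightarrow> real) \<Rightarrow> real" where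
  "slice_potential \<gamma> w n z =
     of_bool (chamber n z) * (vandermonde n (\<lambda>i. z i powr \<gamma>) * (\<Prod>i<n. w (z i)))"

lemma slice_potential_cong:
  assumes "\<And>x. 0 < x \<Longrightarrow> x < 1 \<Longrightarrow> v x = w x"
  shows "slice_potential \<gamma> v n = slice_potential \<gamma> w n"
  by (auto simp: slice_potential_def fun_eq_iff chamber_def assms)

lemma chamberI:
  assumes "unit_entries n z" "\<And>i. Suc i < n \<Longrightarrow> z i < z (Suc i)"
  shows "chamber n z"
proof -
  have "z i < z j" if "i < j" "j < n" for i j
    using chain_less[of "n - 1" z i j] assms(2) that by auto
  then show ?thesis using assms(1) by (auto simp: chamber_def unit_entries_def)
qed

abbreviation (input) step_integral ::
  "(nat \<Rightarrow> 'i) \<Rightarrow> nat \<Rightarrow> real \<Rightarrow> (real \<Rightarrow> real) \<Rightarrow> ((nat \<Rightarrow> real) \<Rightarrow> bool) \<Rightarrow> ennreal" where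
  "step_integral e n \<gamma> w k \<equiv> (\<integral>\<^sup>+y. ennreal (slice_potential \<gamma> w n (\<lambda>i. y (e i))) *
     of_bool (k (\<lambda>i. y (e i))) \<partial>lebPi (e ` {..<n}))"

text \<open>Passes from box integrals to potentials. For z in the chamber the condition
  \<open>k\<close> cuts out exactly the box, and it forces the integrated points into their own
  chamber; for z outside the chamber neither side contributes.\<close>

lemma nn_integral_step_glue:
  fixes e :: "nat \<Rightarrow> 'i"
  assumes k: "\<And>y. k y \<longleftrightarrow> chamber m z \<and> (\<forall>i<n. a i < y (e i) \<and> y (e i) < a (Suc i))"
    and ch: "\<And>y. k y \<Longrightarrow> chamber n (\<lambda>i. y (e i))"
    and eq: "chamber m z \<Longrightarrow>
      box_integral e n a \<gamma> w =
      ennreal (C * (vandermonde m (\<lambda>i. z i powr \<gamma>) * (\<Prod>i<m. w' (z i))))"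
    and C: "0 < C"
  shows "(\<integral>\<^sup>+y. ennreal (slice_potential \<gamma> w n (\<lambda>i. y (e i))) * of_bool (k y) \<partial>lebPi (e ` {..<n})) =
      ennreal C * ennreal (slice_potential \<gamma> w' m z)"
proof (cases "chamber m z")
  case True
  have "(\<integral>\<^sup>+y. ennreal (slice_potential \<gamma> w n (\<lambda>i. y (e i))) * of_bool (k y) \<partial>lebPi (e ` {..<n})) =
    box_integral e n a \<gamma> w"
  proof (rule nn_integral_cong)
    fix y
    have "(\<Prod>i<n. indicator {a i<..<a (Suc i)} (y (e i))) = (of_bool (k y) :: real)"
    proof (cases "k y")
      case T: True
      then show ?thesis using k by (auto simp: indicator_def)
    next
      case False
      then obtain i where "i < n" "y (e i) \<notin> {a i<..<a (Suc i)}" using k True by auto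
      then show ?thesis using False by (auto simp: indicator_def)
    qed
    then show "ennreal (slice_potential \<gamma> w n (\<lambda>i. y (e i))) * of_bool (k y) =
      ennreal ((\<Prod>i<n. indicator {a i<..<a (Suc i)} (y (e i))) *
         (vandermonde n (\<lambda>i. y (e i) powr \<gamma>) * (\<Prod>i<n. w (y (e i)))))"
      using ch[of y] by (auto simp: slice_potential_def)
  qed
  then show ?thesis using eq[OF True] True C by (simp add: slice_potential_def ennreal_mult')
next
  case False
  then have "\<not> k y" for y using k by blast
  then show ?thesis using False by (simp add: slice_potential_def)
qed

section \<open>Interlacing with a fixed slice as a family of independent interval conditions\<close>

lemma linked_chamber_lower:
  assumes "linked n m y z" "n \<le> Suc m" shows "chamber n y"
proof (rule chamberI)
  fix i assume "Suc i < n"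
  then have "y i < z i" "z i < y (Suc i)" using assms by (auto simp: linked_def interlaced_def)
  then show "y i < y (Suc i)" by simp
qed (use assms in \<open>simp add: linked_def\<close>)

lemma linked_chamber_upper:
  assumes "linked n m y z" "m \<le> n" shows "chamber m z"
proof (rule chamberI)
  fix i assume "Suc i < m"
  then have "z i < y (Suc i)" "y (Suc i) < z (Suc i)" using assms by (auto simp: linked_def interlaced_def)
  then show "z i < z (Suc i)" by simp
qed (use assms in \<open>simp add: linked_def\<close>)

lemma chamberD:
  assumes "chamber n z"
  shows "i < n \<Longrightarrow> 0 < z i" "i < n \<Longrightarrow> z i < 1" "i < j \<Longrightarrow> j < n \<Longrightarrow> z i < z j"
  using assms by (auto simp: chamber_def)

text \<open>The four equivalences differ in whether the fixed slice z is the lower or the upper one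
  and in whether the lengths agree. Here z is longer, so every interval lies between two of its
  entries and no artificial end point occurs.\<close>

lemma linked_inside_iff:
  "linked (Suc n) n z y \<longleftrightarrow> chamber (Suc n) z \<and> (\<forall>i<n. z i < y i \<and> y i < z (Suc i))" (is "?l \<longleftrightarrow> ?r")
proof
  assume l: ?l
  then have "\<forall>i<n. z i < y i \<and> y i < z (Suc i)" by (simp add: linked_def interlaced_def)
  moreover from this have "chamber (Suc n) z"
    using l by (intro linked_chamber_lower) auto
  ultimately show ?r by simp
next
  assume r: ?r
  have "0 < y i \<and> y i < 1" if "i < n" for i
    using r that chamberD(1)[of "Suc n" z i] chamberD(2)[of "Suc n" z "Suc i"] by (auto intro: less_trans)
  with r show ?l by (simp add: linked_def interlaced_def unit_entries_def chamber_def)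
qed

lemma linked_right_iff:
  "linked n n z y \<longleftrightarrow> chamber n z \<and>
     (\<forall>i<n. z i < y i \<and> y i < (if Suc i < n then z (Suc i) else 1))" (is "?l \<longleftrightarrow> ?r")
proof
  assume l: ?l
  then have "\<forall>i<n. z i < y i \<and> y i < (if Suc i < n then z (Suc i) else 1)"
    by (simp add: linked_def interlaced_def unit_entries_def)
  moreover from this have "chamber n z"
    using l by (intro linked_chamber_lower) auto
  ultimately show ?r by simp
next
  assume r: ?r
  have "0 < y i \<and> y i < 1" if "i < n" for i
  proof -
    have "z i < y i" "y i < (if Suc i < n then z (Suc i) else 1)" "chamber n z" using r that by auto
    then show ?thesis
      using that chamberD(1)[of n z i] chamberD(2)[of n z "Suc i"] by (cases "Suc i < n") auto
  qed
  moreover have "y i < z (Suc i)" if "i < n" "Suc i < n" for i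
  proof -
    have "y i < (if Suc i < n then z (Suc i) else 1)" using r that(1) by blast
    then show ?thesis using that(2) by simp
  qed
  ultimately show ?l using r by (simp add: linked_def interlaced_def unit_entries_def chamber_def)
qed

lemma linked_left_iff:
  "linked n n y z \<longleftrightarrow> chamber n z \<and>
     (\<forall>i<n. (if i = 0 then 0 else z (i - 1)) < y i \<and> y i < z i)" (is "?l \<longleftrightarrow> ?r")
proof
  assume l: ?l
  have "(if i = 0 then 0 else z (i - 1)) < y i \<and> y i < z i" if "i < n" for i
    using that l by (cases i) (simp_all add: linked_def interlaced_def unit_entries_def)
  moreover have "chamber n z"
    using l by (intro linked_chamber_upper) auto
  ultimately show ?r by simp
next
  assume r: ?r
  have z: "z i < y (Suc i)" if "Suc i < n" for i using r that by (auto dest: spec[of _ "Suc i"])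
  have "0 < y i \<and> y i < 1" if "i < n" for i
  proof -
    have "(if i = 0 then 0 else z (i - 1)) < y i" "y i < z i" "chamber n z" using r that by auto
    then show ?thesis
      using that chamberD(1)[of n z "i - 1"] chamberD(2)[of n z i] by (cases i) auto
  qed
  with r z show ?l by (simp add: linked_def interlaced_def unit_entries_def chamber_def)
qed

lemma linked_both_iff:
  "linked (Suc n) n y z \<longleftrightarrow> chamber n z \<and>
     (\<forall>i<Suc n. (if i = 0 then 0 else z (i - 1)) < y i \<and> y i < (if i < n then z i else 1))" (is "?l \<longleftrightarrow> ?r")
proof
  assume l: ?l
  have "(if i = 0 then 0 else z (i - 1)) < y i \<and> y i < (if i < n then z i else 1)" if "i < Suc n" for i
    using that l by (cases i) (auto simp: linked_def interlaced_def unit_entries_def)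
  moreover have "chamber n z"
    using l by (intro linked_chamber_upper) auto
  ultimately show ?r by simp
next
  assume r: ?r
  have z: "z i < y (Suc i)" "y i < z i" if "i < n" for i
    using r that by (auto dest: spec[of _ "Suc i"] spec[of _ i])
  have "0 < y i \<and> y i < 1" if "i < Suc n" for i
  proof -
    have "(if i = 0 then 0 else z (i - 1)) < y i" "chamber n z" using r that by auto
    then have "0 < y i"
      using that chamberD(1)[of n z "i - 1"] by (cases i) auto
    moreover have "y i < 1"
    proof (cases "i < n")
      case True then show ?thesis using z(2)[of i] r chamberD(2)[of n z i] by auto
    next
      case False then show ?thesis using r that by (auto dest: spec[of _ i])
    qed
    ultimately show ?thesis by simp
  qed
  with r z show ?l by (simp add: linked_def interlaced_def unit_entries_def chamber_def)
qed

text \<open>Case K = 0 of the integral with primitives vanishing at the right end, which is here the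
  largest entry of z itself. The factors a_n^\<gamma> - a_i^\<gamma> are exactly what extends a
  Vandermonde product from n to n + 1 variables.\<close>

lemma step_inside:
  fixes \<gamma> :: real
  assumes "0 < \<gamma>"
  obtains C where "0 < C" and "\<And>(e :: nat \<Rightarrow> 'i) z. inj_on e {..<n} \<Longrightarrow>
    step_integral e n \<gamma> (\<lambda>x. x powr (\<gamma> - 1)) (linked (Suc n) n z) =
      ennreal C * ennreal (slice_potential \<gamma> (\<lambda>_. 1) (Suc n) z)"
proof -
  obtain C where C: "0 < C" and *: "\<And>a (e :: nat \<Rightarrow> 'i). inj_on e {..<n} \<Longrightarrow> (\<And>i. i < n \<Longrightarrow> a i < a (Suc i)) \<Longrightarrow> 0 \<le> a 0 \<Longrightarrow> a n \<le> 1 \<Longrightarrow>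
      box_integral e n a \<gamma> (\<lambda>u. u powr (\<gamma> - 1) * (a n powr \<gamma> - u powr \<gamma>) ^ 0) =
      ennreal (C * (vandermonde n (\<lambda>i. a i powr \<gamma>) * (\<Prod>i<n. (a n powr \<gamma> - a i powr \<gamma>) ^ Suc 0)))"
    using nn_integral_interlacing_right[OF assms, of n 0, where 'i = 'i] by blast
  show thesis
  proof (rule that[OF C])
    fix e :: "nat \<Rightarrow> 'i" and z :: "nat \<Rightarrow> real"
    assume e: "inj_on e {..<n}"
    show "step_integral e n \<gamma> (\<lambda>x. x powr (\<gamma> - 1)) (linked (Suc n) n z) =
      ennreal C * ennreal (slice_potential \<gamma> (\<lambda>_. 1) (Suc n) z)"
    proof (rule nn_integral_step_glue[where a = z])
      assume ch: "chamber (Suc n) z"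
      show "box_integral e n z \<gamma> (\<lambda>u. u powr (\<gamma> - 1)) =
        ennreal (C * (vandermonde (Suc n) (\<lambda>i. z i powr \<gamma>) * (\<Prod>i<Suc n. 1)))"
        using *[OF e, of z] ch by (simp add: chamber_def vandermonde_Suc less_imp_le)
    next
      show "linked (Suc n) n z (\<lambda>i. y (e i)) \<longleftrightarrow> chamber (Suc n) z \<and> (\<forall>i<n. z i < y (e i) \<and> y (e i) < z (Suc i))" for y
        by (rule linked_inside_iff)
    qed (auto simp: C intro: linked_chamber_upper)
  qed
qed

text \<open>Now the right end is the constant 1. The factors that extended the Vandermonde product
  in \<open>step_inside\<close> become a one-point weight and raise the power of 1 -
  x^\<gamma>.\<close>

lemma step_right:
  fixes \<gamma> :: real
  assumes "0 < \<gamma>"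
  obtains C where "0 < C" and "\<And>(e :: nat \<Rightarrow> 'i) z. inj_on e {..<n} \<Longrightarrow>
    step_integral e n \<gamma> (\<lambda>x. x powr (\<gamma> - 1) * (1 - x powr \<gamma>) ^ K) (linked n n z) =
      ennreal C * ennreal (slice_potential \<gamma> (\<lambda>x. (1 - x powr \<gamma>) ^ Suc K) n z)"
proof -
  obtain C where C: "0 < C" and *: "\<And>a (e :: nat \<Rightarrow> 'i). inj_on e {..<n} \<Longrightarrow> (\<And>i. i < n \<Longrightarrow> a i < a (Suc i)) \<Longrightarrow> 0 \<le> a 0 \<Longrightarrow> a n \<le> 1 \<Longrightarrow>
      box_integral e n a \<gamma> (\<lambda>u. u powr (\<gamma> - 1) * (a n powr \<gamma> - u powr \<gamma>) ^ K) =
      ennreal (C * (vandermonde n (\<lambda>i. a i powr \<gamma>) * (\<Prod>i<n. (a n powr \<gamma> - a i powr \<gamma>) ^ Suc K)))"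
    using nn_integral_interlacing_right[OF assms, of n K, where 'i = 'i] by blast
  show thesis
  proof (rule that[OF C])
    fix e :: "nat \<Rightarrow> 'i" and z :: "nat \<Rightarrow> real"
    assume e: "inj_on e {..<n}"
    define a where "a i = (if i < n then z i else 1)" for i
    show "step_integral e n \<gamma> (\<lambda>x. x powr (\<gamma> - 1) * (1 - x powr \<gamma>) ^ K) (linked n n z) =
      ennreal C * ennreal (slice_potential \<gamma> (\<lambda>x. (1 - x powr \<gamma>) ^ Suc K) n z)"
    proof (rule nn_integral_step_glue[where a = a])
      assume ch: "chamber n z"
      have "vandermonde n (\<lambda>i. a i powr \<gamma>) = vandermonde n (\<lambda>i. z i powr \<gamma>)"
        by (auto simp: vandermonde_def a_def intro!: prod.cong)
      moreover have "(\<Prod>i<n. (a n powr \<gamma> - a i powr \<gamma>) ^ Suc K) = (\<Prod>i<n. (1 - z i powr \<gamma>) ^ Suc K)"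
        by (auto simp: a_def intro!: prod.cong)
      moreover have "a i < a (Suc i)" if "i < n" for i using that ch by (auto simp: a_def chamber_def)
      moreover have "0 \<le> a 0" "a n = 1" using ch by (auto simp: a_def chamber_def less_imp_le)
      ultimately show "box_integral e n a \<gamma> (\<lambda>u. u powr (\<gamma> - 1) * (1 - u powr \<gamma>) ^ K) =
        ennreal (C * (vandermonde n (\<lambda>i. z i powr \<gamma>) * (\<Prod>i<n. (1 - z i powr \<gamma>) ^ Suc K)))"
        using *[OF e, of a] by simp
    next
      show "linked n n z (\<lambda>i. y (e i)) \<longleftrightarrow> chamber n z \<and> (\<forall>i<n. a i < y (e i) \<and> y (e i) < a (Suc i))" for y
        unfolding linked_right_iff by (auto simp: a_def)
    qed (auto simp: C intro: linked_chamber_upper)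
  qed
qed

text \<open>The first entry of the integrated slice has no lower neighbour, and 0 takes that place.
  The freedom in b serves slices right of the centre, whose weights involve \<theta> while the
  determinant is in x^\<eta>.\<close>

lemma step_left:
  fixes \<gamma> b :: real
  assumes "0 < \<gamma>" "0 < b"
  obtains C where "0 < C" and "\<And>(e :: nat \<Rightarrow> 'i) z. inj_on e {..<n} \<Longrightarrow>
    step_integral e n \<gamma> (\<lambda>x. x powr (b - 1)) (\<lambda>y. linked n n y z) =
      ennreal C * ennreal (slice_potential \<gamma> (\<lambda>x. x powr b) n z)"
proof -
  obtain C where C: "0 < C" and *: "\<And>a (e :: nat \<Rightarrow> 'i). inj_on e {..<n} \<Longrightarrow> (\<And>i. i < n \<Longrightarrow> a i < a (Suc i)) \<Longrightarrow> a 0 = 0 \<Longrightarrow> a n \<le> 1 \<Longrightarrow>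
      box_integral e n a \<gamma> (\<lambda>u. u powr (b - 1)) =
      ennreal (C * (vandermonde n (\<lambda>i. a (Suc i) powr \<gamma>) * (\<Prod>i<n. a (Suc i) powr b)))"
    using nn_integral_interlacing_left[OF assms, of n, where 'i = 'i] by blast
  show thesis
  proof (rule that[OF C])
    fix e :: "nat \<Rightarrow> 'i" and z :: "nat \<Rightarrow> real"
    assume e: "inj_on e {..<n}"
    define a where "a i = (if i = 0 then 0 else z (i - 1))" for i
    show "step_integral e n \<gamma> (\<lambda>x. x powr (b - 1)) (\<lambda>y. linked n n y z) =
      ennreal C * ennreal (slice_potential \<gamma> (\<lambda>x. x powr b) n z)"
    proof (rule nn_integral_step_glue[where a = a])
      assume ch: "chamber n z"
      have "a i < a (Suc i)" if "i < n" for i using that ch by (auto simp: a_def chamber_def)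
      moreover have "a 0 = 0" "a n \<le> 1" using ch by (auto simp: a_def chamber_def less_imp_le)
      ultimately show "box_integral e n a \<gamma> (\<lambda>u. u powr (b - 1)) =
        ennreal (C * (vandermonde n (\<lambda>i. z i powr \<gamma>) * (\<Prod>i<n. z i powr b)))"
        using *[OF e, of a] by (simp add: a_def)
    next
      show "linked n n (\<lambda>i. y (e i)) z \<longleftrightarrow> chamber n z \<and> (\<forall>i<n. a i < y (e i) \<and> y (e i) < a (Suc i))" for y
        unfolding linked_left_iff by (auto simp: a_def)
    qed (auto simp: C intro: linked_chamber_lower)
  qed
qed

lemma step_both:
  fixes \<gamma> b :: real
  assumes "0 < \<gamma>" "0 < b"
  obtains C where "0 < C" and "\<And>(e :: nat \<Rightarrow> 'i) z. inj_on e {..<Suc n} \<Longrightarrow>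
    step_integral e (Suc n) \<gamma> (\<lambda>x. x powr (b - 1) * (1 - x powr \<gamma>) ^ K) (\<lambda>y. linked (Suc n) n y z) =
      ennreal C * ennreal (slice_potential \<gamma> (\<lambda>x. x powr b * (1 - x powr \<gamma>) ^ Suc K) n z)"
proof -
  obtain C where C: "0 < C" and *: "\<And>a (e :: nat \<Rightarrow> 'i). inj_on e {..<Suc n} \<Longrightarrow> (\<And>i. i < Suc n \<Longrightarrow> a i < a (Suc i)) \<Longrightarrow>
      a 0 = 0 \<Longrightarrow> a (Suc n) = 1 \<Longrightarrow>
      box_integral e (Suc n) a \<gamma> (\<lambda>u. u powr (b - 1) * (1 - u powr \<gamma>) ^ K) =
      ennreal (C * (vandermonde n (\<lambda>i. a (Suc i) powr \<gamma>) *
          (\<Prod>i<n. a (Suc i) powr b * (1 - a (Suc i) powr \<gamma>) ^ Suc K)))"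
    using nn_integral_interlacing_both[OF assms, of n K, where 'i = 'i] by blast
  show thesis
  proof (rule that[OF C])
    fix e :: "nat \<Rightarrow> 'i" and z :: "nat \<Rightarrow> real"
    assume e: "inj_on e {..<Suc n}"
    define a where "a i = (if i = 0 then 0 else if i \<le> n then z (i - 1) else 1)" for i
    show "step_integral e (Suc n) \<gamma> (\<lambda>x. x powr (b - 1) * (1 - x powr \<gamma>) ^ K) (\<lambda>y. linked (Suc n) n y z) =
      ennreal C * ennreal (slice_potential \<gamma> (\<lambda>x. x powr b * (1 - x powr \<gamma>) ^ Suc K) n z)"
    proof (rule nn_integral_step_glue[where a = a])
      assume ch: "chamber n z"
      have "vandermonde n (\<lambda>i. a (Suc i) powr \<gamma>) = vandermonde n (\<lambda>i. z i powr \<gamma>)"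
        by (auto simp: vandermonde_def a_def intro!: prod.cong)
      moreover have "(\<Prod>i<n. a (Suc i) powr b * (1 - a (Suc i) powr \<gamma>) ^ Suc K) =
          (\<Prod>i<n. z i powr b * (1 - z i powr \<gamma>) ^ Suc K)"
        by (auto simp: a_def intro!: prod.cong)
      moreover have "a i < a (Suc i)" if "i < Suc n" for i using that ch by (auto simp: a_def chamber_def)
      moreover have "a 0 = 0" "a (Suc n) = 1" by (auto simp: a_def)
      ultimately show "box_integral e (Suc n) a \<gamma> (\<lambda>u. u powr (b - 1) * (1 - u powr \<gamma>) ^ K) =
        ennreal (C * (vandermonde n (\<lambda>i. z i powr \<gamma>) * (\<Prod>i<n. z i powr b * (1 - z i powr \<gamma>) ^ Suc K)))"
        using *[OF e, of a] by presburger
    next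
      have "(if i = 0 then 0 else z (i - 1)) = a i \<and> (if i < n then z i else 1) = a (Suc i)" if "i < Suc n" for i
        using that by (auto simp: a_def)
      then show "linked (Suc n) n (\<lambda>i. y (e i)) z \<longleftrightarrow> chamber n z \<and> (\<forall>i<Suc n. a i < y (e i) \<and> y (e i) < a (Suc i))" for y
        unfolding linked_both_iff by simp
    qed (auto simp: C intro: linked_chamber_lower)
  qed
qed

section \<open>Integrating out a chain of slices\<close>

text \<open>Points of the product space over J are extensional functions, whereas the integrands are
  evaluated at arrays with further entries. The second condition makes such values depend on the
  coordinates in J only.\<close>

definition local_on :: "'i set \<Rightarrow> (('i \<Rightarrow> real) \<Rightarrow> ennreal) \<Rightarrow> bool" where
  "local_on J G \<longleftrightarrow> G \<in> borel_measurable (lebPi J) \<and> (\<forall>x y. (\<forall>p\<in>J. x p = y p) \<longrightarrow> G x = G y)"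

lemma local_on_cong: "local_on J G \<Longrightarrow> (\<And>p. p \<in> J \<Longrightarrow> x p = y p) \<Longrightarrow> G x = G y"
  by (auto simp: local_on_def)

text \<open>Restricting the overridden array to J gives a measurable map into the product space over
  J; locality then permits the restriction to be dropped.\<close>

lemma local_on_measurable_override:
  assumes "local_on J G"
  shows "(\<lambda>y. G (override_on x y U)) \<in> borel_measurable (lebPi U)"
proof -
  have "(\<lambda>y. \<lambda>p\<in>J. override_on x y U p) \<in> measurable (lebPi U) (lebPi J)"
  proof (rule measurable_restrict)
    show "(\<lambda>y. override_on x y U p) \<in> measurable (lebPi U) lborel" for p
      by (cases "p \<in> U") (auto simp: override_on_def)
  qed
  then have "(\<lambda>y. G (\<lambda>p\<in>J. override_on x y U p)) \<in> borel_measurable (lebPi U)"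
    using assms by (auto simp: local_on_def intro: measurable_compose)
  also have "(\<lambda>y. G (\<lambda>p\<in>J. override_on x y U p)) = (\<lambda>y. G (override_on x y U))"
    by (intro ext local_on_cong[OF assms]) auto
  finally show ?thesis .
qed

lemma local_on_mono:
  assumes "local_on J G" "J \<subseteq> J'"
  shows "local_on J' G"
proof -
  have "G = (\<lambda>y. G (override_on undefined y J'))"
    using assms by (intro ext local_on_cong[OF assms(1)]) (auto simp: override_on_def)
  then have "G \<in> borel_measurable (lebPi J')"
    using local_on_measurable_override[OF assms(1), of undefined J'] by simp
  moreover have "G x = G y" if "\<forall>p\<in>J'. x p = y p" for x y
    using that assms(2) by (intro local_on_cong[OF assms(1)]) auto
  ultimately show ?thesis by (simp add: local_on_def)
qed

lemma local_on_measurable: "local_on J G \<Longrightarrow> J \<subseteq> J' \<Longrightarrow> G \<in> borel_measurable (lebPi J')"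
  using local_on_mono[of J G J'] by (simp add: local_on_def)

lemma local_on_times:
  assumes "local_on J G" "local_on J H"
  shows "local_on J (\<lambda>x. G x * H x)"
  unfolding local_on_def
proof (intro conjI allI impI)
  have [measurable]: "G \<in> borel_measurable (lebPi J)" "H \<in> borel_measurable (lebPi J)"
    using assms by (simp_all add: local_on_def)
  show "(\<lambda>x. G x * H x) \<in> borel_measurable (lebPi J)" by measurable
  fix x y :: "'a \<Rightarrow> real" assume "\<forall>p\<in>J. x p = y p"
  then show "G x * H x = G y * H y"
    using local_on_cong[OF assms(1), of x y] local_on_cong[OF assms(2), of x y] by simp
qed

lemma local_on_prod:
  assumes "\<And>i. i \<in> I \<Longrightarrow> local_on J (G i)"
  shows "local_on J (\<lambda>x. \<Prod>i\<in>I. G i x)"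
  unfolding local_on_def
proof (intro conjI allI impI)
  show "(\<lambda>x. \<Prod>i\<in>I. G i x) \<in> borel_measurable (lebPi J)"
    using assms by (intro borel_measurable_prod_ennreal) (simp add: local_on_def)
  fix x y :: "'b \<Rightarrow> real" assume "\<forall>p\<in>J. x p = y p"
  then show "(\<Prod>i\<in>I. G i x) = (\<Prod>i\<in>I. G i y)"
    by (intro prod.cong refl local_on_cong[OF assms]) simp_all
qed

text \<open>Iteration of transfer operators: \<open>ker j\<close> couples only the blocks j and j +
  1, and its operator sends \<open>F j\<close> to a multiple of \<open>F (Suc j)\<close>. The
  induction takes the last block as the outer variable, so that the inner integral is the induction
  hypothesis with \<open>x\<close> overridden on that block.\<close>

lemma nn_integral_chain:
  fixes K :: "nat \<Rightarrow> 'i set"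
  assumes fin: "\<And>j. finite (K j)"
    and disj: "\<And>i j. i < j \<Longrightarrow> j \<le> m \<Longrightarrow> K i \<inter> K j = {}"
    and F: "\<And>j. j \<le> m \<Longrightarrow> local_on (K j) (F j)"
    and ker: "\<And>j. j < m \<Longrightarrow> local_on (K j \<union> K (Suc j)) (ker j)"
    and step: "\<And>j x. j < m \<Longrightarrow>
      (\<integral>\<^sup>+y. F j y * ker j (override_on x y (K j)) \<partial>lebPi (K j)) = C j * F (Suc j) x"
  shows "(\<integral>\<^sup>+y. F 0 (override_on x y (\<Union>j<m. K j)) * (\<Prod>j<m. ker j (override_on x y (\<Union>j<m. K j)))
      \<partial>lebPi (\<Union>j<m. K j)) = (\<Prod>j<m. C j) * F m x"
  using disj F ker step
proof (induction m arbitrary: x)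
  case 0
  show ?case by (simp add: PiM_empty nn_integral_count_space_finite override_on_def)
next
  case (Suc m)
  interpret product_sigma_finite "\<lambda>_::'i. lborel :: real measure" by (rule product_sigma_finite_lborel)
  define U where "U = (\<Union>j<m. K j)"
  have "K j \<inter> K m = {} \<and> K j \<inter> K (Suc m) = {}" if "j < m" for j
    using Suc.prems(1)[of j m] Suc.prems(1)[of j "Suc m"] that by simp
  then have U: "finite U" "K m \<inter> U = {}" "K (Suc m) \<inter> U = {}"
    using fin unfolding U_def by blast+
  have mSuc: "K m \<inter> K (Suc m) = {}" using Suc.prems(1)[of m "Suc m"] by simp
  define h where "h x = F 0 x * (\<Prod>j<m. ker j x)" for x
  have h: "local_on (K m \<union> U) h"
    unfolding h_def U_def
  proof (intro local_on_times local_on_prod)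
    show "local_on (K m \<union> (\<Union>j<m. K j)) (F 0)"
    proof (rule local_on_mono[OF Suc.prems(2)[of 0]])
      show "K 0 \<subseteq> K m \<union> (\<Union>j<m. K j)" by (cases "m = 0") blast+
    qed simp
    fix j assume "j \<in> {..<m}"
    then have "j < m" by simp
    moreover from this have "Suc j < m \<or> Suc j = m" by linarith
    ultimately have "K j \<union> K (Suc j) \<subseteq> K m \<union> (\<Union>j<m. K j)" by blast
    then show "local_on (K m \<union> (\<Union>j<m. K j)) (ker j)"
      using \<open>j < m\<close> by (intro local_on_mono[OF Suc.prems(3)[of j]]) simp_all
  qed
  have hk: "local_on (K m \<union> U \<union> K (Suc m)) (\<lambda>x. h x * ker m x)"
    by (intro local_on_times local_on_mono[OF h] local_on_mono[OF Suc.prems(3)[of m]]) auto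
  have UN: "(\<Union>j<Suc m. K j) = K m \<union> U" by (auto simp: U_def less_Suc_eq)
  have "(\<integral>\<^sup>+v. F 0 (override_on x v (\<Union>j<Suc m. K j)) *
        (\<Prod>j<Suc m. ker j (override_on x v (\<Union>j<Suc m. K j))) \<partial>lebPi (\<Union>j<Suc m. K j)) =
      (\<integral>\<^sup>+v. h (override_on x v (K m \<union> U)) * ker m (override_on x v (K m \<union> U)) \<partial>lebPi (K m \<union> U))"
    unfolding UN by (simp add: h_def mult_ac)
  also have "\<dots> = (\<integral>\<^sup>+y. (\<integral>\<^sup>+u. h (override_on x (merge (K m) U (y, u)) (K m \<union> U)) *
        ker m (override_on x (merge (K m) U (y, u)) (K m \<union> U)) \<partial>lebPi U) \<partial>lebPi (K m))"
    by (rule product_nn_integral_fold[OF U(2) fin U(1)])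
      (rule local_on_measurable_override[OF hk])
  also have "\<dots> = (\<integral>\<^sup>+y. (\<Prod>j<m. C j) * (F m y * ker m (override_on x y (K m))) \<partial>lebPi (K m))"
  proof (rule nn_integral_cong)
    fix y
    have eq: "override_on x (merge (K m) U (y, u)) (K m \<union> U) = override_on (override_on x y (K m)) u U" for u
      using U(2) by (auto simp: override_on_def merge_def fun_eq_iff)
    \<comment> \<open>The last kernel does not see the blocks in \<open>U\<close> and therefore
      leaves the inner integral.\<close>
    have ker_eq: "ker m (override_on (override_on x y (K m)) u U) = ker m (override_on x y (K m))" for u
      by (rule local_on_cong[OF Suc.prems(3)[of m]]) (use U in \<open>auto simp: override_on_def\<close>)
    have "(\<integral>\<^sup>+u. h (override_on x (merge (K m) U (y, u)) (K m \<union> U)) *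
        ker m (override_on x (merge (K m) U (y, u)) (K m \<union> U)) \<partial>lebPi U) =
      (\<integral>\<^sup>+u. h (override_on (override_on x y (K m)) u U) \<partial>lebPi U) * ker m (override_on x y (K m))"
      unfolding eq ker_eq
      by (rule nn_integral_multc) (rule local_on_measurable_override[OF h])
    also have "(\<integral>\<^sup>+u. h (override_on (override_on x y (K m)) u U) \<partial>lebPi U) =
        (\<Prod>j<m. C j) * F m (override_on x y (K m))"
      unfolding h_def U_def
      by (rule Suc.IH) (use Suc.prems in \<open>auto simp: less_Suc_eq\<close>)
    also have "F m (override_on x y (K m)) = F m y"
      by (rule local_on_cong[OF Suc.prems(2)[of m]]) auto
    finally show "(\<integral>\<^sup>+u. h (override_on x (merge (K m) U (y, u)) (K m \<union> U)) *
        ker m (override_on x (merge (K m) U (y, u)) (K m \<union> U)) \<partial>lebPi U) =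
      (\<Prod>j<m. C j) * (F m y * ker m (override_on x y (K m)))"
      by (simp add: mult_ac)
  qed
  also have "\<dots> = (\<Prod>j<m. C j) * (\<integral>\<^sup>+y. F m y * ker m (override_on x y (K m)) \<partial>lebPi (K m))"
    using local_on_measurable_override[OF Suc.prems(3)[of m], of x "K m"] local_on_measurable[OF Suc.prems(2)[of m], of "K m"]
    by (intro nn_integral_cmult) simp
  also have "\<dots> = (\<Prod>j<Suc m. C j) * F (Suc m) x"
    by (subst Suc.prems(4)) (auto simp: mult_ac)
  finally show ?case .
qed

text \<open>A Markov property: once the middle block K is fixed, \<open>FL\<close> and
  \<open>FR\<close> share no variable, and Tonelli separates the two sides.\<close>

lemma nn_integral_two_sided:
  fixes K L R :: "'i set"
  assumes fin: "finite K" "finite L" "finite R"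
    and disj: "K \<inter> L = {}" "K \<inter> R = {}" "L \<inter> R = {}"
    and g: "local_on K g" and FL: "local_on (K \<union> L) FL" and FR: "local_on (K \<union> R) FR"
  shows "(\<integral>\<^sup>+x. g x * FL x * FR x \<partial>lebPi (K \<union> (L \<union> R))) =
    (\<integral>\<^sup>+y. g y * (\<integral>\<^sup>+u. FL (override_on y u L) \<partial>lebPi L) * (\<integral>\<^sup>+v. FR (override_on y v R) \<partial>lebPi R) \<partial>lebPi K)"
proof -
  interpret product_sigma_finite "\<lambda>_::'i. lborel :: real measure" by (rule product_sigma_finite_lborel)
  have meas: "local_on (K \<union> (L \<union> R)) (\<lambda>x. g x * FL x * FR x)"
    by (intro local_on_times local_on_mono[OF g] local_on_mono[OF FL] local_on_mono[OF FR]) auto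
  have "(\<integral>\<^sup>+x. g x * FL x * FR x \<partial>lebPi (K \<union> (L \<union> R))) =
    (\<integral>\<^sup>+y. (\<integral>\<^sup>+w. g (merge K (L \<union> R) (y, w)) * FL (merge K (L \<union> R) (y, w)) * FR (merge K (L \<union> R) (y, w))
      \<partial>lebPi (L \<union> R)) \<partial>lebPi K)"
    using disj fin by (intro product_nn_integral_fold local_on_measurable[OF meas]) auto
  also have "\<dots> = (\<integral>\<^sup>+y. g y * (\<integral>\<^sup>+u. FL (override_on y u L) \<partial>lebPi L) * (\<integral>\<^sup>+v. FR (override_on y v R) \<partial>lebPi R) \<partial>lebPi K)"
  proof (rule nn_integral_cong)
    fix y
    have *: "g (merge K (L \<union> R) (y, w)) = g y" "FL (merge K (L \<union> R) (y, w)) = FL (override_on y w L)"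
      "FR (merge K (L \<union> R) (y, w)) = FR (override_on y w R)" for w
      using disj by (auto intro!: local_on_cong[OF g] local_on_cong[OF FL] local_on_cong[OF FR]
          simp: merge_def override_on_def)
    have FL': "local_on L (\<lambda>w. FL (override_on y w L))"
      using local_on_measurable_override[OF FL, of y L]
      by (auto simp: local_on_def override_on_def intro!: local_on_cong[OF FL])
    have FR': "local_on R (\<lambda>w. FR (override_on y w R))"
      using local_on_measurable_override[OF FR, of y R]
      by (auto simp: local_on_def override_on_def intro!: local_on_cong[OF FR])
    have "(\<integral>\<^sup>+w. g (merge K (L \<union> R) (y, w)) * FL (merge K (L \<union> R) (y, w)) * FR (merge K (L \<union> R) (y, w)) \<partial>lebPi (L \<union> R)) =
      (\<integral>\<^sup>+w. g y * FL (override_on y w L) * FR (override_on y w R) \<partial>lebPi (L \<union> R))"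
      unfolding * ..
    also have "\<dots> = (\<integral>\<^sup>+u. (\<integral>\<^sup>+v. g y * FL (override_on y (merge L R (u, v)) L) * FR (override_on y (merge L R (u, v)) R)
        \<partial>lebPi R) \<partial>lebPi L)"
    proof (rule product_nn_integral_fold)
      have "local_on (L \<union> R) (\<lambda>w. g y * FL (override_on y w L) * FR (override_on y w R))"
        by (intro local_on_times local_on_mono[OF FL'] local_on_mono[OF FR']) (auto simp: local_on_def)
      then show "(\<lambda>w. g y * FL (override_on y w L) * FR (override_on y w R)) \<in> borel_measurable (lebPi (L \<union> R))"
        by (simp add: local_on_def)
    qed (use disj fin in auto)
    also have "\<dots> = (\<integral>\<^sup>+u. (\<integral>\<^sup>+v. (g y * FL (override_on y u L)) * FR (override_on y v R) \<partial>lebPi R) \<partial>lebPi L)"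
    proof (intro nn_integral_cong arg_cong2[where f = "(*)"] refl)
      show "FL (override_on y (merge L R (u, v)) L) = FL (override_on y u L)"
        "FR (override_on y (merge L R (u, v)) R) = FR (override_on y v R)" for u v
        using disj by (auto intro!: local_on_cong[OF FL] local_on_cong[OF FR] simp: merge_def override_on_def)
    qed
    also have "\<dots> = (\<integral>\<^sup>+u. (g y * FL (override_on y u L)) * (\<integral>\<^sup>+v. FR (override_on y v R) \<partial>lebPi R) \<partial>lebPi L)"
      by (intro nn_integral_cong nn_integral_cmult local_on_measurable[OF FR']) auto
    also have "\<dots> = g y * (\<integral>\<^sup>+u. FL (override_on y u L) \<partial>lebPi L) * (\<integral>\<^sup>+v. FR (override_on y v R) \<partial>lebPi R)"
      using local_on_measurable[OF FL', of L]
      by (subst nn_integral_multc) (auto simp: nn_integral_cmult)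
    finally show "(\<integral>\<^sup>+w. g (merge K (L \<union> R) (y, w)) * FL (merge K (L \<union> R) (y, w)) * FR (merge K (L \<union> R) (y, w)) \<partial>lebPi (L \<union> R)) =
      g y * (\<integral>\<^sup>+u. FL (override_on y u L) \<partial>lebPi L) * (\<integral>\<^sup>+v. FR (override_on y v R) \<partial>lebPi R)" .
  qed
  finally show ?thesis .
qed

lemma local_on_slice_potential:
  assumes "\<And>i. i < n \<Longrightarrow> e i \<in> J" and [measurable]: "w \<in> borel_measurable borel"
  shows "local_on J (\<lambda>x. ennreal (slice_potential \<gamma> w n (\<lambda>i. x (e i))))"
proof -
  have comp: "(\<lambda>x. f (x (e i))) \<in> borel_measurable (lebPi J)" if "i < n" "f \<in> borel_measurable borel" for i and f :: "real \<Rightarrow> real"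
    using measurable_component_singleton[OF assms(1)[OF that(1)], of "\<lambda>_. lborel"] that(2)
    by (intro measurable_compose[OF _ that(2)]) simp
  have id: "(\<lambda>x. x (e i)) \<in> borel_measurable (lebPi J)" if "i < n" for i
    using comp[OF that, of "\<lambda>x. x"] by simp
  have "Measurable.pred (lebPi J) (\<lambda>x. chamber n (\<lambda>i. x (e i)))"
    unfolding chamber_def
    by (intro pred_intros_logic(3) pred_intros_countable(1) pred_intros_imp' borel_measurable_pred_less id borel_measurable_const) auto
  then have "(\<lambda>x. of_bool (chamber n (\<lambda>i. x (e i))) :: real) \<in> borel_measurable (lebPi J)"
    by (rule measurable_compose) simp
  moreover have "(\<lambda>x. vandermonde n (\<lambda>i. x (e i) powr \<gamma>)) \<in> borel_measurable (lebPi J)"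
    unfolding vandermonde_def
    by (intro borel_measurable_prod borel_measurable_diff comp) auto
  moreover have "(\<lambda>x. \<Prod>i<n. w (x (e i))) \<in> borel_measurable (lebPi J)"
    by (intro borel_measurable_prod comp) auto
  ultimately have "(\<lambda>x. slice_potential \<gamma> w n (\<lambda>i. x (e i))) \<in> borel_measurable (lebPi J)"
    unfolding slice_potential_def by simp
  moreover have "slice_potential \<gamma> w n (\<lambda>i. x (e i)) = slice_potential \<gamma> w n (\<lambda>i. y (e i))"
    if "\<forall>p\<in>J. x p = y p" for x y
    unfolding slice_potential_def chamber_def vandermonde_def using that assms(1)
    by (auto intro!: arg_cong2[where f = "(*)"] prod.cong)
  ultimately show ?thesis unfolding local_on_def by (metis measurable_compose measurable_ennreal)
qed

lemma local_on_prod_entries: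
  assumes "\<And>i. i < n \<Longrightarrow> e i \<in> J" and [measurable]: "w \<in> borel_measurable borel"
  shows "local_on J (\<lambda>x. ennreal (\<Prod>i<n. w (x (e i))))"
proof -
  have "(\<lambda>x. w (x (e i))) \<in> borel_measurable (lebPi J)" if "i < n" for i
    using measurable_component_singleton[OF assms(1)[OF that], of "\<lambda>_. lborel"]
    by (intro measurable_compose[OF _ assms(2)]) simp
  then show ?thesis
    using assms(1) by (auto simp: local_on_def intro!: borel_measurable_prod arg_cong[where f = ennreal] prod.cong measurable_compose[OF _ measurable_ennreal])
qed

lemma local_on_linked:
  assumes "\<And>i. i < n \<Longrightarrow> e i \<in> J" "\<And>i. i < m \<Longrightarrow> e' i \<in> J" "m \<le> n"
  shows "local_on J (\<lambda>x. of_bool (linked n m (\<lambda>i. x (e i)) (\<lambda>i. x (e' i))))"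
proof -
  have m: "(\<lambda>x. x (e i)) \<in> borel_measurable (lebPi J)" if "i < n" for i
    using measurable_component_singleton[OF assms(1)[OF that], of "\<lambda>_. lborel"] by simp
  have m': "(\<lambda>x. x (e' i)) \<in> borel_measurable (lebPi J)" if "i < m" for i
    using measurable_component_singleton[OF assms(2)[OF that], of "\<lambda>_. lborel"] by simp
  have "Measurable.pred (lebPi J) (\<lambda>x. linked n m (\<lambda>i. x (e i)) (\<lambda>i. x (e' i)))"
    unfolding linked_def unit_entries_def interlaced_def
    using assms(3)
    by (intro pred_intros_logic(3) pred_intros_countable(1) pred_intros_imp' borel_measurable_pred_less m m' borel_measurable_const) auto
  then have "(\<lambda>x. of_bool (linked n m (\<lambda>i. x (e i)) (\<lambda>i. x (e' i))) :: ennreal) \<in> borel_measurable (lebPi J)"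
    by (rule measurable_compose) simp
  moreover have "linked n m (\<lambda>i. x (e i)) (\<lambda>i. x (e' i)) = linked n m (\<lambda>i. y (e i)) (\<lambda>i. y (e' i))"
    if "\<forall>p\<in>J. x p = y p" for x y
    using that assms by (auto simp: linked_def interlaced_def unit_entries_def)
  ultimately show ?thesis by (auto simp: local_on_def)
qed

section \<open>The limiting density and its slices\<close>

lemma linked_cong:
  assumes "\<And>i. i < n \<Longrightarrow> y i = y' i" "\<And>i. i < m \<Longrightarrow> z i = z' i" "m \<le> n"
  shows "linked n m y z \<longleftrightarrow> linked n m y' z'"
  using assms by (auto simp: linked_def interlaced_def unit_entries_def)

lemma slice_potential_times:
  assumes "\<And>u. 0 \<le> v u"
  shows "ennreal (slice_potential \<gamma> w n z) * ennreal (\<Prod>i<n. v (z i)) =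
    ennreal (slice_potential \<gamma> (\<lambda>u. w u * v u) n z)"
proof -
  have "0 \<le> (\<Prod>i<n. v (z i))" using assms by (simp add: prod_nonneg)
  then show ?thesis
    unfolding slice_potential_def prod.distrib by (subst ennreal_mult''[symmetric]) (simp_all add: mult_ac)
qed

section \<open>Slices of the limiting array, their weights and the potentials from either
  side\<close>

locale plane_partition_limit =
  fixes \<alpha> \<eta> \<theta> :: real and M N :: nat
  assumes \<alpha>: "0 \<le> \<alpha>" and \<eta>: "0 < \<eta>" and \<theta>: "0 < \<theta>" and M1: "1 \<le> M" and MN: "M \<le> N"
begin

text \<open>With q = e^(-\<epsilon>) and a = e^(-\<alpha>\<epsilon>), one unit of central volume has
  weight a q^((\<eta>+\<theta>)/2) = q^\<beta>.\<close>

definition \<beta> :: real where "\<beta> = \<alpha> + (\<eta> + \<theta>) / 2"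

definition expo :: "int \<Rightarrow> real" where
  "expo t = (if t < 0 then \<eta> else if t = 0 then \<beta> else \<theta>)"

abbreviation (input) lo :: int where "lo \<equiv> - int M + 1"
abbreviation (input) hi :: int where "hi \<equiv> int N - 1"
abbreviation L :: "int \<Rightarrow> nat" where "L \<equiv> Lt M N"

definition slice_idx :: "int \<Rightarrow> (int \<times> nat) set" where
  "slice_idx t = (\<lambda>i. (t, Suc i)) ` {..<L t}"

text \<open>The factors per entry, besides the Vandermonde determinants, that appear in slice \<open>t\<close> when all
  slices to its left, respectively to its right, are integrated out.\<close>

definition left_weight :: "int \<Rightarrow> real \<Rightarrow> real" where
  "left_weight t u = (if t \<le> 0 then 1
     else u powr (\<beta> + real_of_int (t - 1) * \<theta>) * (1 - u powr \<eta>) ^ (M - (N - nat t)))"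

definition right_weight :: "int \<Rightarrow> real \<Rightarrow> real" where
  "right_weight t u = (if t \<ge> 0 then (1 - u powr \<theta>) ^ (N - nat t - M)
     else u powr (\<beta> + real_of_int (- t - 1) * \<eta>) * (1 - u powr \<theta>) ^ (N - (M - nat (- t))))"

text \<open>In both cases the slice nearer to the centre comes first: it holds the smaller entries
  and is at least as long as the other.\<close>

definition slice_link :: "int \<Rightarrow> (int \<times> nat \<Rightarrow> real) \<Rightarrow> bool" where
  "slice_link t x = (if t < 0
     then linked (L (t + 1)) (L t) (\<lambda>i. x (t + 1, Suc i)) (\<lambda>i. x (t, Suc i))
     else linked (L t) (L (t + 1)) (\<lambda>i. x (t, Suc i)) (\<lambda>i. x (t + 1, Suc i)))"

definition slice_weight :: "int \<Rightarrow> (int \<times> nat \<Rightarrow> real) \<Rightarrow> ennreal" where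
  "slice_weight t x = ennreal (\<Prod>i<L t. x (t, Suc i) powr (expo t - 1))"

definition left_pot :: "int \<Rightarrow> (int \<times> nat \<Rightarrow> real) \<Rightarrow> ennreal" where
  "left_pot t x = ennreal (slice_potential \<eta> (left_weight t) (L t) (\<lambda>i. x (t, Suc i)))"

definition right_pot :: "int \<Rightarrow> (int \<times> nat \<Rightarrow> real) \<Rightarrow> ennreal" where
  "right_pot t x = ennreal (slice_potential \<theta> (right_weight t) (L t) (\<lambda>i. x (t, Suc i)))"

lemma \<beta>_pos: "0 < \<beta>"
  unfolding \<beta>_def using \<alpha> \<eta> \<theta> by (intro add_nonneg_pos) auto

lemma expo_pos: "0 < expo t"
  using \<beta>_pos \<eta> \<theta> by (simp add: expo_def)

lemma L_neg: "lo \<le> t \<Longrightarrow> t < 0 \<Longrightarrow> L (t + 1) = Suc (L t)"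
  by (auto simp: Lt_def)

lemma L_nonneg: "0 \<le> t \<Longrightarrow> L t = min (nat (int N - t)) M"
  using MN by (auto simp: Lt_def)

lemma L_const: "0 \<le> t \<Longrightarrow> int M \<le> int N - (t + 1) \<Longrightarrow> L (t + 1) = L t"
  by (auto simp: L_nonneg)

lemma L_decr: "0 \<le> t \<Longrightarrow> t < hi \<Longrightarrow> int N - (t + 1) < int M \<Longrightarrow> L t = Suc (L (t + 1))"
  by (auto simp: L_nonneg)

lemma L_lo: "L lo = 1" and L_hi: "L hi = 1"
  using M1 MN by (auto simp: Lt_def)

lemma finite_slice_idx: "finite (slice_idx t)"
  by (simp add: slice_idx_def)

lemma slice_idx_iff: "(s, k) \<in> slice_idx t \<longleftrightarrow> s = t \<and> 1 \<le> k \<and> k \<le> L t"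
  by (cases k) (auto simp: slice_idx_def)

lemma slice_idx_disjoint: "s \<noteq> t \<Longrightarrow> slice_idx s \<inter> slice_idx t = {}"
  by (auto simp: slice_idx_def)

lemma slice_link_override_left:
  assumes "lo \<le> t" "t < hi"
  shows "slice_link t (override_on x y (slice_idx t)) \<longleftrightarrow>
    (if t < 0 then linked (L (t + 1)) (L t) (\<lambda>i. x (t + 1, Suc i)) (\<lambda>i. y (t, Suc i))
     else linked (L t) (L (t + 1)) (\<lambda>i. y (t, Suc i)) (\<lambda>i. x (t + 1, Suc i)))"
proof -
  have "t < 0 \<Longrightarrow> L t \<le> L (t + 1)" "0 \<le> t \<Longrightarrow> L (t + 1) \<le> L t"
    using assms L_neg[of t] by (auto simp: L_nonneg)
  then show ?thesis
    unfolding slice_link_def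
    by (cases "t < 0") (simp_all, (rule linked_cong; simp add: override_on_def slice_idx_iff)+)
qed

lemma slice_link_override_right:
  assumes "lo \<le> t" "t < hi"
  shows "slice_link t (override_on x y (slice_idx (t + 1))) \<longleftrightarrow>
    (if t < 0 then linked (L (t + 1)) (L t) (\<lambda>i. y (t + 1, Suc i)) (\<lambda>i. x (t, Suc i))
     else linked (L t) (L (t + 1)) (\<lambda>i. x (t, Suc i)) (\<lambda>i. y (t + 1, Suc i)))"
proof -
  have "t < 0 \<Longrightarrow> L t \<le> L (t + 1)" "0 \<le> t \<Longrightarrow> L (t + 1) \<le> L t"
    using assms L_neg[of t] by (auto simp: L_nonneg)
  then show ?thesis
    unfolding slice_link_def
    by (cases "t < 0") (simp_all, (rule linked_cong; simp add: override_on_def slice_idx_iff)+)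
qed

lemma slice_weight_override: "slice_weight t (override_on x y (slice_idx t)) = slice_weight t y"
  unfolding slice_weight_def
  by (intro arg_cong[where f = ennreal] prod.cong) (auto simp: override_on_def slice_idx_def)

lemma pot_times_slice_weight:
  "ennreal (slice_potential \<gamma> w (L t) (\<lambda>i. y (t, Suc i))) * slice_weight t y =
    ennreal (slice_potential \<gamma> (\<lambda>u. w u * u powr (expo t - 1)) (L t) (\<lambda>i. y (t, Suc i)))"
  unfolding slice_weight_def by (rule slice_potential_times) simp

text \<open>Three regimes. For t < 0 slice t lies inside the longer slice t + 1
  (\<open>step_inside\<close>); from the centre on, as long as the lengths stay equal to M, the free
  end is 0 (\<open>step_left\<close>); once the slices shrink, both 0 and 1 are ends
  (\<open>step_both\<close>). The determinant stays in x^\<eta> throughout.\<close>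

lemma left_step:
  assumes t: "lo \<le> t" "t < hi"
  shows "\<exists>C>0. \<forall>x. (\<integral>\<^sup>+y. left_pot t y *
      (slice_weight t (override_on x y (slice_idx t)) * of_bool (slice_link t (override_on x y (slice_idx t))))
      \<partial>lebPi (slice_idx t)) = ennreal C * left_pot (t + 1) x"
proof -
  define w where "w u = left_weight t u * u powr (expo t - 1)" for u
  have inj: "inj_on (\<lambda>i. (t, Suc i)) {..<L t}" by (auto simp: inj_on_def)
  have eq: "left_pot t y * (slice_weight t (override_on x y (slice_idx t)) * P) =
      ennreal (slice_potential \<eta> w (L t) (\<lambda>i. y (t, Suc i))) * P" for x y P
    unfolding slice_weight_override w_def left_pot_def
    by (simp add: pot_times_slice_weight flip: mult.assoc)
  show ?thesis
    unfolding eq slice_link_override_left[OF t]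
  proof (cases "t < 0")
    case True
    have w: "slice_potential \<eta> w n = slice_potential \<eta> (\<lambda>u. u powr (\<eta> - 1)) n" for n
      using True by (intro slice_potential_cong) (simp add: w_def left_weight_def expo_def)
    have w': "left_weight (t + 1) = (\<lambda>_. 1)" using True by (simp add: left_weight_def fun_eq_iff)
    obtain C where "0 < C" and "\<And>(e :: nat \<Rightarrow> int \<times> nat) z. inj_on e {..<L t} \<Longrightarrow>
      step_integral e (L t) \<eta> (\<lambda>x. x powr (\<eta> - 1)) (linked (Suc (L t)) (L t) z) =
      ennreal C * ennreal (slice_potential \<eta> (\<lambda>_. 1) (Suc (L t)) z)"
      using step_inside[OF \<eta>, of "L t", where 'i = "int \<times> nat"] by blast
    from this(1) this(2)[OF inj] show "\<exists>C>0. \<forall>x. (\<integral>\<^sup>+y. ennreal (slice_potential \<eta> w (L t) (\<lambda>i. y (t, Suc i))) *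
        of_bool (if t < 0 then linked (L (t + 1)) (L t) (\<lambda>i. x (t + 1, Suc i)) (\<lambda>i. y (t, Suc i))
          else linked (L t) (L (t + 1)) (\<lambda>i. y (t, Suc i)) (\<lambda>i. x (t + 1, Suc i)))
        \<partial>lebPi (slice_idx t)) = ennreal C * left_pot (t + 1) x"
      using True by (intro exI[of _ C]) (simp add: w w' left_pot_def slice_idx_def L_neg[OF t(1)])
  next
    case False
    \<comment> \<open>Slice t enters with total exponent b - 1: this is \<beta> - 1 at the centre,
      and later the accumulated \<beta> + (t - 1) \<theta> together with \<theta> - 1 from the slice
      weight.\<close>
    define b where "b = \<beta> + real_of_int t * \<theta>"
    define K where "K = M - (N - nat t)"
    have b: "0 < b" unfolding b_def using False \<beta>_pos \<theta> by (auto intro!: add_pos_nonneg)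
    have w: "slice_potential \<eta> w n = slice_potential \<eta> (\<lambda>u. u powr (b - 1) * (1 - u powr \<eta>) ^ K) n" for n
    proof (rule slice_potential_cong)
      fix u :: real assume "0 < u" "u < 1"
      show "w u = u powr (b - 1) * (1 - u powr \<eta>) ^ K"
      proof (cases "t = 0")
        case True
        then show ?thesis using MN by (simp add: w_def left_weight_def b_def K_def expo_def)
      next
        case F: False
        have "u powr (\<beta> + real_of_int (t - 1) * \<theta>) * u powr (\<theta> - 1) = u powr (b - 1)"
          by (simp add: b_def algebra_simps flip: powr_add)
        then show ?thesis using F False by (simp add: w_def left_weight_def K_def expo_def mult_ac)
      qed
    qed
    show "\<exists>C>0. \<forall>x. (\<integral>\<^sup>+y. ennreal (slice_potential \<eta> w (L t) (\<lambda>i. y (t, Suc i))) *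
        of_bool (if t < 0 then linked (L (t + 1)) (L t) (\<lambda>i. x (t + 1, Suc i)) (\<lambda>i. y (t, Suc i))
          else linked (L t) (L (t + 1)) (\<lambda>i. y (t, Suc i)) (\<lambda>i. x (t + 1, Suc i)))
        \<partial>lebPi (slice_idx t)) = ennreal C * left_pot (t + 1) x"
    proof (cases "int M \<le> int N - (t + 1)")
      case True
      \<comment> \<open>Subtraction of naturals truncates, so the power of 1 - x^\<eta> is 0 until
        the slices begin to shrink.\<close>
      have K0: "K = 0" "M - (N - nat (t + 1)) = 0" using True False by (auto simp: K_def)
      have w': "left_weight (t + 1) = (\<lambda>u. u powr b)"
        using False K0(2) by (simp add: left_weight_def b_def fun_eq_iff)
      obtain C where "0 < C" and "\<And>(e :: nat \<Rightarrow> int \<times> nat) z. inj_on e {..<L t} \<Longrightarrow>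
        step_integral e (L t) \<eta> (\<lambda>x. x powr (b - 1)) (\<lambda>y. linked (L t) (L t) y z) =
        ennreal C * ennreal (slice_potential \<eta> (\<lambda>x. x powr b) (L t) z)"
        using step_left[OF \<eta> b, of "L t", where 'i = "int \<times> nat"] by blast
      from this(1) this(2)[OF inj] show ?thesis
        using False True by (intro exI[of _ C]) (simp add: w w' K0 left_pot_def slice_idx_def L_const)
    next
      case F: False
      have L: "L t = Suc (L (t + 1))" using L_decr[of t] F False t by simp
      have K: "M - (N - nat (t + 1)) = Suc K" using F False t by (auto simp: K_def)
      have w': "left_weight (t + 1) = (\<lambda>u. u powr b * (1 - u powr \<eta>) ^ Suc K)"
        using False K by (simp add: left_weight_def b_def fun_eq_iff)
      obtain C where "0 < C" and "\<And>(e :: nat \<Rightarrow> int \<times> nat) z. inj_on e {..<Suc (L (t + 1))} \<Longrightarrow>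
        step_integral e (Suc (L (t + 1))) \<eta> (\<lambda>x. x powr (b - 1) * (1 - x powr \<eta>) ^ K) (\<lambda>y. linked (Suc (L (t + 1))) (L (t + 1)) y z) =
        ennreal C * ennreal (slice_potential \<eta> (\<lambda>x. x powr b * (1 - x powr \<eta>) ^ Suc K) (L (t + 1)) z)"
        using step_both[OF \<eta> b, where n = "L (t + 1)" and K = K, where 'i = "int \<times> nat"] by blast
      from this(1) this(2)[OF inj[unfolded L]] show ?thesis
        using False by (intro exI[of _ C]) (simp add: w w' left_pot_def slice_idx_def L del: power_Suc)
    qed
  qed
qed

text \<open>The mirror image is not symmetric because M \<le> N. Moving left, the growing slices at
  the right end contain their predecessors (\<open>step_inside\<close>), those of constant length M
  have the free end 1 (\<open>step_right\<close>), and left of the centre each slice is one entry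
  shorter than the one integrated out (\<open>step_both\<close>).\<close>

lemma right_step:
  assumes t: "lo \<le> t" "t < hi"
  shows "\<exists>C>0. \<forall>x. (\<integral>\<^sup>+y. right_pot (t + 1) y *
      (slice_weight (t + 1) (override_on x y (slice_idx (t + 1))) *
       of_bool (slice_link t (override_on x y (slice_idx (t + 1)))))
      \<partial>lebPi (slice_idx (t + 1))) = ennreal C * right_pot t x"
proof -
  define w where "w u = right_weight (t + 1) u * u powr (expo (t + 1) - 1)" for u
  have inj: "inj_on (\<lambda>i. (t + 1, Suc i)) {..<L (t + 1)}" by (auto simp: inj_on_def)
  have eq: "right_pot (t + 1) y * (slice_weight (t + 1) (override_on x y (slice_idx (t + 1))) * P) =
      ennreal (slice_potential \<theta> w (L (t + 1)) (\<lambda>i. y (t + 1, Suc i))) * P" for x y P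
    unfolding slice_weight_override w_def right_pot_def
    by (simp add: pot_times_slice_weight flip: mult.assoc)
  show ?thesis
    unfolding eq slice_link_override_right[OF t]
  proof (cases "t < 0")
    case True
    \<comment> \<open>Slice t + 1 enters with exponent b - 1: this is \<beta> - 1 at the centre, and
      left of it \<eta> - 1 from the slice weight added to the accumulated \<beta> + (- t - 2)
      \<eta>.\<close>
    define b where "b = \<beta> + real_of_int (- t - 1) * \<eta>"
    define K where "K = N - (M - nat (- (t + 1)))"
    have b: "0 < b" unfolding b_def using True \<beta>_pos \<eta> by (auto intro!: add_pos_nonneg)
    have L: "L (t + 1) = Suc (L t)" using True t by (simp add: L_neg)
    have w: "slice_potential \<theta> w n = slice_potential \<theta> (\<lambda>u. u powr (b - 1) * (1 - u powr \<theta>) ^ K) n" for n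
    proof (rule slice_potential_cong)
      fix u :: real assume "0 < u" "u < 1"
      show "w u = u powr (b - 1) * (1 - u powr \<theta>) ^ K"
      proof (cases "t + 1 = 0")
        case T: True
        then have "t = - 1" by simp
        then show ?thesis by (simp add: w_def right_weight_def b_def K_def expo_def)
      next
        case F: False
        have "u powr (\<beta> + real_of_int (- (t + 1) - 1) * \<eta>) * u powr (\<eta> - 1) = u powr (b - 1)"
          by (simp add: b_def algebra_simps flip: powr_add)
        then show ?thesis using F True by (simp add: w_def right_weight_def K_def expo_def mult_ac)
      qed
    qed
    have K: "N - (M - nat (- t)) = Suc K" using True t MN by (auto simp: K_def)
    have w': "right_weight t = (\<lambda>u. u powr b * (1 - u powr \<theta>) ^ Suc K)"
      using True K by (simp add: right_weight_def b_def fun_eq_iff)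
    obtain C where "0 < C" and "\<And>(e :: nat \<Rightarrow> int \<times> nat) z. inj_on e {..<Suc (L t)} \<Longrightarrow>
        step_integral e (Suc (L t)) \<theta> (\<lambda>x. x powr (b - 1) * (1 - x powr \<theta>) ^ K) (\<lambda>y. linked (Suc (L t)) (L t) y z) =
        ennreal C * ennreal (slice_potential \<theta> (\<lambda>x. x powr b * (1 - x powr \<theta>) ^ Suc K) (L t) z)"
      using step_both[OF \<theta> b, where n = "L t" and K = K, where 'i = "int \<times> nat"] by blast
    from this(1) this(2)[OF inj[unfolded L]] show "\<exists>C>0. \<forall>x. (\<integral>\<^sup>+y. ennreal (slice_potential \<theta> w (L (t + 1)) (\<lambda>i. y (t + 1, Suc i))) *
        of_bool (if t < 0 then linked (L (t + 1)) (L t) (\<lambda>i. y (t + 1, Suc i)) (\<lambda>i. x (t, Suc i))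
          else linked (L t) (L (t + 1)) (\<lambda>i. x (t, Suc i)) (\<lambda>i. y (t + 1, Suc i)))
        \<partial>lebPi (slice_idx (t + 1))) = ennreal C * right_pot t x"
      using True by (intro exI[of _ C]) (simp add: w w' right_pot_def slice_idx_def L del: power_Suc)
  next
    case False
    define K where "K = N - nat (t + 1) - M"
    have w: "slice_potential \<theta> w n = slice_potential \<theta> (\<lambda>u. u powr (\<theta> - 1) * (1 - u powr \<theta>) ^ K) n" for n
      using False by (intro slice_potential_cong) (simp add: w_def right_weight_def expo_def K_def mult_ac)
    show "\<exists>C>0. \<forall>x. (\<integral>\<^sup>+y. ennreal (slice_potential \<theta> w (L (t + 1)) (\<lambda>i. y (t + 1, Suc i))) *
        of_bool (if t < 0 then linked (L (t + 1)) (L t) (\<lambda>i. y (t + 1, Suc i)) (\<lambda>i. x (t, Suc i))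
          else linked (L t) (L (t + 1)) (\<lambda>i. x (t, Suc i)) (\<lambda>i. y (t + 1, Suc i)))
        \<partial>lebPi (slice_idx (t + 1))) = ennreal C * right_pot t x"
    proof (cases "int M \<le> int N - (t + 1)")
      case True
      have L: "L t = L (t + 1)" using True False by (simp add: L_const)
      have K: "N - nat t - M = Suc K" using True False by (auto simp: K_def)
      have w': "right_weight t = (\<lambda>u. (1 - u powr \<theta>) ^ Suc K)"
        using False K by (simp add: right_weight_def fun_eq_iff)
      obtain C where "0 < C" and "\<And>(e :: nat \<Rightarrow> int \<times> nat) z. inj_on e {..<L (t + 1)} \<Longrightarrow>
        step_integral e (L (t + 1)) \<theta> (\<lambda>x. x powr (\<theta> - 1) * (1 - x powr \<theta>) ^ K) (linked (L (t + 1)) (L (t + 1)) z) =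
        ennreal C * ennreal (slice_potential \<theta> (\<lambda>x. (1 - x powr \<theta>) ^ Suc K) (L (t + 1)) z)"
        using step_right[OF \<theta>, where n = "L (t + 1)" and K = K, where 'i = "int \<times> nat"] by blast
      from this(1) this(2)[OF inj] show ?thesis
        using False by (intro exI[of _ C]) (simp add: w w' right_pot_def slice_idx_def L del: power_Suc)
    next
      case F: False
      have L: "L t = Suc (L (t + 1))" using L_decr[of t] F False t by simp
      have K0: "K = 0" "N - nat t - M = 0" using F False t by (auto simp: K_def)
      have w': "right_weight t = (\<lambda>_. 1)"
        using False K0 by (simp add: right_weight_def fun_eq_iff)
      obtain C where "0 < C" and "\<And>(e :: nat \<Rightarrow> int \<times> nat) z. inj_on e {..<L (t + 1)} \<Longrightarrow>
        step_integral e (L (t + 1)) \<theta> (\<lambda>x. x powr (\<theta> - 1)) (linked (Suc (L (t + 1))) (L (t + 1)) z) =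
        ennreal C * ennreal (slice_potential \<theta> (\<lambda>_. 1) (Suc (L (t + 1))) z)"
        using step_inside[OF \<theta>, of "L (t + 1)", where 'i = "int \<times> nat"] by blast
      from this(1) this(2)[OF inj] show ?thesis
        using False by (intro exI[of _ C]) (simp add: w w' K0 right_pot_def slice_idx_def L)
    qed
  qed
qed

section \<open>Locality of the factors: each depends on one slice or on two neighbouring
  ones\<close>

lemma measurable_left_weight: "left_weight t \<in> borel_measurable borel"
  unfolding left_weight_def by (cases "t \<le> 0") simp_all

lemma measurable_right_weight: "right_weight t \<in> borel_measurable borel"
  unfolding right_weight_def by (cases "t \<ge> 0") simp_all

lemma local_on_left_pot: "local_on (slice_idx t) (left_pot t)"
  unfolding left_pot_def[abs_def]
  by (rule local_on_slice_potential) (auto simp: slice_idx_iff measurable_left_weight)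

lemma local_on_right_pot: "local_on (slice_idx t) (right_pot t)"
  unfolding right_pot_def[abs_def]
  by (rule local_on_slice_potential) (auto simp: slice_idx_iff measurable_right_weight)

lemma local_on_slice_weight: "local_on (slice_idx t) (slice_weight t)"
  unfolding slice_weight_def[abs_def]
  by (rule local_on_prod_entries[where w = "\<lambda>u. u powr (expo t - 1)"]) (auto simp: slice_idx_iff)

lemma local_on_slice_link:
  assumes "lo \<le> t" "t < hi"
  shows "local_on (slice_idx t \<union> slice_idx (t + 1)) (\<lambda>x. of_bool (slice_link t x))"
proof -
  have "t < 0 \<Longrightarrow> L t \<le> L (t + 1)" "0 \<le> t \<Longrightarrow> L (t + 1) \<le> L t"
    using assms L_neg[of t] by (auto simp: L_nonneg)
  then show ?thesis
    unfolding slice_link_def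
    by (cases "t < 0") (auto intro!: local_on_linked simp: slice_idx_iff)
qed

text \<open>The chain of left steps, with slices numbered by their distance from the left end. The
  initial function is consistent with the density: at the left end there is a single entry, the
  Vandermonde product is empty and the left weight is 1, so that \<open>left_pot\<close> is merely
  the indicator of the chamber.\<close>

lemma left_integral:
  assumes t: "lo \<le> t" "t \<le> hi"
  defines "U \<equiv> (\<Union>s\<in>{lo..<t}. slice_idx s)"
  shows "\<exists>C>0. \<forall>x. (\<integral>\<^sup>+y. left_pot lo (override_on x y U) *
      (\<Prod>s\<in>{lo..<t}. slice_weight s (override_on x y U) * of_bool (slice_link s (override_on x y U))) \<partial>lebPi U) =
    ennreal C * left_pot t x"
proof -
  define m where "m = nat (t - lo)"
  define ker where "ker s x = slice_weight s x * of_bool (slice_link s x)" for s x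
  have image: "{lo..<t} = (\<lambda>j. lo + int j) ` {..<m}"
  proof -
    have "s \<in> (\<lambda>j. lo + int j) ` {..<m}" if "s \<in> {lo..<t}" for s
      using that by (intro image_eqI[of _ _ "nat (s - lo)"]) (auto simp: m_def)
    then show ?thesis using t by (auto simp: m_def)
  qed
  have inj: "inj_on (\<lambda>j. lo + int j) {..<m}" by (auto simp: inj_on_def)
  have "\<forall>j. \<exists>C. j < m \<longrightarrow> 0 < C \<and> (\<forall>x. (\<integral>\<^sup>+y. left_pot (lo + int j) y *
      ker (lo + int j) (override_on x y (slice_idx (lo + int j))) \<partial>lebPi (slice_idx (lo + int j))) =
      ennreal C * left_pot (lo + int (Suc j)) x)"
  proof
    fix j
    show "\<exists>C. j < m \<longrightarrow> 0 < C \<and> (\<forall>x. (\<integral>\<^sup>+y. left_pot (lo + int j) y *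
      ker (lo + int j) (override_on x y (slice_idx (lo + int j))) \<partial>lebPi (slice_idx (lo + int j))) =
      ennreal C * left_pot (lo + int (Suc j)) x)"
    proof (cases "j < m")
      case True
      then have "lo \<le> lo + int j" "lo + int j < hi" using t by (auto simp: m_def)
      from left_step[OF this] show ?thesis unfolding ker_def by (simp add: add_ac)
    qed simp
  qed
  from choice[OF this] obtain C where C': "\<forall>j. j < m \<longrightarrow> 0 < C j \<and> (\<forall>x. (\<integral>\<^sup>+y. left_pot (lo + int j) y *
      ker (lo + int j) (override_on x y (slice_idx (lo + int j))) \<partial>lebPi (slice_idx (lo + int j))) =
      ennreal (C j) * left_pot (lo + int (Suc j)) x)"
    by (rule exE)
  then have C: "\<And>j. j < m \<Longrightarrow> 0 < C j" "\<And>j x. j < m \<Longrightarrow> (\<integral>\<^sup>+y. left_pot (lo + int j) y *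
      ker (lo + int j) (override_on x y (slice_idx (lo + int j))) \<partial>lebPi (slice_idx (lo + int j))) =
      ennreal (C j) * left_pot (lo + int (Suc j)) x" by simp_all
  have U: "U = (\<Union>j<m. slice_idx (lo + int j))"
    unfolding U_def image by simp
  have "(\<integral>\<^sup>+y. left_pot (lo + int 0) (override_on x y U) * (\<Prod>j<m. ker (lo + int j) (override_on x y U)) \<partial>lebPi U) =
      (\<Prod>j<m. ennreal (C j)) * left_pot (lo + int m) x" for x
    unfolding U
  proof (rule nn_integral_chain[where F = "\<lambda>j. left_pot (lo + int j)" and ker = "\<lambda>j. ker (lo + int j)"])
    fix j assume "j < m"
    then have j: "lo \<le> lo + int j" "lo + int j < hi" using t by (auto simp: m_def)
    have "local_on (slice_idx (lo + int j) \<union> slice_idx (lo + int j + 1)) (\<lambda>x. slice_weight (lo + int j) x * of_bool (slice_link (lo + int j) x))"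
      by (intro local_on_times local_on_slice_link[OF j] local_on_mono[OF local_on_slice_weight]) auto
    then show "local_on (slice_idx (lo + int j) \<union> slice_idx (lo + int (Suc j))) (ker (lo + int j))"
      unfolding ker_def[abs_def] by (simp add: add_ac)
  qed (use C in \<open>auto simp: finite_slice_idx slice_idx_disjoint local_on_left_pot\<close>)
  moreover have "(\<Prod>s\<in>{lo..<t}. h s) = (\<Prod>j<m. h (lo + int j))" for h :: "int \<Rightarrow> ennreal"
    unfolding image by (subst prod.reindex[OF inj]) simp
  moreover have "lo + int m = t" using t by (simp add: m_def)
  moreover have "(\<Prod>j<m. ennreal (C j)) = ennreal (\<Prod>j<m. C j)"
    using C(1) by (intro prod_ennreal) (auto simp: less_imp_le)
  ultimately show ?thesis
    using C(1) by (intro exI[of _ "\<Prod>j<m. C j"]) (auto simp: ker_def intro!: prod_pos)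
qed

lemma right_integral:
  assumes t: "lo \<le> t" "t \<le> hi"
  defines "U \<equiv> (\<Union>s\<in>{t<..hi}. slice_idx s)"
  shows "\<exists>C>0. \<forall>x. (\<integral>\<^sup>+y. right_pot hi (override_on x y U) *
      (\<Prod>s\<in>{t..<hi}. slice_weight (s + 1) (override_on x y U) * of_bool (slice_link s (override_on x y U))) \<partial>lebPi U) =
    ennreal C * right_pot t x"
proof -
  define m where "m = nat (hi - t)"
  \<comment> \<open>Link s joins the slices s and s + 1. Moving left, slice s + 1 is the one
    integrated out, so its weight travels with link s.\<close>
  define ker where "ker s x = slice_weight (s + 1) x * of_bool (slice_link s x)" for s x
  have image: "{t<..hi} = (\<lambda>j. hi - int j) ` {..<m}"
  proof -
    have "s \<in> (\<lambda>j. hi - int j) ` {..<m}" if "s \<in> {t<..hi}" for s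
      using that by (intro image_eqI[of _ _ "nat (hi - s)"]) (auto simp: m_def)
    then show ?thesis using t by (auto simp: m_def)
  qed
  have image': "{t..<hi} = (\<lambda>j. hi - int j - 1) ` {..<m}"
  proof -
    have "s \<in> (\<lambda>j. hi - int j - 1) ` {..<m}" if "s \<in> {t..<hi}" for s
      using that by (intro image_eqI[of _ _ "nat (hi - s - 1)"]) (auto simp: m_def)
    then show ?thesis using t by (auto simp: m_def)
  qed
  have inj: "inj_on (\<lambda>j. hi - int j - 1) {..<m}" by (auto simp: inj_on_def)
  have "\<forall>j. \<exists>C. j < m \<longrightarrow> 0 < C \<and> (\<forall>x. (\<integral>\<^sup>+y. right_pot (hi - int j) y *
      ker (hi - int j - 1) (override_on x y (slice_idx (hi - int j))) \<partial>lebPi (slice_idx (hi - int j))) =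
      ennreal C * right_pot (hi - int (Suc j)) x)"
  proof
    fix j
    show "\<exists>C. j < m \<longrightarrow> 0 < C \<and> (\<forall>x. (\<integral>\<^sup>+y. right_pot (hi - int j) y *
      ker (hi - int j - 1) (override_on x y (slice_idx (hi - int j))) \<partial>lebPi (slice_idx (hi - int j))) =
      ennreal C * right_pot (hi - int (Suc j)) x)"
    proof (cases "j < m")
      case True
      then have "lo \<le> hi - int j - 1" "hi - int j - 1 < hi" using t by (auto simp: m_def)
      from right_step[OF this] show ?thesis unfolding ker_def by (simp add: algebra_simps)
    qed simp
  qed
  from choice[OF this] obtain C where C': "\<forall>j. j < m \<longrightarrow> 0 < C j \<and> (\<forall>x. (\<integral>\<^sup>+y. right_pot (hi - int j) y *
      ker (hi - int j - 1) (override_on x y (slice_idx (hi - int j))) \<partial>lebPi (slice_idx (hi - int j))) =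
      ennreal (C j) * right_pot (hi - int (Suc j)) x)"
    by (rule exE)
  then have C: "\<And>j. j < m \<Longrightarrow> 0 < C j" "\<And>j x. j < m \<Longrightarrow> (\<integral>\<^sup>+y. right_pot (hi - int j) y *
      ker (hi - int j - 1) (override_on x y (slice_idx (hi - int j))) \<partial>lebPi (slice_idx (hi - int j))) =
      ennreal (C j) * right_pot (hi - int (Suc j)) x" by simp_all
  have U: "U = (\<Union>j<m. slice_idx (hi - int j))"
    unfolding U_def image by simp
  have "(\<integral>\<^sup>+y. right_pot (hi - int 0) (override_on x y U) * (\<Prod>j<m. ker (hi - int j - 1) (override_on x y U)) \<partial>lebPi U) =
      (\<Prod>j<m. ennreal (C j)) * right_pot (hi - int m) x" for x
    unfolding U
  proof (rule nn_integral_chain[where F = "\<lambda>j. right_pot (hi - int j)" and ker = "\<lambda>j. ker (hi - int j - 1)"])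
    fix j assume "j < m"
    then have j: "lo \<le> hi - int j - 1" "hi - int j - 1 < hi" using t by (auto simp: m_def)
    have "local_on (slice_idx (hi - int j - 1) \<union> slice_idx (hi - int j - 1 + 1))
        (\<lambda>x. slice_weight (hi - int j - 1 + 1) x * of_bool (slice_link (hi - int j - 1) x))"
      by (intro local_on_times local_on_slice_link[OF j] local_on_mono[OF local_on_slice_weight]) auto
    then show "local_on (slice_idx (hi - int j) \<union> slice_idx (hi - int (Suc j))) (ker (hi - int j - 1))"
      unfolding ker_def[abs_def] by (simp add: algebra_simps Un_commute)
  qed (use C in \<open>auto simp: finite_slice_idx slice_idx_disjoint local_on_right_pot\<close>)
  moreover have "(\<Prod>s\<in>{t..<hi}. h s) = (\<Prod>j<m. h (hi - int j - 1))" for h :: "int \<Rightarrow> ennreal"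
    unfolding image' by (subst prod.reindex[OF inj]) simp
  moreover have "hi - int m = t" using t by (simp add: m_def)
  moreover have "(\<Prod>j<m. ennreal (C j)) = ennreal (\<Prod>j<m. C j)"
    using C(1) by (intro prod_ennreal) (auto simp: less_imp_le)
  ultimately show ?thesis
    using C(1) by (intro exI[of _ "\<Prod>j<m. C j"]) (auto simp: ker_def intro!: prod_pos)
qed

section \<open>The density of the whole array as a product along the chain of slices\<close>

lemma arr_idx_eq: "arr_idx M N = (\<Union>s\<in>{lo..hi}. slice_idx s)"
  by (auto simp: arr_idx_def slice_idx_iff)

lemma finite_arr_idx: "finite (arr_idx M N)"
  by (simp add: arr_idx_eq finite_slice_idx)

lemma slice_link_chamber:
  assumes "slice_link t x" "lo \<le> t" "t < hi"
  shows "chamber (L t) (\<lambda>i. x (t, Suc i)) \<and> chamber (L (t + 1)) (\<lambda>i. x (t + 1, Suc i))"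
proof (cases "t < 0")
  case True
  then show ?thesis
    using assms L_neg[of t] linked_chamber_lower[of "L (t + 1)" "L t"] linked_chamber_upper[of "L (t + 1)" "L t"]
    by (simp add: slice_link_def)
next
  case False
  then have "L (t + 1) \<le> L t" "L t \<le> Suc (L (t + 1))" by (auto simp: L_nonneg)
  then show ?thesis
    using assms False linked_chamber_lower[of "L t" "L (t + 1)"] linked_chamber_upper[of "L t" "L (t + 1)"]
    by (simp add: slice_link_def)
qed

text \<open>The form in which the constraints factorise: the chamber conditions on the two end
  slices are the values of \<open>left_pot\<close> and \<open>right_pot\<close> there, and each link
  involves two neighbouring slices only.\<close>

lemma limit_array_ok_iff:
  "limit_array_ok M N x \<longleftrightarrow> chamber (L lo) (\<lambda>i. x (lo, Suc i)) \<and> chamber (L hi) (\<lambda>i. x (hi, Suc i)) \<and>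
    (\<forall>t\<in>{lo..<hi}. slice_link t x)" (is "?l \<longleftrightarrow> ?r")
proof
  assume ok: ?l
  have unit: "unit_entries (L t) (\<lambda>i. x (t, Suc i))" if "lo \<le> t" "t \<le> hi" for t
    using ok that by (auto simp: limit_array_ok_def unit_entries_def arr_idx_def)
  have ch: "chamber (L t) (\<lambda>i. x (t, Suc i))" if "lo \<le> t" "t \<le> hi" for t
    using ok that unit[OF that] unfolding chamber_def unit_entries_def limit_array_ok_def by simp
  have "slice_link t x" if t: "lo \<le> t" "t < hi" for t
  proof (cases "t < 0")
    case True
    have "x (t + 1, Suc i) < x (t, Suc i) \<and> x (t, Suc i) < x (t + 1, Suc (Suc i))" if "i < L t" for i
      using ok that True t unfolding limit_array_ok_def by simp
    then show ?thesis
      using True unit[of t] unit[of "t + 1"] t by (simp add: slice_link_def linked_def interlaced_def)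
  next
    case False
    have "x (t, Suc i) < x (t + 1, Suc i) \<and> x (t + 1, Suc i) < xext M N x t (Suc i + 1)" if "i < L (t + 1)" for i
      using ok that False t unfolding limit_array_ok_def by simp
    then have "x (t, Suc i) < x (t + 1, Suc i) \<and> (Suc i < L t \<longrightarrow> x (t + 1, Suc i) < x (t, Suc (Suc i)))"
      if "i < L (t + 1)" for i
      using that by (fastforce simp: xext_def)
    then show ?thesis
      using False unit[of t] unit[of "t + 1"] t by (simp add: slice_link_def linked_def interlaced_def)
  qed
  then show ?r using ch[of lo] ch[of hi] M1 MN by auto
next
  assume r: ?r
  have ch: "chamber (L t) (\<lambda>i. x (t, Suc i))" if "lo \<le> t" "t \<le> hi" for t
    using slice_link_chamber[of t x] r that by (cases "t = hi") auto
  have unit: "0 < x (t, i) \<and> x (t, i) < 1" if "lo \<le> t" "t \<le> hi" "1 \<le> i" "i \<le> L t" for t i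
    using chamberD(1)[OF ch[of t], of "i - 1"] chamberD(2)[OF ch[of t], of "i - 1"] that by simp
  have link: "slice_link t x" if "lo \<le> t" "t < hi" for t using r that by auto
  show ?l
    unfolding limit_array_ok_def
  proof (intro conjI allI impI)
    show "\<forall>p\<in>arr_idx M N. 0 < x p \<and> x p < 1" using unit by (auto simp: arr_idx_def)
  next
    fix t i j assume "lo \<le> t \<and> t \<le> hi \<and> 1 \<le> i \<and> i < j \<and> j \<le> L t"
    then have "lo \<le> t" "t \<le> hi" "i - 1 < j - 1" "j - 1 < L t" "Suc (i - 1) = i" "Suc (j - 1) = j" by auto
    then show "x (t, i) < x (t, j)"
      using chamberD(3)[OF ch[of t], of "i - 1" "j - 1"] by simp
  next
    fix t i assume a: "lo \<le> t \<and> t \<le> - 1 \<and> 1 \<le> i \<and> i \<le> L t"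
    then have "slice_link t x" using M1 MN by (intro link) auto
    then have "linked (L (t + 1)) (L t) (\<lambda>i. x (t + 1, Suc i)) (\<lambda>i. x (t, Suc i))"
      using a by (simp add: slice_link_def)
    then show "x (t + 1, i) < x (t, i)" "x (t, i) < x (t + 1, i + 1)"
      using a L_neg[of t] by (auto simp: linked_def interlaced_def dest: spec[of _ "i - 1"])
  next
    fix t i assume a: "0 \<le> t \<and> t \<le> int N - 2 \<and> 1 \<le> i \<and> i \<le> L (t + 1)"
    then have "slice_link t x" using M1 MN by (intro link) auto
    then have l: "linked (L t) (L (t + 1)) (\<lambda>i. x (t, Suc i)) (\<lambda>i. x (t + 1, Suc i))"
      using a by (simp add: slice_link_def)
    then show "x (t, i) < x (t + 1, i)"
      using a by (auto simp: linked_def interlaced_def dest: spec[of _ "i - 1"])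
    \<comment> \<open>The conventional neighbour 1 occurs for i = \<open>L t\<close>, where the
      claim reduces to the bound x < 1.\<close>
    have "L (t + 1) \<le> L t" using a by (simp add: L_nonneg)
    then show "x (t + 1, i) < xext M N x t (i + 1)"
      using a l unit[of "t + 1" i] M1 MN
      by (auto simp: xext_def linked_def interlaced_def dest: spec[of _ "i - 1"])
  qed
qed

definition array_weight :: "(int \<times> nat \<Rightarrow> real) \<Rightarrow> real" where
  "array_weight x = (\<Prod>p\<in>arr_idx M N. x p powr (expo (fst p) - 1))"

lemma array_weight_eq: "ennreal (array_weight x) = (\<Prod>s\<in>{lo..hi}. slice_weight s x)"
proof -
  have "array_weight x = (\<Prod>s\<in>{lo..hi}. \<Prod>p\<in>slice_idx s. x p powr (expo (fst p) - 1))"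
    unfolding array_weight_def arr_idx_eq
    by (rule prod.UNION_disjoint) (auto simp: finite_slice_idx slice_idx_disjoint)
  also have "\<dots> = (\<Prod>s\<in>{lo..hi}. \<Prod>i<L s. x (s, Suc i) powr (expo s - 1))"
    unfolding slice_idx_def by (intro prod.cong refl) (subst prod.reindex, auto simp: inj_on_def)
  finally show ?thesis
    unfolding slice_weight_def by (simp add: prod_ennreal prod_nonneg)
qed

lemma right_weight_hi: "right_weight hi = (\<lambda>_. 1)"
  using M1 MN by (auto simp: right_weight_def fun_eq_iff nat_diff_distrib)

text \<open>The weight of a slice other than t is attached to the link on the side facing t, so
  every slice is counted once and the two brackets are the integrands of
  \<open>left_integral\<close> and \<open>right_integral\<close>.\<close>

lemma array_density_eq:
  assumes t: "lo \<le> t" "t \<le> hi"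
  shows "of_bool (limit_array_ok M N x) * ennreal (array_weight x) =
    slice_weight t x *
      (left_pot lo x * (\<Prod>s\<in>{lo..<t}. slice_weight s x * of_bool (slice_link s x))) *
      (right_pot hi x * (\<Prod>s\<in>{t..<hi}. slice_weight (s + 1) x * of_bool (slice_link s x)))"
proof -
  have 1: "left_pot lo x = of_bool (chamber (L lo) (\<lambda>i. x (lo, Suc i)))"
    unfolding left_pot_def slice_potential_def L_lo left_weight_def vandermonde_def using M1 by simp
  have 2: "right_pot hi x = of_bool (chamber (L hi) (\<lambda>i. x (hi, Suc i)))"
    unfolding right_pot_def slice_potential_def L_hi right_weight_hi vandermonde_def by simp
  have "(\<Prod>s\<in>{t..<hi}. slice_weight (s + 1) x) = (\<Prod>s\<in>{t<..hi}. slice_weight s x)"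
    by (rule prod.reindex_bij_witness[where i = "\<lambda>s. s - 1" and j = "\<lambda>s. s + 1"]) auto
  moreover have "{lo..hi} = insert t ({lo..<t} \<union> {t<..hi})" using t by auto
  moreover have "(\<Prod>s\<in>{lo..<t} \<union> {t<..hi}. slice_weight s x) =
      (\<Prod>s\<in>{lo..<t}. slice_weight s x) * (\<Prod>s\<in>{t<..hi}. slice_weight s x)"
    by (rule prod.union_disjoint) auto
  ultimately have w: "(\<Prod>s\<in>{lo..hi}. slice_weight s x) =
      slice_weight t x * (\<Prod>s\<in>{lo..<t}. slice_weight s x) * (\<Prod>s\<in>{t..<hi}. slice_weight (s + 1) x)"
    by (simp add: mult_ac)
  have "{lo..<hi} = {lo..<t} \<union> {t..<hi}" using t by auto
  then have b: "of_bool (\<forall>s\<in>{lo..<hi}. slice_link s x) =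
      (\<Prod>s\<in>{lo..<t}. of_bool (slice_link s x)) * (\<Prod>s\<in>{t..<hi}. of_bool (slice_link s x) :: ennreal)"
    by (auto simp: prod_zero_iff)
  have "of_bool (limit_array_ok M N x) = left_pot lo x * right_pot hi x * of_bool (\<forall>s\<in>{lo..<hi}. slice_link s x)"
    unfolding 1 2 limit_array_ok_iff by simp
  then show ?thesis
    unfolding array_weight_eq w b prod.distrib by (simp add: mult_ac)
qed

text \<open>With slice t held fixed, the left part integrates to a Vandermonde product in x^\<eta>
  and the right part to one in x^\<theta>; their product is the interaction term of the density. The
  constant does not depend on g.\<close>

lemma marginal:
  assumes t: "lo \<le> t" "t \<le> hi"
  obtains C where "0 < C" "\<And>g. local_on (slice_idx t) g \<Longrightarrow>
    (\<integral>\<^sup>+x. of_bool (limit_array_ok M N x) * ennreal (array_weight x) * g x \<partial>lebPi (arr_idx M N)) =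
    ennreal C * (\<integral>\<^sup>+y. g y * (slice_weight t y * left_pot t y * right_pot t y) \<partial>lebPi (slice_idx t))"
proof -
  define UL where "UL = (\<Union>s\<in>{lo..<t}. slice_idx s)"
  define UR where "UR = (\<Union>s\<in>{t<..hi}. slice_idx s)"
  define FL where "FL x = left_pot lo x * (\<Prod>s\<in>{lo..<t}. slice_weight s x * of_bool (slice_link s x))" for x
  define FR where "FR x = right_pot hi x * (\<Prod>s\<in>{t..<hi}. slice_weight (s + 1) x * of_bool (slice_link s x))" for x
  obtain CL where CL: "0 < CL" "\<And>x. (\<integral>\<^sup>+y. FL (override_on x y UL) \<partial>lebPi UL) = ennreal CL * left_pot t x"
    using left_integral[OF t] unfolding FL_def UL_def by blast
  obtain CR where CR: "0 < CR" "\<And>x. (\<integral>\<^sup>+y. FR (override_on x y UR) \<partial>lebPi UR) = ennreal CR * right_pot t x"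
    using right_integral[OF t] unfolding FR_def UR_def by blast
  have idx: "arr_idx M N = slice_idx t \<union> (UL \<union> UR)"
  proof -
    have "{lo..hi} = insert t ({lo..<t} \<union> {t<..hi})" using t by auto
    then show ?thesis unfolding arr_idx_eq UL_def UR_def by auto
  qed
  have lkL: "slice_idx s \<union> slice_idx (s + 1) \<subseteq> slice_idx t \<union> UL" if "s \<in> {lo..<t}" for s
  proof -
    have "s + 1 = t \<or> s + 1 \<in> {lo..<t}" using that by auto
    then show ?thesis using that unfolding UL_def by blast
  qed
  have lkR: "slice_idx s \<union> slice_idx (s + 1) \<subseteq> slice_idx t \<union> UR" if "s \<in> {t..<hi}" for s
  proof -
    have "s = t \<or> s \<in> {t<..hi}" "s + 1 \<in> {t<..hi}" using that by auto
    then show ?thesis unfolding UR_def by blast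
  qed
  have loL: "slice_idx lo \<subseteq> slice_idx t \<union> UL"
    using t by (cases "lo = t") (auto simp: UL_def)
  have hiR: "slice_idx hi \<subseteq> slice_idx t \<union> UR"
    using t by (cases "hi = t") (auto simp: UR_def)
  have FL: "local_on (slice_idx t \<union> UL) FL"
    unfolding FL_def[abs_def]
    by (intro local_on_times local_on_prod local_on_mono[OF local_on_left_pot loL]
        local_on_mono[OF local_on_slice_weight] local_on_mono[OF local_on_slice_link lkL]) (use lkL t in auto)
  have FR: "local_on (slice_idx t \<union> UR) FR"
    unfolding FR_def[abs_def]
    by (intro local_on_times local_on_prod local_on_mono[OF local_on_right_pot hiR]
        local_on_mono[OF local_on_slice_weight] local_on_mono[OF local_on_slice_link lkR]) (use lkR t in auto)
  show thesis
  proof (rule that[of "CL * CR"])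
    show "0 < CL * CR" using CL CR by simp
    fix g :: "(int \<times> nat \<Rightarrow> real) \<Rightarrow> ennreal" assume g: "local_on (slice_idx t) g"
    have gw: "local_on (slice_idx t) (\<lambda>x. g x * slice_weight t x)"
      by (intro local_on_times g local_on_slice_weight)
    have "(\<integral>\<^sup>+x. of_bool (limit_array_ok M N x) * ennreal (array_weight x) * g x \<partial>lebPi (arr_idx M N)) =
      (\<integral>\<^sup>+x. (g x * slice_weight t x) * FL x * FR x \<partial>lebPi (slice_idx t \<union> (UL \<union> UR)))"
      unfolding idx array_density_eq[OF t] FL_def FR_def by (simp add: mult_ac)
    also have "\<dots> = (\<integral>\<^sup>+y. (g y * slice_weight t y) * (\<integral>\<^sup>+u. FL (override_on y u UL) \<partial>lebPi UL) *
        (\<integral>\<^sup>+v. FR (override_on y v UR) \<partial>lebPi UR) \<partial>lebPi (slice_idx t))"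
    proof (rule nn_integral_two_sided[OF _ _ _ _ _ _ gw FL FR])
      show "slice_idx t \<inter> UL = {}" "slice_idx t \<inter> UR = {}" "UL \<inter> UR = {}"
        by (auto simp: UL_def UR_def slice_idx_iff)
    qed (auto simp: UL_def UR_def finite_slice_idx)
    also have "\<dots> = (\<integral>\<^sup>+y. ennreal (CL * CR) * (g y * (slice_weight t y * left_pot t y * right_pot t y)) \<partial>lebPi (slice_idx t))"
      unfolding CL(2) CR(2) using CL(1) CR(1) by (simp add: ennreal_mult mult_ac)
    also have "\<dots> = ennreal (CL * CR) * (\<integral>\<^sup>+y. g y * (slice_weight t y * left_pot t y * right_pot t y) \<partial>lebPi (slice_idx t))"
      by (intro nn_integral_cmult local_on_measurable[OF _ order_refl] local_on_times g
          local_on_slice_weight local_on_left_pot local_on_right_pot)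
    finally show "(\<integral>\<^sup>+x. of_bool (limit_array_ok M N x) * ennreal (array_weight x) * g x \<partial>lebPi (arr_idx M N)) =
      ennreal (CL * CR) * (\<integral>\<^sup>+y. g y * (slice_weight t y * left_pot t y * right_pot t y) \<partial>lebPi (slice_idx t))" .
  qed
qed

end

section \<open>Products of power laws\<close>

text \<open>The topology on functions is the product topology; continuity of the test functions
  refers to it.\<close>

lemma tendsto_fun_componentwise:
  fixes f :: "'a \<Rightarrow> 'b \<Rightarrow> 'c :: topological_space"
  assumes "\<And>p. ((\<lambda>n. f n p) \<longlongrightarrow> l p) F"
  shows "(f \<longlongrightarrow> l) F"
proof -
  have "limitin (product_topology (\<lambda>_. euclidean) UNIV) f l F"
    using assms by (simp add: limitin_componentwise)
  then show ?thesis by (simp add: euclidean_product_topology)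
qed

lemma PiM_density_lborel:
  fixes f :: "'i \<Rightarrow> real \<Rightarrow> ennreal"
  assumes I: "finite I" and f[measurable]: "\<And>i. f i \<in> borel_measurable borel"
    and sf: "\<And>i. sigma_finite_measure (density lborel (f i))"
  shows "PiM I (\<lambda>i. density lborel (f i)) = density (lebPi I) (\<lambda>x. \<Prod>i\<in>I. f i (x i))"
proof -
  interpret leb: product_sigma_finite "\<lambda>_::'i. lborel :: real measure" by (rule product_sigma_finite_lborel)
  interpret product_sigma_finite "\<lambda>i. density lborel (f i)"
    using sf by (simp add: product_sigma_finite_def)
  have comp: "(\<lambda>x. f i (x i)) \<in> borel_measurable (lebPi I)" if "i \<in> I" for i
    using that by measurable
  show ?thesis
  proof (rule PiM_eqI[OF I, symmetric])
    show "sets (density (lebPi I) (\<lambda>x. \<Prod>i\<in>I. f i (x i))) = sets (PiM I (\<lambda>i. density lborel (f i)))"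
      by (auto intro!: sets_PiM_cong)
    fix A assume "\<And>i. i \<in> I \<Longrightarrow> A i \<in> sets (density lborel (f i))"
    then have A: "A i \<in> sets lborel" if "i \<in> I" for i using that by simp
    have "emeasure (density (lebPi I) (\<lambda>x. \<Prod>i\<in>I. f i (x i))) (Pi\<^sub>E I A) =
        (\<integral>\<^sup>+x. (\<Prod>i\<in>I. f i (x i)) * indicator (Pi\<^sub>E I A) x \<partial>lebPi I)"
      using A I by (intro emeasure_density borel_measurable_prod_ennreal comp sets_PiM_I_finite) auto
    also have "\<dots> = (\<integral>\<^sup>+x. (\<Prod>i\<in>I. f i (x i) * indicator (A i) (x i)) \<partial>lebPi I)"
    proof (rule nn_integral_cong)
      fix x assume "x \<in> space (lebPi I)"
      then have "x \<in> Pi\<^sub>E I A \<longleftrightarrow> (\<forall>i\<in>I. x i \<in> A i)"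
        by (auto simp: space_PiM PiE_iff)
      then have "(indicator (Pi\<^sub>E I A) x :: ennreal) = (\<Prod>i\<in>I. indicator (A i) (x i))"
        using I by (auto simp: indicator_def prod_zero_iff)
      then show "(\<Prod>i\<in>I. f i (x i)) * indicator (Pi\<^sub>E I A) x = (\<Prod>i\<in>I. f i (x i) * indicator (A i) (x i))"
        by (simp add: prod.distrib)
    qed
    also have "\<dots> = (\<Prod>i\<in>I. \<integral>\<^sup>+u. f i u * indicator (A i) u \<partial>lborel)"
      using A by (intro leb.product_nn_integral_prod I) auto
    also have "\<dots> = (\<Prod>i\<in>I. emeasure (density lborel (f i)) (A i))"
      using A by (intro prod.cong refl) (auto simp: emeasure_density)
    finally show "emeasure (density (lebPi I) (\<lambda>x. \<Prod>i\<in>I. f i (x i))) (Pi\<^sub>E I A) =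
      (\<Prod>i\<in>I. emeasure (density lborel (f i)) (A i))" .
  qed
qed

text \<open>The Beta(c, 1) law, with distribution function u^c on the unit interval.\<close>

definition power_law :: "real \<Rightarrow> real measure" where
  "power_law c = density lborel (\<lambda>u. ennreal (c * u powr (c - 1)) * indicator {0<..<1} u)"

lemma sets_power_law[measurable_cong]: "sets (power_law c) = sets borel"
  by (simp add: power_law_def)

lemma space_power_law: "space (power_law c) = UNIV"
  by (simp add: power_law_def)

lemma emeasure_power_law_Ioo:
  assumes c: "0 < c" and ab: "0 \<le> a" "a \<le> b" "b \<le> 1"
  shows "emeasure (power_law c) {a<..<b} = ennreal (b powr c - a powr c)"
proof (cases "a = b")
  case False
  have int: "set_integrable lborel {a<..<b} (\<lambda>u. c * u powr (c - 1))"
    using set_integrable_powr[OF c ab(1,3)] by simp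
  have "(LINT u:{a<..<b}|lborel. c * u powr (c - 1)) = b powr c - a powr c"
  proof (rule set_integral_FTC_Ioo[OF _ int])
    show "continuous_on {a..b} (\<lambda>x. x powr c)"
      using ab c by (intro continuous_on_powr' continuous_intros) auto
    show "((\<lambda>x. x powr c) has_field_derivative c * x powr (c - 1)) (at x)" if "a < x" for x
      using that ab by (auto intro!: derivative_eq_intros)
  qed (use False ab in auto)
  moreover have "emeasure (power_law c) {a<..<b} = (\<integral>\<^sup>+u. ennreal (indicator {a<..<b} u * (c * u powr (c - 1))) \<partial>lborel)"
    unfolding power_law_def
    by (subst emeasure_density) (use ab c in \<open>auto intro!: nn_integral_cong simp: indicator_def\<close>)
  moreover have "\<dots> = ennreal (LINT u:{a<..<b}|lborel. c * u powr (c - 1))"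
    unfolding set_lebesgue_integral_def using int c
    by (subst nn_integral_eq_integral) (auto simp: set_integrable_def)
  ultimately show ?thesis by simp
qed simp

lemma prob_space_power_law: "0 < c \<Longrightarrow> prob_space (power_law c)"
proof
  assume c: "0 < c"
  have "emeasure (power_law c) UNIV = emeasure (power_law c) {0<..<1}"
    unfolding power_law_def by (subst (1 2) emeasure_density) (auto intro!: nn_integral_cong simp: indicator_def)
  then show "emeasure (power_law c) (space (power_law c)) = 1"
    using emeasure_power_law_Ioo[OF c, of 0 1] c by (simp add: space_power_law)
qed

lemma AE_power_law_unit: "AE u in power_law c. 0 < u \<and> u < 1"
  unfolding power_law_def by (subst AE_density) (auto simp: indicator_def)

lemma emeasure_power_law_singleton: "emeasure (power_law c) {u} = 0"
proof -
  have "AE x in lborel. x \<noteq> u" by (rule AE_lborel_singleton)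
  then have "AE x in power_law c. x \<noteq> u"
    unfolding power_law_def by (subst AE_density) auto
  then show ?thesis
    by (subst (asm) AE_iff_measurable[OF _ refl]) (auto simp: space_power_law sets_power_law)
qed

text \<open>The coordinate p is integrated first: for fixed other coordinates a tie confines it to
  the single point \<open>x q\<close>, a null set.\<close>

lemma AE_PiM_distinct:
  fixes M :: "'i \<Rightarrow> real measure"
  assumes I: "finite I" and ps: "\<And>i. prob_space (M i)" and sets: "\<And>i. sets (M i) = sets borel"
    and null: "\<And>i u. emeasure (M i) {u} = 0" and pq: "p \<in> I" "q \<in> I" "p \<noteq> q"
  shows "AE x in PiM I M. x p \<noteq> x q"
proof -
  interpret product_sigma_finite M
    using ps by (simp add: product_sigma_finite_def prob_space_imp_sigma_finite)
  note sets[measurable_cong]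
  define J where "J = I - {p}"
  have J: "I = insert p J" "p \<notin> J" "finite J" "q \<in> J" using I pq by (auto simp: J_def)
  have [measurable]: "(\<lambda>x. x p) \<in> borel_measurable (PiM I M)" "(\<lambda>x. x q) \<in> borel_measurable (PiM I M)"
    using pq by measurable
  have meas: "{x \<in> space (PiM I M). x p = x q} \<in> sets (PiM I M)"
    by measurable
  have "emeasure (PiM I M) {x \<in> space (PiM I M). x p = x q} =
      (\<integral>\<^sup>+x. indicator {x \<in> space (PiM I M). x p = x q} x \<partial>PiM (insert p J) M)"
    using meas by (simp add: J(1))
  also have "\<dots> = (\<integral>\<^sup>+x. (\<integral>\<^sup>+u. indicator {x \<in> space (PiM I M). x p = x q} (x(p := u)) \<partial>M p) \<partial>PiM J M)"
    using meas J by (intro product_nn_integral_insert) auto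
  also have "\<dots> \<le> (\<integral>\<^sup>+x. (\<integral>\<^sup>+u. indicator {x q} u \<partial>M p) \<partial>PiM J M)"
    using pq by (intro nn_integral_mono) (auto simp: indicator_def)
  also have "\<dots> = 0"
    using null sets by simp
  finally show ?thesis
    using meas by (subst AE_iff_measurable[OF _ refl]) auto
qed

context plane_partition_limit
begin

definition \<nu> :: "(int \<times> nat \<Rightarrow> real) measure" where
  "\<nu> = PiM (arr_idx M N) (\<lambda>p. power_law (expo (fst p)))"

definition ok_set :: "(int \<times> nat \<Rightarrow> real) set" where
  "ok_set = {x \<in> space \<nu>. limit_array_ok M N x}"

lemma prob_space_\<nu>: "prob_space \<nu>"
  unfolding \<nu>_def by (intro prob_space_PiM prob_space_power_law expo_pos)

lemma sets_\<nu>[measurable_cong]: "sets \<nu> = sets (lebPi (arr_idx M N))"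
  unfolding \<nu>_def by (intro sets_PiM_cong) (auto simp: sets_power_law)

lemma space_\<nu>: "space \<nu> = Pi\<^sub>E (arr_idx M N) (\<lambda>_. UNIV)"
  by (simp add: \<nu>_def space_PiM space_power_law)

lemma local_on_limit_array_ok: "local_on (arr_idx M N) (\<lambda>x. of_bool (limit_array_ok M N x))"
proof -
  have "(\<lambda>x. of_bool (limit_array_ok M N x)) =
      (\<lambda>x. left_pot lo x * right_pot hi x * (\<Prod>s\<in>{lo..<hi}. of_bool (slice_link s x)))"
  proof
    fix x
    have "left_pot lo x = of_bool (chamber (L lo) (\<lambda>i. x (lo, Suc i)))"
      unfolding left_pot_def slice_potential_def L_lo left_weight_def vandermonde_def using M1 by simp
    moreover have "right_pot hi x = of_bool (chamber (L hi) (\<lambda>i. x (hi, Suc i)))"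
      unfolding right_pot_def slice_potential_def L_hi right_weight_hi vandermonde_def by simp
    moreover have "(\<Prod>s\<in>{lo..<hi}. of_bool (slice_link s x) :: ennreal) = of_bool (\<forall>s\<in>{lo..<hi}. slice_link s x)"
      by (auto simp: prod_zero_iff)
    ultimately show "of_bool (limit_array_ok M N x) =
        left_pot lo x * right_pot hi x * (\<Prod>s\<in>{lo..<hi}. of_bool (slice_link s x))"
      unfolding limit_array_ok_iff by simp
  qed
  then show ?thesis
    using M1 MN
    by (auto intro!: local_on_times local_on_prod local_on_mono[OF local_on_left_pot]
        local_on_mono[OF local_on_right_pot] local_on_mono[OF local_on_slice_link]
        simp: arr_idx_def slice_idx_iff)
qed

lemma ok_set_measurable: "ok_set \<in> sets \<nu>"
proof -
  have m[measurable]: "(\<lambda>x. of_bool (limit_array_ok M N x) :: ennreal) \<in> borel_measurable \<nu>"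
    using local_on_measurable[OF local_on_limit_array_ok, of "arr_idx M N"]
    by (simp add: measurable_cong_sets[OF sets_\<nu> refl])
  have "{x \<in> space \<nu>. of_bool (limit_array_ok M N x) = (1::ennreal)} \<in> sets \<nu>" by measurable
  then show ?thesis by (simp add: ok_set_def)
qed

lemma AE_\<nu>_unit: "AE x in \<nu>. \<forall>p\<in>arr_idx M N. 0 < x p \<and> x p < 1"
  unfolding \<nu>_def
  by (intro AE_finite_allI finite_arr_idx AE_PiM_component[where P = "\<lambda>u. 0 < u \<and> u < 1"]
      prob_space_power_law expo_pos AE_power_law_unit)

lemma AE_\<nu>_distinct: "AE x in \<nu>. \<forall>p\<in>arr_idx M N. \<forall>q\<in>arr_idx M N. p \<noteq> q \<longrightarrow> x p \<noteq> x q"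
proof -
  have "AE x in \<nu>. p \<noteq> q \<longrightarrow> x p \<noteq> x q" if "p \<in> arr_idx M N" "q \<in> arr_idx M N" for p q
    unfolding \<nu>_def using that
    by (cases "p = q") (auto intro!: AE_PiM_distinct finite_arr_idx prob_space_power_law expo_pos
        sets_power_law emeasure_power_law_singleton)
  then show ?thesis
    by (intro AE_finite_allI finite_arr_idx)
qed

end

section \<open>Discretization\<close>

text \<open>The diagonal coordinates \<open>(t, k)\<close> of the cell in row \<open>i\<close> and column \<open>j\<close>.\<close>

definition diag :: "nat \<Rightarrow> nat \<Rightarrow> int \<times> nat" where
  "diag i j = (int j - int i, min i j)"

lemma slice_diag: "slice \<Lambda> (fst (diag i j)) (snd (diag i j)) = \<Lambda> i j"
  by (auto simp: slice_def diag_def nat_diff_distrib min_def)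

definition discretize :: "real \<Rightarrow> real \<Rightarrow> nat" where
  "discretize \<epsilon> u = nat \<lfloor>- ln u / \<epsilon>\<rfloor>"

lemma discretize_antimono:
  assumes "0 < \<epsilon>" "0 < u" "u \<le> v"
  shows "discretize \<epsilon> v \<le> discretize \<epsilon> u"
  unfolding discretize_def using assms
  by (intro nat_mono floor_mono divide_right_mono) auto

text \<open>A gap of at least \<epsilon> between the logarithms is a gap of at least 1 before taking
  floors. The condition v < 1 keeps the floors nonnegative, so that \<open>nat\<close> does not
  merge them.\<close>

lemma discretize_strict:
  assumes "0 < \<epsilon>" "0 < u" "v < 1" "u < v" "\<epsilon> \<le> ln v - ln u"
  shows "discretize \<epsilon> v < discretize \<epsilon> u"
proof -
  have "- ln v / \<epsilon> + 1 \<le> - ln u / \<epsilon>"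
    using divide_right_mono[OF assms(5), of \<epsilon>] assms(1) by (simp add: diff_divide_distrib)
  then have "\<lfloor>- ln v / \<epsilon>\<rfloor> + 1 \<le> \<lfloor>- ln u / \<epsilon>\<rfloor>"
    by (metis floor_mono floor_add_int of_int_1)
  moreover have "0 \<le> \<lfloor>- ln v / \<epsilon>\<rfloor>"
    using assms by (simp add: divide_nonpos_pos)
  moreover have "nat a < nat b" if "a + 1 \<le> b" "0 \<le> a" for a b using that by simp
  ultimately show ?thesis unfolding discretize_def by blast
qed

lemma discretize_bounds:
  assumes "0 < \<epsilon>" "0 < u" "u \<le> 1"
  shows "u \<le> exp (- \<epsilon>) ^ discretize \<epsilon> u" "exp (- \<epsilon>) ^ discretize \<epsilon> u \<le> u * exp \<epsilon>"
proof -
  have nn: "0 \<le> - ln u / \<epsilon>" using assms by (simp add: divide_nonpos_pos)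
  then have d: "real (discretize \<epsilon> u) = of_int \<lfloor>- ln u / \<epsilon>\<rfloor>" by (simp add: discretize_def)
  have "real (discretize \<epsilon> u) \<le> - ln u / \<epsilon>" unfolding d by simp
  then have 1: "ln u \<le> - \<epsilon> * real (discretize \<epsilon> u)" using assms by (simp add: field_simps)
  have "- ln u / \<epsilon> - 1 \<le> real (discretize \<epsilon> u)" unfolding d by linarith
  then have 2: "- \<epsilon> * real (discretize \<epsilon> u) \<le> ln u + \<epsilon>" using assms by (simp add: field_simps)
  have eq: "exp (- \<epsilon>) ^ discretize \<epsilon> u = exp (- \<epsilon> * real (discretize \<epsilon> u))"
    by (simp add: exp_of_nat_mult[symmetric] mult.commute)
  show "u \<le> exp (- \<epsilon>) ^ discretize \<epsilon> u"
    unfolding eq using 1 assms by (metis exp_le_cancel_iff exp_ln)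
  have "exp (- \<epsilon> * real (discretize \<epsilon> u)) \<le> exp (ln u + \<epsilon>)" using 2 by simp
  then show "exp (- \<epsilon>) ^ discretize \<epsilon> u \<le> u * exp \<epsilon>"
    unfolding eq using assms by (simp add: exp_add)
qed

lemma tendsto_discretize:
  assumes "S \<longlonglongrightarrow> 0" "\<And>n. 0 < S n" "0 < u" "u \<le> 1"
  shows "(\<lambda>n. exp (- S n) ^ discretize (S n) u) \<longlonglongrightarrow> u"
proof (rule tendsto_sandwich)
  show "\<forall>\<^sub>F n in sequentially. u \<le> exp (- S n) ^ discretize (S n) u"
    "\<forall>\<^sub>F n in sequentially. exp (- S n) ^ discretize (S n) u \<le> u * exp (S n)"
    using discretize_bounds assms by (auto intro!: always_eventually)
  have "(\<lambda>n. u * exp (S n)) \<longlonglongrightarrow> u * exp 0"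
    by (intro tendsto_intros assms)
  then show "(\<lambda>n. u * exp (S n)) \<longlonglongrightarrow> u" by simp
qed simp

lemma measurable_discretize[measurable]: "discretize \<epsilon> \<in> measurable borel (count_space UNIV)"
  unfolding discretize_def by measurable

text \<open>Under the power law the discretized variable is exactly geometric.\<close>

lemma emeasure_power_law_discretize:
  assumes c: "0 < c" and \<epsilon>: "0 < \<epsilon>"
  shows "emeasure (power_law c) {u. discretize \<epsilon> u = n} =
    ennreal ((1 - exp (- \<epsilon> * c)) * exp (- \<epsilon> * c * real n))"
proof -
  define a where "a = exp (- \<epsilon> * real (Suc n))"
  define b where "b = exp (- \<epsilon> * real n)"
  have ab: "0 < a" "a < b" "b \<le> 1" using \<epsilon> by (auto simp: a_def b_def)
  \<comment> \<open>Within the unit interval the level set is the half-open interval from a to b;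
    its closed end b is a null set.\<close>
  have "emeasure (power_law c) {u. discretize \<epsilon> u = n} = emeasure (power_law c) {a<..<b}"
  proof (rule emeasure_eq_AE)
    have "AE u in power_law c. u \<noteq> b"
      by (subst AE_iff_measurable[OF _ refl])
        (auto simp: space_power_law sets_power_law emeasure_power_law_singleton)
    then show "AE u in power_law c. (u \<in> {u. discretize \<epsilon> u = n}) = (u \<in> {a<..<b})"
      using AE_power_law_unit[of c]
    proof eventually_elim
      case (elim u)
      then have nn: "0 \<le> - ln u / \<epsilon>" using \<epsilon> by (simp add: divide_nonpos_pos)
      then have "discretize \<epsilon> u = n \<longleftrightarrow> \<lfloor>- ln u / \<epsilon>\<rfloor> = int n"
        by (auto simp: discretize_def)
      also have "\<dots> \<longleftrightarrow> real n \<le> - ln u / \<epsilon> \<and> - ln u / \<epsilon> < real n + 1"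
        by (simp add: floor_eq_iff)
      also have "\<dots> \<longleftrightarrow> ln u \<le> - \<epsilon> * real n \<and> - \<epsilon> * real (Suc n) < ln u"
        using \<epsilon> by (auto simp: field_simps)
      also have "\<dots> \<longleftrightarrow> u \<le> b \<and> a < u"
        unfolding a_def b_def using elim(2) ln_ge_iff[of u] by (metis exp_less_cancel_iff exp_le_cancel_iff exp_ln)
      finally show ?case using elim(1) by auto
    qed
    have "{u. discretize \<epsilon> u = n} = discretize \<epsilon> -` {n} \<inter> space borel" by auto
    also have "\<dots> \<in> sets borel" by measurable
    finally show "{u. discretize \<epsilon> u = n} \<in> sets (power_law c)" by (simp add: sets_power_law)
  qed (simp add: sets_power_law)
  also have "\<dots> = ennreal (b powr c - a powr c)"
    using ab c by (intro emeasure_power_law_Ioo) auto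
  also have "b powr c - a powr c = (1 - exp (- \<epsilon> * c)) * exp (- \<epsilon> * c * real n)"
    unfolding a_def b_def powr_def by (simp add: algebra_simps exp_add[symmetric] exp_diff[symmetric])
  finally show ?thesis .
qed

context plane_partition_limit
begin

section \<open>Rows and columns of the array versus its diagonal slices\<close>

lemma diag_in_arr_idx: "1 \<le> i \<Longrightarrow> i \<le> M \<Longrightarrow> 1 \<le> j \<Longrightarrow> j \<le> N \<Longrightarrow> diag i j \<in> arr_idx M N"
  by (auto simp: arr_idx_def diag_def Lt_def)

lemma arr_idx_diag:
  assumes "p \<in> arr_idx M N"
  obtains i j where "1 \<le> i" "i \<le> M" "1 \<le> j" "j \<le> N" "p = diag i j"
proof -
  obtain t k where p: "p = (t, k)" by (cases p)
  show thesis
  proof (rule that[of "k + nat (- t)" "k + nat t"])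
    show "p = diag (k + nat (- t)) (k + nat t)" by (auto simp: p diag_def)
  qed (use assms MN in \<open>auto simp: p arr_idx_def Lt_def split: if_splits\<close>)
qed

text \<open>The strict plane-partition inequalities for x = q^\<Lambda>, reversed because q < 1,
  written in row and column coordinates.\<close>

definition increasing_array :: "(int \<times> nat \<Rightarrow> real) \<Rightarrow> bool" where
  "increasing_array x \<longleftrightarrow> (\<forall>i j. 1 \<le> i \<longrightarrow> i \<le> M \<longrightarrow> 1 \<le> j \<longrightarrow> j \<le> N \<longrightarrow>
     (Suc i \<le> M \<longrightarrow> x (diag i j) < x (diag (Suc i) j)) \<and>
     (Suc j \<le> N \<longrightarrow> x (diag i j) < x (diag i (Suc j))))"

text \<open>A unit move down or to the right leads to a neighbouring diagonal; which of the
  interlacing inequalities it expresses depends on the side of the main diagonal.\<close>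

lemma limit_array_ok_imp_increasing:
  assumes ok: "limit_array_ok M N x"
  shows "increasing_array x"
  unfolding increasing_array_def
proof (intro allI impI conjI)
  fix i j assume ij: "1 \<le> i" "i \<le> M" "1 \<le> j" "j \<le> N"
  have left: "x (t + 1, k) < x (t, k) \<and> x (t, k) < x (t + 1, k + 1)"
    if "lo \<le> t" "t \<le> - 1" "1 \<le> k" "k \<le> L t" for t k
    using ok that unfolding limit_array_ok_def by blast
  have right: "x (t, k) < x (t + 1, k) \<and> x (t + 1, k) < xext M N x t (k + 1)"
    if "0 \<le> t" "t \<le> int N - 2" "1 \<le> k" "k \<le> L (t + 1)" for t k
    using ok that unfolding limit_array_ok_def by blast
  show "x (diag i j) < x (diag (Suc i) j)" if "Suc i \<le> M"
  proof (cases "j \<le> i")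
    case True
    then show ?thesis
      using left[of "int j - int i - 1" j] ij that by (auto simp: diag_def Lt_def algebra_simps)
  next
    case False
    define t where "t = int j - int i - 1"
    have "i < L t" "i \<le> L (t + 1)" "0 \<le> t" "t \<le> int N - 2"
      using False ij that MN by (auto simp: t_def L_nonneg)
    then have "x (t + 1, i) < x (t, i + 1)"
      using right[of t i] ij by (simp add: xext_def)
    then show ?thesis using False by (simp add: diag_def t_def algebra_simps)
  qed
  show "x (diag i j) < x (diag i (Suc j))" if "Suc j \<le> N"
  proof (cases "j < i")
    case True
    then show ?thesis
      using left[of "int j - int i" j] ij that by (auto simp: diag_def Lt_def algebra_simps)
  next
    case False
    define t where "t = int j - int i"
    have "i \<le> L (t + 1)" "0 \<le> t" "t \<le> int N - 2"
      using False ij that MN by (auto simp: t_def L_nonneg)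
    then have "x (t, i) < x (t + 1, i)"
      using right[of t i] ij by simp
    then show ?thesis using False by (simp add: diag_def t_def algebra_simps)
  qed
qed

text \<open>The bounds 0 < x < 1 form a separate hypothesis, because monotonicity says nothing about
  the extreme entries.\<close>

lemma increasing_imp_limit_array_ok:
  assumes inc: "increasing_array x" and unit: "\<forall>p\<in>arr_idx M N. 0 < x p \<and> x p < 1"
  shows "limit_array_ok M N x"
proof -
  have down: "x (diag i j) < x (diag (Suc i) j)" if "1 \<le> i" "Suc i \<le> M" "1 \<le> j" "j \<le> N" for i j
    using inc that by (simp add: increasing_array_def)
  have across: "x (diag i j) < x (diag i (Suc j))" if "1 \<le> i" "i \<le> M" "1 \<le> j" "Suc j \<le> N" for i j
    using inc that by (simp add: increasing_array_def)
  have units: "unit_entries (L t) (\<lambda>i. x (t, Suc i))" if "lo \<le> t" "t \<le> hi" for t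
    using unit that by (auto simp: unit_entries_def arr_idx_def)
  have ch: "chamber (L t) (\<lambda>i. x (t, Suc i))" if "t = lo \<or> t = hi" for t
    using units[of t] that L_lo L_hi M1 MN by (intro chamberI) auto
  have "slice_link t x" if t: "lo \<le> t" "t < hi" for t
  proof (cases "t < 0")
    case True
    define s where "s = nat (- t)"
    have s: "t = - int s" "1 \<le> s" "Suc s \<le> M" using True t by (auto simp: s_def)
    have "x (t + 1, Suc i) < x (t, Suc i) \<and> x (t, Suc i) < x (t + 1, Suc (Suc i))" if "i < L t" for i
    proof
      have i: "Suc i + s \<le> M" using that True t by (auto simp: Lt_def s_def)
      have d: "diag (i + s) (Suc i) = (t + 1, Suc i)" "diag (Suc (i + s)) (Suc i) = (t, Suc i)"
        "diag (Suc (i + s)) (Suc (Suc i)) = (t + 1, Suc (Suc i))"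
        using s by (auto simp: diag_def)
      show "x (t + 1, Suc i) < x (t, Suc i)"
        using down[of "i + s" "Suc i"] i s MN unfolding d by simp
      show "x (t, Suc i) < x (t + 1, Suc (Suc i))"
        using across[of "Suc (i + s)" "Suc i"] i s MN unfolding d by simp
    qed
    then show ?thesis
      using True units[of t] units[of "t + 1"] t by (simp add: slice_link_def linked_def interlaced_def)
  next
    case False
    define s where "s = nat t"
    have s: "t = int s" using False by (simp add: s_def)
    have "x (t, Suc i) < x (t + 1, Suc i) \<and> (Suc i < L t \<longrightarrow> x (t + 1, Suc i) < x (t, Suc (Suc i)))"
      if "i < L (t + 1)" for i
    proof (intro conjI impI)
      have i: "Suc i + Suc s \<le> N" "Suc i \<le> M" using that False by (auto simp: L_nonneg s_def)
      have d: "diag (Suc i) (Suc (i + s)) = (t, Suc i)" "diag (Suc i) (Suc (Suc (i + s))) = (t + 1, Suc i)"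
        "diag (Suc (Suc i)) (Suc (Suc (i + s))) = (t, Suc (Suc i))"
        using s by (auto simp: diag_def)
      show "x (t, Suc i) < x (t + 1, Suc i)"
        using across[of "Suc i" "Suc (i + s)"] i unfolding d by simp
      assume "Suc i < L t"
      then have "Suc (Suc i) \<le> M" using False by (auto simp: L_nonneg)
      then show "x (t + 1, Suc i) < x (t, Suc (Suc i))"
        using down[of "Suc i" "Suc (Suc (i + s))"] i unfolding d by simp
    qed
    then show ?thesis
      using False units[of t] units[of "t + 1"] t by (simp add: slice_link_def linked_def interlaced_def)
  qed
  then show ?thesis using ch unfolding limit_array_ok_iff by auto
qed

text \<open>The event contains a box of positive measure: the entry in row i and column j is
  confined to the interval from (i+j-1)/(M+N) to (i+j)/(M+N), and these intervals move up along rows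
  and columns.\<close>

lemma ok_set_pos: "0 < emeasure \<nu> ok_set"
proof -
  define S where "S = real (M + N)"
  have S: "0 < S" using M1 by (simp add: S_def)
  \<comment> \<open>This is i + j in diagonal coordinates, by i + j = 2 min(i, j) + |j - i|.\<close>
  define h where "h p = real (2 * snd p) + real_of_int \<bar>fst p\<bar>" for p :: "int \<times> nat"
  have h: "h (diag i j) = real (i + j)" for i j by (auto simp: h_def diag_def min_def)
  define B where "B p = {(h p - 1) / S<..<h p / S}" for p
  interpret product_sigma_finite "\<lambda>p :: int \<times> nat. power_law (expo (fst p))"
    by (simp add: product_sigma_finite_def prob_space_imp_sigma_finite prob_space_power_law expo_pos)
  have range: "1 \<le> h p" "h p \<le> S" if p: "p \<in> arr_idx M N" for p
  proof -
    obtain i j where "1 \<le> i" "i \<le> M" "1 \<le> j" "j \<le> N" "p = diag i j" using arr_idx_diag[OF p] .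
    then show "1 \<le> h p" "h p \<le> S" by (auto simp: h S_def)
  qed
  have "emeasure \<nu> (Pi\<^sub>E (arr_idx M N) B) = (\<Prod>p\<in>arr_idx M N. emeasure (power_law (expo (fst p))) (B p))"
    unfolding \<nu>_def by (rule emeasure_PiM[OF finite_arr_idx]) (simp add: B_def sets_power_law)
  also have "\<dots> > 0"
  proof -
    have "emeasure (power_law (expo (fst p))) (B p) \<noteq> 0" if "p \<in> arr_idx M N" for p
    proof -
      have "emeasure (power_law (expo (fst p))) (B p) =
          ennreal ((h p / S) powr expo (fst p) - ((h p - 1) / S) powr expo (fst p))"
        unfolding B_def using range[OF that] S
        by (intro emeasure_power_law_Ioo expo_pos) (auto simp: field_simps)
      moreover have "((h p - 1) / S) powr expo (fst p) < (h p / S) powr expo (fst p)"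
        using range[OF that] S by (intro powr_less_mono2 expo_pos) (auto simp: divide_strict_right_mono)
      ultimately show ?thesis by simp
    qed
    then show ?thesis using finite_arr_idx by (auto simp: zero_less_iff_neq_zero prod_zero_iff)
  qed
  also have "emeasure \<nu> (Pi\<^sub>E (arr_idx M N) B) \<le> emeasure \<nu> ok_set"
  proof (rule emeasure_mono[OF _ ok_set_measurable], rule subsetI)
    fix x assume x: "x \<in> Pi\<^sub>E (arr_idx M N) B"
    then have xB: "(h p - 1) / S < x p \<and> x p < h p / S" if "p \<in> arr_idx M N" for p
      using that by (auto simp: PiE_iff B_def)
    have "increasing_array x"
      unfolding increasing_array_def
    proof (intro allI impI conjI)
      fix i j assume ij: "1 \<le> i" "i \<le> M" "1 \<le> j" "j \<le> N"
      show "x (diag i j) < x (diag (Suc i) j)" if "Suc i \<le> M"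
        using xB[OF diag_in_arr_idx, of i j] xB[OF diag_in_arr_idx, of "Suc i" j] ij that by (simp add: h)
      show "x (diag i j) < x (diag i (Suc j))" if "Suc j \<le> N"
        using xB[OF diag_in_arr_idx, of i j] xB[OF diag_in_arr_idx, of i "Suc j"] ij that by (simp add: h)
    qed
    moreover have "0 < x p \<and> x p < 1" if "p \<in> arr_idx M N" for p
    proof -
      have "0 \<le> (h p - 1) / S" "h p / S \<le> 1" using range[OF that] S by auto
      then show ?thesis using xB[OF that] by linarith
    qed
    ultimately show "x \<in> ok_set"
      using x increasing_imp_limit_array_ok by (auto simp: ok_set_def space_\<nu> PiE_iff)
  qed
  finally show ?thesis .
qed

end

section \<open>Convergence\<close>

context plane_partition_limit
begin

text \<open>No monotonicity is imposed: this is the countable state space of the unconditioned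
  rounded array, whose entries are independent geometric variables.\<close>

definition arrays :: "(nat \<Rightarrow> nat \<Rightarrow> nat) set" where
  "arrays = {\<Lambda>. \<forall>i j. \<Lambda> i j \<noteq> 0 \<longrightarrow> 1 \<le> i \<and> i \<le> M \<and> 1 \<le> j \<and> j \<le> N}"

definition discrete_array :: "real \<Rightarrow> (int \<times> nat \<Rightarrow> real) \<Rightarrow> nat \<Rightarrow> nat \<Rightarrow> nat" where
  "discrete_array \<epsilon> x i j =
     (if 1 \<le> i \<and> i \<le> M \<and> 1 \<le> j \<and> j \<le> N then discretize \<epsilon> (x (diag i j)) else 0)"

lemma discrete_array_in: "discrete_array \<epsilon> x \<in> arrays"
  by (auto simp: arrays_def discrete_array_def)

lemma plane_partitions_subset: "plane_partitions M N \<subseteq> arrays"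
  by (auto simp: plane_partitions_def arrays_def)

lemma countable_arrays: "countable arrays"
proof -
  let ?R = "{1..M} \<times> {1..N}"
  have "inj_on (\<lambda>\<Lambda>. \<lambda>(i, j)\<in>?R. \<Lambda> i j) arrays"
  proof (rule inj_onI, intro ext)
    fix \<Lambda> \<Lambda>' i j assume L: "\<Lambda> \<in> arrays" "\<Lambda>' \<in> arrays"
      and eq: "(\<lambda>(i, j)\<in>?R. \<Lambda> i j) = (\<lambda>(i, j)\<in>?R. \<Lambda>' i j)"
    show "\<Lambda> i j = \<Lambda>' i j"
    proof (cases "(i, j) \<in> ?R")
      case True
      then show ?thesis using fun_cong[OF eq, of "(i, j)"] by simp
    next
      case False
      then have "\<not> (1 \<le> i \<and> i \<le> M \<and> 1 \<le> j \<and> j \<le> N)" by simp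
      then have "\<Lambda> i j = 0" "\<Lambda>' i j = 0" using L unfolding arrays_def by blast+
      then show ?thesis by simp
    qed
  qed
  moreover have "(\<lambda>\<Lambda>. \<lambda>(i, j)\<in>?R. \<Lambda> i j) ` arrays \<subseteq> (\<Pi>\<^sub>E p\<in>?R. UNIV)"
    by (intro image_subsetI) (simp add: restrict_PiE_iff)
  then have "countable ((\<lambda>\<Lambda>. \<lambda>(i, j)\<in>?R. \<Lambda> i j) ` arrays)"
    by (rule countable_subset) (intro countable_PiE; simp)
  ultimately show ?thesis by (simp add: countable_image_inj_eq)
qed

lemma slice_discrete_array:
  assumes "p \<in> arr_idx M N"
  shows "slice (discrete_array \<epsilon> x) (fst p) (snd p) = discretize \<epsilon> (x p)"
proof -
  obtain i j where "1 \<le> i" "i \<le> M" "1 \<le> j" "j \<le> N" "p = diag i j" using arr_idx_diag[OF assms] .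
  then show ?thesis using slice_diag[of "discrete_array \<epsilon> x" i j] by (simp add: discrete_array_def)
qed

lemma pp_array_discrete_array:
  "pp_array q M N (discrete_array \<epsilon> x) = restrict (\<lambda>p. q ^ discretize \<epsilon> (x p)) (arr_idx M N)"
  unfolding pp_array_def
proof (rule restrict_ext)
  fix p assume "p \<in> arr_idx M N"
  from slice_discrete_array[OF this, of \<epsilon> x]
  show "(case p of (t, i) \<Rightarrow> q ^ slice (discrete_array \<epsilon> x) t i) = q ^ discretize \<epsilon> (x p)"
    by (simp add: case_prod_beta)
qed

lemma discrete_array_eq_iff:
  assumes \<Lambda>: "\<Lambda> \<in> arrays" and x: "x \<in> space \<nu>"
  shows "discrete_array \<epsilon> x = \<Lambda> \<longleftrightarrow>
    x \<in> (\<Pi>\<^sub>E p\<in>arr_idx M N. {u. discretize \<epsilon> u = slice \<Lambda> (fst p) (snd p)})" (is "?l \<longleftrightarrow> ?r")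
proof
  assume ?l
  then show ?r using x slice_discrete_array[of _ \<epsilon> x] by (auto simp: space_\<nu> PiE_iff)
next
  assume r: ?r
  show ?l
  proof (intro ext)
    fix i j
    show "discrete_array \<epsilon> x i j = \<Lambda> i j"
    proof (cases "1 \<le> i \<and> i \<le> M \<and> 1 \<le> j \<and> j \<le> N")
      case True
      then have "discretize \<epsilon> (x (diag i j)) = slice \<Lambda> (fst (diag i j)) (snd (diag i j))"
        using r diag_in_arr_idx[of i j] by (auto simp: PiE_iff)
      then show ?thesis using True by (simp add: discrete_array_def slice_diag)
    next
      case False
      then have "\<Lambda> i j = 0" using \<Lambda> unfolding arrays_def by blast
      then show ?thesis using False by (auto simp: discrete_array_def)
    qed
  qed
qed

lemma slice_size_arrays:
  assumes "\<Lambda> \<in> arrays"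
  shows "slice_size M N \<Lambda> t = (\<Sum>k\<in>{1..L t}. slice \<Lambda> t k)"
  unfolding slice_size_def
proof (rule sum.mono_neutral_right)
  show "{1..L t} \<subseteq> {1..M + N}" by (auto simp: Lt_def split: if_splits)
  have A: "i \<le> M \<and> j \<le> N" if "\<Lambda> i j \<noteq> 0" for i j
    using assms that unfolding arrays_def by blast
  show "\<forall>k\<in>{1..M + N} - {1..L t}. slice \<Lambda> t k = 0"
  proof (rule ballI, rule ccontr)
    fix k assume k: "k \<in> {1..M + N} - {1..L t}" and "slice \<Lambda> t k \<noteq> 0"
    then have "if t \<le> 0 then k + nat \<bar>t\<bar> \<le> M else k \<le> M \<and> k + nat t \<le> N"
      using A by (auto simp: slice_def split: if_splits)
    then show False using k by (auto simp: Lt_def split: if_splits)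
  qed
qed simp

text \<open>The volumes are regrouped by diagonals, so that each entry contributes its own factor.
  This factorisation matches the weight with a product of geometric laws.\<close>

lemma pp_weight_eq:
  assumes \<Lambda>: "\<Lambda> \<in> arrays"
  shows "pp_weight (exp (- \<epsilon>)) (exp (- \<alpha> * \<epsilon>)) \<eta> \<theta> M N \<Lambda> =
    (\<Prod>p\<in>arr_idx M N. exp (- \<epsilon> * expo (fst p) * real (slice \<Lambda> (fst p) (snd p))))"
proof -
  define s where "s t = real (slice_size M N \<Lambda> t)" for t
  have "\<eta> * real (left_vol M N \<Lambda>) + \<beta> * real (central_vol M N \<Lambda>) + \<theta> * real (right_vol M N \<Lambda>) =
      (\<Sum>t\<in>{- int M..-1}. expo t * s t) + (\<Sum>t\<in>{0}. expo t * s t) + (\<Sum>t\<in>{1..int N}. expo t * s t)"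
    unfolding left_vol_def central_vol_def right_vol_def s_def
    by (simp add: expo_def sum_distrib_left)
  also have "\<dots> = (\<Sum>t\<in>{- int M..-1} \<union> {0} \<union> {1..int N}. expo t * s t)"
    by (subst sum.union_disjoint, simp, simp, force, subst sum.union_disjoint) auto
  \<comment> \<open>The slices at t = -M and t = N are empty.\<close>
  also have "\<dots> = (\<Sum>t\<in>{lo..hi}. expo t * s t)"
    using M1 MN by (intro sum.mono_neutral_right) (auto simp: s_def slice_size_arrays[OF \<Lambda>] Lt_def)
  also have "\<dots> = (\<Sum>t\<in>{lo..hi}. \<Sum>k\<in>{1..L t}. expo t * real (slice \<Lambda> t k))"
    by (simp add: s_def slice_size_arrays[OF \<Lambda>] sum_distrib_left)
  also have "\<dots> = (\<Sum>p\<in>arr_idx M N. expo (fst p) * real (slice \<Lambda> (fst p) (snd p)))"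
  proof -
    have "arr_idx M N = Sigma {lo..hi} (\<lambda>t. {1..L t})" by (auto simp: arr_idx_def)
    then show ?thesis by (simp add: sum.Sigma case_prod_beta)
  qed
  finally have sum: "\<eta> * real (left_vol M N \<Lambda>) + \<beta> * real (central_vol M N \<Lambda>) + \<theta> * real (right_vol M N \<Lambda>) =
      (\<Sum>p\<in>arr_idx M N. expo (fst p) * real (slice \<Lambda> (fst p) (snd p)))" .
  have "exp (- \<alpha> * \<epsilon>) * exp (- \<epsilon>) powr ((\<eta> + \<theta>) / 2) = exp (- \<epsilon> * \<beta>)"
    by (simp add: powr_def \<beta>_def algebra_simps flip: exp_add)
  then have "pp_weight (exp (- \<epsilon>)) (exp (- \<alpha> * \<epsilon>)) \<eta> \<theta> M N \<Lambda> =
      exp (- \<epsilon> * (\<eta> * real (left_vol M N \<Lambda>))) * exp (- \<epsilon> * \<beta> * real (central_vol M N \<Lambda>)) * exp (- \<epsilon> * (\<theta> * real (right_vol M N \<Lambda>)))"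
    unfolding pp_weight_def by (simp add: powr_def mult_ac flip: exp_of_nat_mult)
  also have "\<dots> = exp (- \<epsilon> * (\<eta> * real (left_vol M N \<Lambda>) + \<beta> * real (central_vol M N \<Lambda>) + \<theta> * real (right_vol M N \<Lambda>)))"
    by (simp add: algebra_simps flip: exp_add)
  also have "\<dots> = (\<Prod>p\<in>arr_idx M N. exp (- \<epsilon> * expo (fst p) * real (slice \<Lambda> (fst p) (snd p))))"
    unfolding sum by (simp add: sum_distrib_left exp_sum finite_arr_idx mult_ac flip: sum_negf)
  finally show ?thesis .
qed

text \<open>Product of the normalising factors 1 - q^c of the geometric laws.\<close>

definition norm_const :: "real \<Rightarrow> real" where
  "norm_const \<epsilon> = (\<Prod>p\<in>arr_idx M N. 1 - exp (- \<epsilon> * expo (fst p)))"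

lemma norm_const_pos: "0 < \<epsilon> \<Longrightarrow> 0 < norm_const \<epsilon>"
  unfolding norm_const_def using expo_pos by (auto intro!: prod_pos)

abbreviation weight :: "real \<Rightarrow> (nat \<Rightarrow> nat \<Rightarrow> nat) \<Rightarrow> real" where
  "weight \<epsilon> \<equiv> pp_weight (exp (- \<epsilon>)) (exp (- \<alpha> * \<epsilon>)) \<eta> \<theta> M N"

lemma weight_nonneg: "0 \<le> weight \<epsilon> \<Lambda>"
  by (simp add: pp_weight_def)

text \<open>The preimage of a single array is a box of level sets of \<open>discretize\<close>, so
  its measure is a product of geometric probabilities; on a countable space this determines the
  law.\<close>

lemma measurable_discrete_array: "discrete_array \<epsilon> \<in> measurable \<nu> (count_space arrays)"
  and distr_discrete_array:
    "0 < \<epsilon> \<Longrightarrow> distr \<nu> (count_space arrays) (discrete_array \<epsilon>) =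
      density (count_space arrays) (\<lambda>\<Lambda>. ennreal (norm_const \<epsilon> * weight \<epsilon> \<Lambda>))"
proof -
  let ?B = "\<lambda>\<Lambda> p. {u. discretize \<epsilon> u = slice \<Lambda> (fst p) (snd p)}"
  interpret product_sigma_finite "\<lambda>p :: int \<times> nat. power_law (expo (fst p))"
    by (simp add: product_sigma_finite_def prob_space_imp_sigma_finite prob_space_power_law expo_pos)
  have B: "?B \<Lambda> p \<in> sets (power_law c)" for \<Lambda> p c
  proof -
    have "?B \<Lambda> p = discretize \<epsilon> -` {slice \<Lambda> (fst p) (snd p)} \<inter> space borel" by auto
    also have "\<dots> \<in> sets borel" by measurable
    finally show ?thesis by (simp add: sets_power_law)
  qed
  have vimage: "discrete_array \<epsilon> -` {\<Lambda>} \<inter> space \<nu> = Pi\<^sub>E (arr_idx M N) (?B \<Lambda>)" if "\<Lambda> \<in> arrays" for \<Lambda>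
  proof -
    have "Pi\<^sub>E (arr_idx M N) (?B \<Lambda>) \<subseteq> space \<nu>" by (auto simp: space_\<nu> PiE_iff)
    then show ?thesis
      using discrete_array_eq_iff[OF that, of _ \<epsilon>] unfolding vimage_def by blast
  qed
  have sets: "Pi\<^sub>E (arr_idx M N) (?B \<Lambda>) \<in> sets \<nu>" for \<Lambda>
    unfolding \<nu>_def by (intro sets_PiM_I_finite finite_arr_idx B)
  show meas: "discrete_array \<epsilon> \<in> measurable \<nu> (count_space arrays)"
    unfolding measurable_count_space_eq_countable[OF countable_arrays]
    using discrete_array_in vimage sets by auto
  assume \<epsilon>: "0 < \<epsilon>"
  show "distr \<nu> (count_space arrays) (discrete_array \<epsilon>) =
      density (count_space arrays) (\<lambda>\<Lambda>. ennreal (norm_const \<epsilon> * weight \<epsilon> \<Lambda>))"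
  proof (rule measure_eqI_countable[OF _ _ countable_arrays])
    fix \<Lambda> assume \<Lambda>: "\<Lambda> \<in> arrays"
    have "emeasure (distr \<nu> (count_space arrays) (discrete_array \<epsilon>)) {\<Lambda>} = emeasure \<nu> (Pi\<^sub>E (arr_idx M N) (?B \<Lambda>))"
      using \<Lambda> by (subst emeasure_distr[OF meas]) (auto simp: vimage)
    also have "\<dots> = (\<Prod>p\<in>arr_idx M N. emeasure (power_law (expo (fst p))) (?B \<Lambda> p))"
      unfolding \<nu>_def by (rule emeasure_PiM[OF finite_arr_idx]) (rule B)
    also have "\<dots> = (\<Prod>p\<in>arr_idx M N. ennreal ((1 - exp (- \<epsilon> * expo (fst p))) *
        exp (- \<epsilon> * expo (fst p) * real (slice \<Lambda> (fst p) (snd p)))))"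
      by (intro prod.cong refl emeasure_power_law_discretize expo_pos \<epsilon>)
    also have "\<dots> = ennreal (\<Prod>p\<in>arr_idx M N. (1 - exp (- \<epsilon> * expo (fst p))) *
        exp (- \<epsilon> * expo (fst p) * real (slice \<Lambda> (fst p) (snd p))))"
      using \<epsilon> expo_pos by (intro prod_ennreal) (auto simp: less_imp_le)
    also have "\<dots> = ennreal (norm_const \<epsilon> * weight \<epsilon> \<Lambda>)"
      unfolding pp_weight_eq[OF \<Lambda>] norm_const_def prod.distrib ..
    also have "\<dots> = emeasure (density (count_space arrays) (\<lambda>\<Lambda>. ennreal (norm_const \<epsilon> * weight \<epsilon> \<Lambda>))) {\<Lambda>}"
      using \<Lambda> by (subst emeasure_density) (auto simp: nn_integral_count_space_indicator[symmetric])
    finally show "emeasure (distr \<nu> (count_space arrays) (discrete_array \<epsilon>)) {\<Lambda>} =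
      emeasure (density (count_space arrays) (\<lambda>\<Lambda>. ennreal (norm_const \<epsilon> * weight \<epsilon> \<Lambda>))) {\<Lambda>}" .
  qed auto
qed

text \<open>Translates between integrals over \<open>\<nu>\<close> and the unordered sums in
  \<open>pp_expect\<close>; the bound on h yields integrability and hence absolute
  summability.\<close>

lemma integral_discrete_array:
  assumes \<epsilon>: "0 < \<epsilon>" and h: "\<And>\<Lambda>. \<bar>h \<Lambda>\<bar> \<le> B"
  shows "(\<integral>x. h (discrete_array \<epsilon> x) \<partial>\<nu>) = norm_const \<epsilon> * infsum (\<lambda>\<Lambda>. weight \<epsilon> \<Lambda> * h \<Lambda>) arrays"
proof -
  interpret prob_space \<nu> by (rule prob_space_\<nu>)
  let ?w = "\<lambda>\<Lambda>. norm_const \<epsilon> * weight \<epsilon> \<Lambda>"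
  have w: "0 \<le> ?w \<Lambda>" for \<Lambda> using norm_const_pos[OF \<epsilon>] weight_nonneg[of \<epsilon> \<Lambda>] by simp
  have "integrable \<nu> (\<lambda>x. h (discrete_array \<epsilon> x))"
    using h by (intro integrable_const_bound[where B = B])
      (auto intro!: measurable_compose[OF measurable_discrete_array])
  then have "integrable (distr \<nu> (count_space arrays) (discrete_array \<epsilon>)) h"
    by (subst integrable_distr_eq[OF measurable_discrete_array]) auto
  then have int: "integrable (count_space arrays) (\<lambda>\<Lambda>. ?w \<Lambda> * h \<Lambda>)"
    unfolding distr_discrete_array[OF \<epsilon>] using w by (subst (asm) integrable_density) auto
  have "(\<integral>x. h (discrete_array \<epsilon> x) \<partial>\<nu>) = (\<integral>\<Lambda>. h \<Lambda> \<partial>distr \<nu> (count_space arrays) (discrete_array \<epsilon>))"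
    by (subst integral_distr[OF measurable_discrete_array]) auto
  also have "\<dots> = (\<integral>\<Lambda>. ?w \<Lambda> * h \<Lambda> \<partial>count_space arrays)"
    unfolding distr_discrete_array[OF \<epsilon>] using w by (subst integral_density) auto
  also have "\<dots> = infsum (\<lambda>\<Lambda>. ?w \<Lambda> * h \<Lambda>) arrays"
    using int by (subst infsetsum_infsum[symmetric]) (auto simp: Infinite_Set_Sum.abs_summable_on_def infsetsum_def)
  also have "\<dots> = norm_const \<epsilon> * infsum (\<lambda>\<Lambda>. weight \<epsilon> \<Lambda> * h \<Lambda>) arrays"
    by (simp add: mult.assoc infsum_cmult_right')
  finally show ?thesis .
qed

text \<open>Numerator and denominator are both expectations over the unconditioned array, restricted
  to plane partitions; \<open>norm_const\<close> occurs in each and cancels.\<close>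

lemma pp_expect_eq:
  assumes \<epsilon>: "0 < \<epsilon>" and f: "\<And>x. x \<in> Pi\<^sub>E (arr_idx M N) (\<lambda>_. UNIV) \<Longrightarrow> \<bar>f x\<bar> \<le> B"
  shows "pp_expect \<epsilon> \<alpha> \<eta> \<theta> M N f =
    (\<integral>x. of_bool (discrete_array \<epsilon> x \<in> plane_partitions M N) * f (pp_array (exp (- \<epsilon>)) M N (discrete_array \<epsilon> x)) \<partial>\<nu>) /
    (\<integral>x. of_bool (discrete_array \<epsilon> x \<in> plane_partitions M N) \<partial>\<nu>)"
proof -
  have restrict: "infsum (\<lambda>\<Lambda>. weight \<epsilon> \<Lambda> * (of_bool (\<Lambda> \<in> plane_partitions M N) * h \<Lambda>)) arrays =
      infsum (\<lambda>\<Lambda>. weight \<epsilon> \<Lambda> * h \<Lambda>) (plane_partitions M N)" for h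
    using plane_partitions_subset by (intro infsum_cong_neutral) auto
  have bound: "\<bar>of_bool (\<Lambda> \<in> plane_partitions M N) * f (pp_array (exp (- \<epsilon>)) M N \<Lambda>)\<bar> \<le> B" for \<Lambda>
  proof -
    have "\<bar>f (pp_array (exp (- \<epsilon>)) M N \<Lambda>)\<bar> \<le> B" by (rule f) (simp add: pp_array_def)
    then show ?thesis by (auto intro: order_trans[OF abs_ge_zero])
  qed
  show ?thesis
    using restrict[of "\<lambda>\<Lambda>. f (pp_array (exp (- \<epsilon>)) M N \<Lambda>)"] restrict[of "\<lambda>_. 1"] norm_const_pos[OF \<epsilon>]
      integral_discrete_array[OF \<epsilon>, where h = "\<lambda>\<Lambda>. of_bool (\<Lambda> \<in> plane_partitions M N) * f (pp_array (exp (- \<epsilon>)) M N \<Lambda>)", OF bound]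
      integral_discrete_array[OF \<epsilon>, where h = "\<lambda>\<Lambda>. of_bool (\<Lambda> \<in> plane_partitions M N)" and B = 1]
    by (simp add: pp_expect_def Let_def)
qed

section \<open>When a rounded array is a plane partition\<close>

lemma increasing_imp_plane_partition:
  assumes "increasing_array x" "\<forall>p\<in>arr_idx M N. 0 < x p \<and> x p < 1" "0 < \<epsilon>"
  shows "discrete_array \<epsilon> x \<in> plane_partitions M N"
proof -
  have "discrete_array \<epsilon> x (Suc i) j \<le> discrete_array \<epsilon> x i j" if "1 \<le> i" "1 \<le> j" for i j
  proof (cases "Suc i \<le> M \<and> j \<le> N")
    case True
    then have "discretize \<epsilon> (x (diag (Suc i) j)) \<le> discretize \<epsilon> (x (diag i j))"
      using assms that diag_in_arr_idx[of i j]
      by (intro discretize_antimono) (auto simp: increasing_array_def less_imp_le)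
    then show ?thesis using True that by (simp add: discrete_array_def)
  qed (auto simp: discrete_array_def)
  moreover have "discrete_array \<epsilon> x i (Suc j) \<le> discrete_array \<epsilon> x i j" if "1 \<le> i" "1 \<le> j" for i j
  proof (cases "i \<le> M \<and> Suc j \<le> N")
    case True
    then have "discretize \<epsilon> (x (diag i (Suc j))) \<le> discretize \<epsilon> (x (diag i j))"
      using assms that diag_in_arr_idx[of i j]
      by (intro discretize_antimono) (auto simp: increasing_array_def less_imp_le)
    then show ?thesis using True that by (simp add: discrete_array_def)
  qed (auto simp: discrete_array_def)
  ultimately show ?thesis
    using discrete_array_in[of \<epsilon> x] by (simp add: plane_partitions_def arrays_def)
qed

text \<open>Since the entries are distinct, a violated inequality is strictly violated, and rounding
  preserves this as soon as \<epsilon> is at most the gap between the two logarithms, which serves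
  as d.\<close>

lemma not_increasing_imp_not_plane_partition:
  assumes "\<not> increasing_array x" and unit: "\<forall>p\<in>arr_idx M N. 0 < x p \<and> x p < 1"
    and dist: "\<forall>p\<in>arr_idx M N. \<forall>q\<in>arr_idx M N. p \<noteq> q \<longrightarrow> x p \<noteq> x q"
  obtains d where "0 < d" "\<And>\<epsilon>. 0 < \<epsilon> \<Longrightarrow> \<epsilon> \<le> d \<Longrightarrow> discrete_array \<epsilon> x \<notin> plane_partitions M N"
proof -
  note goal = that
  have key: thesis if ij: "1 \<le> i" "i \<le> M" "1 \<le> j" "j \<le> N" "1 \<le> i'" "i' \<le> M" "1 \<le> j'" "j' \<le> N"
    and nb: "i' = Suc i \<and> j' = j \<or> i' = i \<and> j' = Suc j" and ge: "\<not> x (diag i j) < x (diag i' j')" for i j i' j'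
  proof -
    have p: "diag i j \<in> arr_idx M N" "diag i' j' \<in> arr_idx M N" using diag_in_arr_idx ij by auto
    have "diag i j \<noteq> diag i' j'" using nb by (auto simp: diag_def)
    then have less: "x (diag i' j') < x (diag i j)" using dist p ge by (meson linorder_neqE_linordered_idom)
    show thesis
    proof (rule goal[of "ln (x (diag i j)) - ln (x (diag i' j'))"])
      show "0 < ln (x (diag i j)) - ln (x (diag i' j'))" using less unit p by simp
      fix \<epsilon> :: real assume "0 < \<epsilon>" "\<epsilon> \<le> ln (x (diag i j)) - ln (x (diag i' j'))"
      then have "discretize \<epsilon> (x (diag i j)) < discretize \<epsilon> (x (diag i' j'))"
        using less unit p by (intro discretize_strict) auto
      then have "discrete_array \<epsilon> x i j < discrete_array \<epsilon> x i' j'"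
        using ij by (simp add: discrete_array_def)
      moreover have "discrete_array \<epsilon> x i' j' \<le> discrete_array \<epsilon> x i j"
        if "discrete_array \<epsilon> x \<in> plane_partitions M N"
        using nb ij that by (auto simp: plane_partitions_def)
      ultimately show "discrete_array \<epsilon> x \<notin> plane_partitions M N" by fastforce
    qed
  qed
  from assms(1) obtain i j where ij: "1 \<le> i" "i \<le> M" "1 \<le> j" "j \<le> N"
    and "Suc i \<le> M \<and> \<not> x (diag i j) < x (diag (Suc i) j) \<or> Suc j \<le> N \<and> \<not> x (diag i j) < x (diag i (Suc j))"
    unfolding increasing_array_def by blast
  then show thesis
  proof (elim disjE conjE)
    assume "Suc i \<le> M" "\<not> x (diag i j) < x (diag (Suc i) j)"
    then show thesis using ij by (intro key[of i j "Suc i" j]) auto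
  next
    assume "Suc j \<le> N" "\<not> x (diag i j) < x (diag i (Suc j))"
    then show thesis using ij by (intro key[of i j i "Suc j"]) auto
  qed
qed

text \<open>Ties are the only obstruction: plane partitions satisfy weak inequalities, so an array
  with two equal neighbours could pass at every scale without lying in \<open>ok_set\<close>. Almost
  surely there are none.\<close>

lemma AE_indicator_limit:
  assumes S: "S \<longlonglongrightarrow> 0" "\<And>n. 0 < S n"
  shows "AE x in \<nu>. (\<lambda>n. of_bool (discrete_array (S n) x \<in> plane_partitions M N) :: real)
    \<longlonglongrightarrow> indicator ok_set x"
  using AE_\<nu>_unit AE_\<nu>_distinct AE_space
proof eventually_elim
  case (elim x)
  show ?case
  proof (cases "increasing_array x")
    case True
    then have "x \<in> ok_set" using increasing_imp_limit_array_ok elim by (simp add: ok_set_def)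
    moreover have "discrete_array (S n) x \<in> plane_partitions M N" for n
      using increasing_imp_plane_partition[OF True elim(1) S(2)] .
    ultimately show ?thesis by simp
  next
    case False
    then have "x \<notin> ok_set" using limit_array_ok_imp_increasing by (auto simp: ok_set_def)
    obtain d where d: "0 < d" "\<And>\<epsilon>. 0 < \<epsilon> \<Longrightarrow> \<epsilon> \<le> d \<Longrightarrow> discrete_array \<epsilon> x \<notin> plane_partitions M N"
      using not_increasing_imp_not_plane_partition[OF False elim(1,2)] by blast
    have "eventually (\<lambda>n. S n < d) sequentially" using S(1) d(1) by (rule order_tendstoD(2))
    then have "eventually (\<lambda>n. of_bool (discrete_array (S n) x \<in> plane_partitions M N) = (0::real)) sequentially"
      by eventually_elim (use d(2) S(2) in \<open>simp add: less_imp_le\<close>)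
    then show ?thesis using \<open>x \<notin> ok_set\<close> by (simp add: tendsto_eventually)
  qed
qed

lemma pp_expect_tendsto:
  assumes cont: "continuous_on (Pi\<^sub>E (arr_idx M N) (\<lambda>_. UNIV)) f"
    and bdd: "bounded (f ` Pi\<^sub>E (arr_idx M N) (\<lambda>_. UNIV))"
    and meas: "f \<in> borel_measurable (lebPi (arr_idx M N))"
  shows "((\<lambda>\<epsilon>. pp_expect \<epsilon> \<alpha> \<eta> \<theta> M N f) \<longlongrightarrow>
    (\<integral>x. indicator ok_set x * f x \<partial>\<nu>) / measure \<nu> ok_set) (at_right 0)"
\<comment> \<open>Reduction to sequences, the setting of dominated convergence.\<close>
proof (rule tendsto_at_right_sequentially[of 0 1])
  fix S :: "nat \<Rightarrow> real" assume S: "\<And>n. 0 < S n" "S \<longlonglongrightarrow> 0"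
  interpret prob_space \<nu> by (rule prob_space_\<nu>)
  obtain B where B: "\<And>x. x \<in> Pi\<^sub>E (arr_idx M N) (\<lambda>_. UNIV) \<Longrightarrow> \<bar>f x\<bar> \<le> B"
    using bdd by (auto simp: bounded_iff)
  have f_meas: "f \<in> borel_measurable \<nu>" using meas by (simp add: measurable_cong_sets[OF sets_\<nu> refl])
  have dm: "(\<lambda>x. h (discrete_array \<epsilon> x)) \<in> borel_measurable \<nu>" for h :: "_ \<Rightarrow> real" and \<epsilon>
    by (rule measurable_compose[OF measurable_discrete_array]) simp
  have ok[measurable]: "ok_set \<in> sets \<nu>" by (rule ok_set_measurable)
  have num: "(\<lambda>n. \<integral>x. of_bool (discrete_array (S n) x \<in> plane_partitions M N) *
        f (pp_array (exp (- S n)) M N (discrete_array (S n) x)) \<partial>\<nu>) \<longlonglongrightarrow> (\<integral>x. indicator ok_set x * f x \<partial>\<nu>)"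
  proof (rule integral_dominated_convergence[where w = "\<lambda>_. B"])
    show "(\<lambda>x. indicator ok_set x * f x) \<in> borel_measurable \<nu>" using f_meas by simp
    show "(\<lambda>x. of_bool (discrete_array (S n) x \<in> plane_partitions M N) *
        f (pp_array (exp (- S n)) M N (discrete_array (S n) x))) \<in> borel_measurable \<nu>" for n
      by (rule dm)
    show "AE x in \<nu>. norm (of_bool (discrete_array (S n) x \<in> plane_partitions M N) *
        f (pp_array (exp (- S n)) M N (discrete_array (S n) x))) \<le> B" for n
    proof (rule AE_I2)
      fix x
      have "\<bar>f (pp_array (exp (- S n)) M N (discrete_array (S n) x))\<bar> \<le> B"
        by (rule B) (simp add: pp_array_def)
      then show "norm (of_bool (discrete_array (S n) x \<in> plane_partitions M N) *
        f (pp_array (exp (- S n)) M N (discrete_array (S n) x))) \<le> B"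
        by (auto intro: order_trans[OF abs_ge_zero])
    qed
    show "AE x in \<nu>. (\<lambda>n. of_bool (discrete_array (S n) x \<in> plane_partitions M N) *
        f (pp_array (exp (- S n)) M N (discrete_array (S n) x))) \<longlonglongrightarrow> indicator ok_set x * f x"
      using AE_indicator_limit[OF S(2,1)] AE_\<nu>_unit AE_space
    proof eventually_elim
      case (elim x)
      have x: "x \<in> Pi\<^sub>E (arr_idx M N) (\<lambda>_. UNIV)" using elim(3) by (simp add: space_\<nu>)
      have "(\<lambda>n. pp_array (exp (- S n)) M N (discrete_array (S n) x)) \<longlonglongrightarrow> x"
      proof (rule tendsto_fun_componentwise)
        fix p
        show "(\<lambda>n. pp_array (exp (- S n)) M N (discrete_array (S n) x) p) \<longlonglongrightarrow> x p"
        proof (cases "p \<in> arr_idx M N")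
          case True
          then show ?thesis unfolding pp_array_discrete_array
            using tendsto_discretize[OF S(2,1), of "x p"] elim(2) by (simp add: less_imp_le)
        next
          case False
          \<comment> \<open>Outside the index set both arrays are \<open>undefined\<close>, so
            convergence holds in the whole function space.\<close>
          then show ?thesis unfolding pp_array_discrete_array using PiE_arb[OF x False] by simp
        qed
      qed
      then have "(\<lambda>n. f (pp_array (exp (- S n)) M N (discrete_array (S n) x))) \<longlonglongrightarrow> f x"
        by (rule continuous_on_tendsto_compose[OF cont _ x]) (simp add: pp_array_def)
      then show ?case using elim(1) by (intro tendsto_mult)
    qed
  qed simp
  have den: "(\<lambda>n. \<integral>x. of_bool (discrete_array (S n) x \<in> plane_partitions M N) \<partial>\<nu>) \<longlonglongrightarrow>
      (\<integral>x. (indicator ok_set x :: real) \<partial>\<nu>)"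
  proof (rule integral_dominated_convergence[where w = "\<lambda>_. 1"])
    show "(\<lambda>x. of_bool (discrete_array (S n) x \<in> plane_partitions M N) :: real) \<in> borel_measurable \<nu>" for n
      by (rule dm)
  qed (use AE_indicator_limit[OF S(2,1)] in auto)
  \<comment> \<open>The limit of the denominators is positive, so the quotient converges.\<close>
  have "measure \<nu> ok_set \<noteq> 0"
    using ok_set_pos by (simp add: emeasure_eq_measure)
  moreover have "(\<lambda>n. \<integral>x. of_bool (discrete_array (S n) x \<in> plane_partitions M N) \<partial>\<nu>) \<longlonglongrightarrow> measure \<nu> ok_set"
    using den by simp
  moreover have "pp_expect (S n) \<alpha> \<eta> \<theta> M N f =
    (\<integral>x. of_bool (discrete_array (S n) x \<in> plane_partitions M N) * f (pp_array (exp (- S n)) M N (discrete_array (S n) x)) \<partial>\<nu>) /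
    (\<integral>x. of_bool (discrete_array (S n) x \<in> plane_partitions M N) \<partial>\<nu>)" for n
    by (rule pp_expect_eq[OF S(1)]) (rule B)
  ultimately show "(\<lambda>n. pp_expect (S n) \<alpha> \<eta> \<theta> M N f) \<longlonglongrightarrow> (\<integral>x. indicator ok_set x * f x \<partial>\<nu>) / measure \<nu> ok_set"
    using tendsto_divide[OF num] by simp
qed simp

end

section \<open>Marginals of the limit\<close>

lemma vandermonde_pairs:
  "vandermonde n (\<lambda>i. f (Suc i)) = (\<Prod>(i, j)\<in>{(i, j). 1 \<le> i \<and> i < j \<and> j \<le> n}. f j - f i)"
proof -
  have "vandermonde n (\<lambda>i. f (Suc i)) = (\<Prod>(j, i)\<in>Sigma {..<n} (\<lambda>j. {..<j}). f (Suc j) - f (Suc i))"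
    unfolding vandermonde_def by (subst prod.Sigma) auto
  also have "\<dots> = (\<Prod>(i, j)\<in>{(i, j). 1 \<le> i \<and> i < j \<and> j \<le> n}. f j - f i)"
    by (rule prod.reindex_bij_witness[where i = "\<lambda>(i, j). (j - 1, i - 1)" and j = "\<lambda>(j, i). (Suc i, Suc j)"]) auto
  finally show ?thesis .
qed

lemma chamber_iff_weyl_chamber: "chamber n (\<lambda>i. z (Suc i)) \<longleftrightarrow> z \<in> weyl_chamber n"
proof
  assume ch: "chamber n (\<lambda>i. z (Suc i))"
  have "0 < z i \<and> z i < 1" if "i \<in> {1..n}" for i
    using chamberD(1,2)[OF ch, of "i - 1"] that by (cases i) auto
  moreover have "z i < z j" if "i \<in> {1..n}" "j \<in> {1..n}" "i < j" for i j
  proof -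
    have "i - 1 < j - 1" "j - 1 < n" "Suc (i - 1) = i" "Suc (j - 1) = j" using that by auto
    then show ?thesis using chamberD(3)[OF ch, of "i - 1" "j - 1"] by simp
  qed
  ultimately show "z \<in> weyl_chamber n" by (simp add: weyl_chamber_def)
qed (auto simp: weyl_chamber_def chamber_def)

lemma slice_potential_nonneg:
  assumes "0 < \<gamma>" "\<And>u. 0 < u \<Longrightarrow> u < 1 \<Longrightarrow> 0 \<le> w u"
  shows "0 \<le> slice_potential \<gamma> w n z"
proof (cases "chamber n z")
  case True
  have "0 \<le> vandermonde n (\<lambda>i. z i powr \<gamma>)"
    using chamberD[OF True] assms(1)
    by (intro vandermonde_pos[THEN less_imp_le] powr_less_mono2) (auto simp: less_imp_le)
  moreover have "0 \<le> (\<Prod>i<n. w (z i))"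
    using chamberD[OF True] assms(2) by (intro prod_nonneg) auto
  ultimately show ?thesis by (simp add: slice_potential_def)
qed (simp add: slice_potential_def)

text \<open>Renaming coordinates sends boxes to boxes with the same side lengths. It carries
  integrals over the positions (t, i) of a slice to integrals over vectors indexed by i.\<close>

lemma distr_PiM_lborel_reindex:
  fixes e :: "'j \<Rightarrow> 'i"
  assumes J: "finite J" and e: "inj_on e J"
  shows "distr (lebPi (e ` J)) (lebPi J) (\<lambda>x. \<lambda>j\<in>J. x (e j)) = lebPi J"
proof -
  interpret i: product_sigma_finite "\<lambda>_::'i. lborel :: real measure" by (rule product_sigma_finite_lborel)
  interpret j: product_sigma_finite "\<lambda>_::'j. lborel :: real measure" by (rule product_sigma_finite_lborel)
  have meas: "(\<lambda>x. \<lambda>j\<in>J. x (e j)) \<in> measurable (lebPi (e ` J)) (lebPi J)"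
    by (intro measurable_restrict measurable_component_singleton) auto
  show ?thesis
  proof (rule j.PiM_eqI[OF J])
    fix A :: "'j \<Rightarrow> real set" assume A: "\<And>i. i \<in> J \<Longrightarrow> A i \<in> sets lborel"
    define A' where "A' p = A (the_inv_into J e p)" for p
    have A': "A' (e j) = A j" if "j \<in> J" for j using that the_inv_into_f_f[OF e] by (simp add: A'_def)
    have "emeasure (distr (lebPi (e ` J)) (lebPi J) (\<lambda>x. \<lambda>j\<in>J. x (e j))) (Pi\<^sub>E J A) =
        emeasure (lebPi (e ` J)) ((\<lambda>x. \<lambda>j\<in>J. x (e j)) -` Pi\<^sub>E J A \<inter> space (lebPi (e ` J)))"
      using A J by (intro emeasure_distr meas sets_PiM_I_finite) auto
    also have "(\<lambda>x. \<lambda>j\<in>J. x (e j)) -` Pi\<^sub>E J A \<inter> space (lebPi (e ` J)) = Pi\<^sub>E (e ` J) A'"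
      by (auto simp: space_PiM PiE_iff A')
    also have "emeasure (lebPi (e ` J)) \<dots> = (\<Prod>p\<in>e ` J. emeasure lborel (A' p))"
      using J A by (intro i.emeasure_PiM) (auto simp: A')
    also have "\<dots> = (\<Prod>j\<in>J. emeasure lborel (A j))"
      by (subst prod.reindex[OF e]) (auto simp: A')
    finally show "emeasure (distr (lebPi (e ` J)) (lebPi J) (\<lambda>x. \<lambda>j\<in>J. x (e j))) (Pi\<^sub>E J A) =
      (\<Prod>j\<in>J. emeasure lborel (A j))" .
  qed simp
qed

context plane_partition_limit
begin

text \<open>The exponents add up as \<eta> - 1 + \<beta> + (|t| - 1) \<eta> on the left and \<theta>
  - 1 + \<beta> + (t - 1) \<theta> on the right. For t > 0 truncated subtraction leaves at most one
  of the powers of 1 - u^\<theta> and 1 - u^\<eta> nontrivial, which produces the case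
  distinction.\<close>

lemma wc_eq:
  assumes u: "0 < u" "u < 1"
  shows "wc \<alpha> \<eta> \<theta> M N t u = u powr (expo t - 1) * left_weight t u * right_weight t u"
proof -
  consider "t = 0" | "t < 0" | "t > 0" "int M \<le> int N - t" | "t > 0" "int N - t < int M" by linarith
  then show ?thesis
  proof cases
    case 1
    then show ?thesis by (simp add: wc_def expo_def left_weight_def right_weight_def \<beta>_def)
  next
    case 2
    have "u powr (\<eta> - 1) * u powr (\<beta> + real_of_int (- t - 1) * \<eta>) = u powr (\<alpha> + (\<eta> + \<theta>) / 2 + real_of_int \<bar>t\<bar> * \<eta> - 1)"
      using 2 by (simp add: \<beta>_def algebra_simps flip: powr_add)
    then show ?thesis using 2
      by (simp add: wc_def expo_def left_weight_def right_weight_def flip: mult.assoc)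
  next
    case 3
    have e: "u powr (\<theta> - 1) * u powr (\<beta> + real_of_int (t - 1) * \<theta>) = u powr (\<alpha> + (\<eta> + \<theta>) / 2 + real_of_int t * \<theta> - 1)"
      by (simp add: \<beta>_def algebra_simps flip: powr_add)
    have "M - (N - nat t) = 0" using 3 by auto
    then show ?thesis using 3 e
      by (simp add: wc_def expo_def left_weight_def right_weight_def flip: mult.assoc)
  next
    case 4
    have e: "u powr (\<theta> - 1) * u powr (\<beta> + real_of_int (t - 1) * \<theta>) = u powr (\<alpha> + (\<eta> + \<theta>) / 2 + real_of_int t * \<theta> - 1)"
      by (simp add: \<beta>_def algebra_simps flip: powr_add)
    have "N - nat t - M = 0" using 4 by auto
    then show ?thesis using 4 e
      by (simp add: wc_def expo_def left_weight_def right_weight_def flip: mult.assoc)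
  qed
qed

lemma slice_density_eq:
  fixes z :: "nat \<Rightarrow> real"
  defines "x \<equiv> \<lambda>p. z (snd p)"
  shows "slice_weight t x * left_pot t x * right_pot t x =
    ennreal (indicator (weyl_chamber (L t)) z * slice_density \<alpha> \<eta> \<theta> M N t z)"
proof -
  have unit: "0 \<le> left_weight t u" "0 \<le> right_weight t u" if "0 < u" "u < 1" for u
    using that \<eta> \<theta> by (auto simp: left_weight_def right_weight_def powr_le1 less_imp_le)
  have eq: "slice_weight t x * left_pot t x * right_pot t x =
      ennreal ((\<Prod>i<L t. z (Suc i) powr (expo t - 1)) *
        slice_potential \<eta> (left_weight t) (L t) (\<lambda>i. z (Suc i)) *
        slice_potential \<theta> (right_weight t) (L t) (\<lambda>i. z (Suc i)))"
    unfolding slice_weight_def left_pot_def right_pot_def x_def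
    using slice_potential_nonneg[OF \<eta> unit(1)] slice_potential_nonneg[OF \<theta> unit(2)]
    by (simp add: ennreal_mult mult_nonneg_nonneg prod_nonneg)
  show ?thesis
  proof (cases "z \<in> weyl_chamber (L t)")
    case True
    then have ch: "chamber (L t) (\<lambda>i. z (Suc i))" by (simp add: chamber_iff_weyl_chamber)
    have "(\<Prod>i\<in>{1..L t}. wc \<alpha> \<eta> \<theta> M N t (z i)) = (\<Prod>i<L t. wc \<alpha> \<eta> \<theta> M N t (z (Suc i)))"
      by (rule prod.reindex_bij_witness[where i = Suc and j = "\<lambda>i. i - 1"]) auto
    also have "\<dots> = (\<Prod>i<L t. z (Suc i) powr (expo t - 1) * left_weight t (z (Suc i)) * right_weight t (z (Suc i)))"
      using chamberD[OF ch] by (intro prod.cong refl wc_eq) auto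
    finally have "slice_density \<alpha> \<eta> \<theta> M N t z =
        vandermonde (L t) (\<lambda>i. z (Suc i) powr \<eta>) * vandermonde (L t) (\<lambda>i. z (Suc i) powr \<theta>) *
        (\<Prod>i<L t. z (Suc i) powr (expo t - 1) * left_weight t (z (Suc i)) * right_weight t (z (Suc i)))"
      unfolding slice_density_def vandermonde_pairs[of _ "\<lambda>i. z i powr _"]
      by (simp add: case_prod_beta prod.distrib)
    then show ?thesis
      unfolding eq slice_potential_def using ch True by (simp add: prod.distrib mult_ac)
  next
    case False
    then show ?thesis unfolding eq by (simp add: slice_potential_def chamber_iff_weyl_chamber)
  qed
qed

text \<open>Measurability is inherited from the local factors through
  \<open>slice_density_eq\<close>, applied to the array that repeats the vector z in every
  slice.\<close>

lemma measurable_slice_density: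
  "(\<lambda>z. ennreal (indicator (weyl_chamber (L t)) z * slice_density \<alpha> \<eta> \<theta> M N t z))
    \<in> borel_measurable (lebPi {1..L t})"
proof -
  let ?H = "\<lambda>x. slice_weight t x * left_pot t x * right_pot t x"
  have H: "local_on (slice_idx t) ?H"
    by (intro local_on_times local_on_slice_weight local_on_left_pot local_on_right_pot)
  have "(\<lambda>z. \<lambda>p\<in>slice_idx t. z (snd p)) \<in> measurable (lebPi {1..L t}) (lebPi (slice_idx t))"
    by (intro measurable_restrict measurable_component_singleton) (auto simp: slice_idx_iff)
  from measurable_compose[OF this local_on_measurable[OF H order_refl]]
  have "(\<lambda>z. ?H (\<lambda>p\<in>slice_idx t. z (snd p))) \<in> borel_measurable (lebPi {1..L t})" .
  also have "(\<lambda>z. ?H (\<lambda>p\<in>slice_idx t. z (snd p))) = (\<lambda>z. ?H (\<lambda>p. z (snd p)))"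
    by (intro ext local_on_cong[OF H]) simp
  finally show ?thesis unfolding slice_density_eq .
qed

section \<open>From the product law to the conditioned law of a slice\<close>

lemma \<nu>_density:
  "\<nu> = density (lebPi (arr_idx M N)) (\<lambda>x. \<Prod>p\<in>arr_idx M N.
     ennreal (expo (fst p) * x p powr (expo (fst p) - 1)) * indicator {0<..<1} (x p))"
  unfolding \<nu>_def power_law_def
proof (rule PiM_density_lborel[OF finite_arr_idx])
  show "sigma_finite_measure (density lborel (\<lambda>u. ennreal (expo (fst p) * u powr (expo (fst p) - 1)) * indicator {0<..<1} u))"
    for p :: "int \<times> nat"
    using prob_space_imp_sigma_finite[OF prob_space_power_law[OF expo_pos[of "fst p"]]] by (simp add: power_law_def)
qed measurable

definition expo_prod :: real where "expo_prod = (\<Prod>p\<in>arr_idx M N. expo (fst p))"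

lemma expo_prod_pos: "0 < expo_prod"
  unfolding expo_prod_def using expo_pos by (intro prod_pos) auto

text \<open>On the event every entry lies in the unit interval, so the indicators in the product
  density drop out and a constant times \<open>array_weight\<close> remains.\<close>

lemma nn_integral_\<nu>_ok_set:
  assumes [measurable]: "A \<in> sets \<nu>"
  shows "emeasure \<nu> (ok_set \<inter> A) =
    ennreal expo_prod * (\<integral>\<^sup>+x. of_bool (limit_array_ok M N x) * ennreal (array_weight x) * indicator A x \<partial>lebPi (arr_idx M N))"
proof -
  let ?I = "arr_idx M N"
  have [measurable]: "ok_set \<in> sets \<nu>" by (rule ok_set_measurable)
  have sets: "ok_set \<inter> A \<in> sets (lebPi ?I)" using ok_set_measurable assms sets_\<nu> by auto
  have A: "A \<in> sets (lebPi ?I)" using assms sets_\<nu> by auto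
  have comp: "(\<lambda>x. x p) \<in> borel_measurable (lebPi ?I)" if "p \<in> ?I" for p
    using measurable_component_singleton[OF that, of "\<lambda>_. lborel"] by simp
  have aw: "(\<lambda>x. array_weight x) \<in> borel_measurable (lebPi ?I)"
    unfolding array_weight_def using comp by (intro borel_measurable_prod powr_real_measurable) auto
  have "emeasure \<nu> (ok_set \<inter> A) = (\<integral>\<^sup>+x. (\<Prod>p\<in>?I.
     ennreal (expo (fst p) * x p powr (expo (fst p) - 1)) * indicator {0<..<1} (x p)) * indicator (ok_set \<inter> A) x \<partial>lebPi ?I)"
    unfolding \<nu>_density
  proof (rule emeasure_density[OF _ sets])
    show "(\<lambda>x. \<Prod>p\<in>?I. ennreal (expo (fst p) * x p powr (expo (fst p) - 1)) * indicator {0<..<1} (x p))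
      \<in> borel_measurable (lebPi ?I)"
    proof (rule borel_measurable_prod_ennreal)
      fix p assume p: "p \<in> ?I"
      have "(\<lambda>u. ennreal (expo (fst p) * u powr (expo (fst p) - 1)) * indicator {0<..<1} u) \<in> borel_measurable borel"
        by measurable
      from measurable_compose[OF comp[OF p] this]
      show "(\<lambda>x. ennreal (expo (fst p) * x p powr (expo (fst p) - 1)) * indicator {0<..<1} (x p)) \<in> borel_measurable (lebPi ?I)" .
    qed
  qed
  also have "\<dots> = (\<integral>\<^sup>+x. ennreal expo_prod * (of_bool (limit_array_ok M N x) * ennreal (array_weight x) * indicator A x) \<partial>lebPi ?I)"
  proof (rule nn_integral_cong)
    fix x assume x: "x \<in> space (lebPi ?I)"
    show "(\<Prod>p\<in>?I. ennreal (expo (fst p) * x p powr (expo (fst p) - 1)) * indicator {0<..<1} (x p)) * indicator (ok_set \<inter> A) x =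
      ennreal expo_prod * (of_bool (limit_array_ok M N x) * ennreal (array_weight x) * indicator A x)"
    proof (cases "limit_array_ok M N x")
      case True
      then have unit: "0 < x p \<and> x p < 1" if "p \<in> ?I" for p using that by (auto simp: limit_array_ok_def)
      have "(\<Prod>p\<in>?I. ennreal (expo (fst p) * x p powr (expo (fst p) - 1)) * indicator {0<..<1} (x p)) =
          (\<Prod>p\<in>?I. ennreal (expo (fst p) * x p powr (expo (fst p) - 1)))"
        using unit by (intro prod.cong) auto
      also have "\<dots> = ennreal (\<Prod>p\<in>?I. expo (fst p) * x p powr (expo (fst p) - 1))"
        using expo_pos by (intro prod_ennreal) (simp add: less_imp_le)
      also have "\<dots> = ennreal expo_prod * ennreal (array_weight x)"
        unfolding prod.distrib expo_prod_def[symmetric] array_weight_def[symmetric]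
        using expo_prod_pos by (simp add: ennreal_mult')
      finally show ?thesis
        using True x by (simp add: indicator_inter_arith ok_set_def space_\<nu> space_PiM indicator_def)
    qed (simp add: ok_set_def)
  qed
  also have "\<dots> = ennreal expo_prod * (\<integral>\<^sup>+x. of_bool (limit_array_ok M N x) * ennreal (array_weight x) * indicator A x \<partial>lebPi ?I)"
  proof (rule nn_integral_cmult)
    note [measurable] = aw A local_on_measurable[OF local_on_limit_array_ok order_refl]
    have "(\<lambda>x. of_bool (limit_array_ok M N x) * ennreal (array_weight x)) \<in> borel_measurable (lebPi ?I)"
      by (intro borel_measurable_times_ennreal) measurable
    then show "(\<lambda>x. of_bool (limit_array_ok M N x) * ennreal (array_weight x) * indicator A x) \<in> borel_measurable (lebPi ?I)"
      by measurable
  qed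
  finally show ?thesis .
qed

definition limit_measure :: "(int \<times> nat \<Rightarrow> real) measure" where
  "limit_measure = uniform_measure \<nu> ok_set"

lemma emeasure_ok_set: "emeasure \<nu> ok_set = ennreal (measure \<nu> ok_set)" "0 < measure \<nu> ok_set"
proof -
  interpret prob_space \<nu> by (rule prob_space_\<nu>)
  show "emeasure \<nu> ok_set = ennreal (measure \<nu> ok_set)" by (rule emeasure_eq_measure)
  then show "0 < measure \<nu> ok_set" using ok_set_pos by simp
qed

lemma slice_marginal:
  assumes t: "lo \<le> t" "t \<le> hi"
  shows "\<exists>C>0. distr limit_measure (lebPi {1..L t}) (\<lambda>x. \<lambda>i\<in>{1..L t}. x (t, i)) =
    density (lebPi {1..L t})
      (\<lambda>y. ennreal (C * indicator (weyl_chamber (L t)) y * slice_density \<alpha> \<eta> \<theta> M N t y))"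
proof -
  let ?J = "{1..L t}" and ?\<phi> = "\<lambda>x. \<lambda>i\<in>{1..L t}. x (t, i)"
  let ?D = "\<lambda>y. ennreal (indicator (weyl_chamber (L t)) y * slice_density \<alpha> \<eta> \<theta> M N t y)"
  obtain C where C: "0 < C" "\<And>g. local_on (slice_idx t) g \<Longrightarrow>
    (\<integral>\<^sup>+x. of_bool (limit_array_ok M N x) * ennreal (array_weight x) * g x \<partial>lebPi (arr_idx M N)) =
    ennreal C * (\<integral>\<^sup>+y. g y * (slice_weight t y * left_pot t y * right_pot t y) \<partial>lebPi (slice_idx t))"
    using marginal[OF t] by blast
  define m where "m = measure \<nu> ok_set"
  have m: "emeasure \<nu> ok_set = ennreal m" "0 < m" using emeasure_ok_set by (auto simp: m_def)
  \<comment> \<open>Collects the factors c of the power-law densities, the constants of the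
    integrated slices, and the division by the probability of the conditioning event.\<close>
  define C' where "C' = expo_prod * C / m"
  have C': "0 < C'" using expo_prod_pos C(1) m(2) by (simp add: C'_def)
  have idx: "slice_idx t = Pair t ` ?J" by (auto simp: slice_idx_iff image_iff)
  have idx_sub: "slice_idx t \<subseteq> arr_idx M N" using t by (auto simp: arr_idx_eq)
  have \<phi>: "?\<phi> \<in> measurable (lebPi K) (lebPi ?J)" if "slice_idx t \<subseteq> K" for K
    using that by (intro measurable_restrict measurable_component_singleton) (auto simp: idx)
  have \<phi>': "?\<phi> \<in> measurable limit_measure (lebPi ?J)"
    using \<phi>[OF idx_sub] by (simp add: limit_measure_def measurable_cong_sets[OF sets_\<nu> refl])
  have \<phi>\<nu>: "?\<phi> \<in> measurable \<nu> (lebPi ?J)"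
    using \<phi>[OF idx_sub] by (simp add: measurable_cong_sets[OF sets_\<nu> refl])
  have "distr limit_measure (lebPi ?J) ?\<phi> =
    density (lebPi ?J) (\<lambda>y. ennreal (C' * indicator (weyl_chamber (L t)) y * slice_density \<alpha> \<eta> \<theta> M N t y))"
  proof (rule measure_eqI)
    fix B assume "B \<in> sets (distr limit_measure (lebPi ?J) ?\<phi>)"
    then have B: "B \<in> sets (lebPi ?J)" by simp
    define A where "A = ?\<phi> -` B \<inter> space \<nu>"
    have A: "A \<in> sets \<nu>" unfolding A_def by (rule measurable_sets[OF \<phi>\<nu> B])
    define g where "g x = (indicator B (?\<phi> x) :: ennreal)" for x
    have g: "local_on (slice_idx t) g"
    proof -
      have "g \<in> borel_measurable (lebPi (slice_idx t))"
        unfolding g_def using B by (intro measurable_compose[OF \<phi>[OF order_refl]]) simp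
      moreover have "g x = g y" if "\<forall>p\<in>slice_idx t. x p = y p" for x y
      proof -
        have "?\<phi> x = ?\<phi> y" using that by (intro restrict_ext) (simp add: slice_idx_iff)
        then show ?thesis by (simp only: g_def)
      qed
      ultimately show ?thesis unfolding local_on_def by blast
    qed
    have "emeasure (distr limit_measure (lebPi ?J) ?\<phi>) B = emeasure limit_measure A"
      unfolding A_def using emeasure_distr[OF \<phi>' B] by (simp add: limit_measure_def)
    also have "\<dots> = emeasure \<nu> (ok_set \<inter> A) / ennreal m"
      unfolding limit_measure_def m(1)[symmetric] by (rule emeasure_uniform_measure[OF ok_set_measurable A])
    also have "emeasure \<nu> (ok_set \<inter> A) =
      ennreal expo_prod * (\<integral>\<^sup>+x. of_bool (limit_array_ok M N x) * ennreal (array_weight x) * indicator A x \<partial>lebPi (arr_idx M N))"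
      by (rule nn_integral_\<nu>_ok_set[OF A])
    also have "(\<integral>\<^sup>+x. of_bool (limit_array_ok M N x) * ennreal (array_weight x) * indicator A x \<partial>lebPi (arr_idx M N)) =
      (\<integral>\<^sup>+x. of_bool (limit_array_ok M N x) * ennreal (array_weight x) * g x \<partial>lebPi (arr_idx M N))"
      by (intro nn_integral_cong) (auto simp: A_def g_def indicator_def space_\<nu> space_PiM)
    also have "\<dots> = ennreal C * (\<integral>\<^sup>+y. g y * (slice_weight t y * left_pot t y * right_pot t y) \<partial>lebPi (slice_idx t))"
      by (rule C(2)[OF g])
    also have "(\<integral>\<^sup>+y. g y * (slice_weight t y * left_pot t y * right_pot t y) \<partial>lebPi (slice_idx t)) =
      (\<integral>\<^sup>+y. indicator B (?\<phi> y) * ?D (?\<phi> y) \<partial>lebPi (Pair t ` ?J))"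
      unfolding idx[symmetric]
    proof (rule nn_integral_cong)
      fix y
      have "slice_weight t y * left_pot t y * right_pot t y =
        slice_weight t (\<lambda>p. ?\<phi> y (snd p)) * left_pot t (\<lambda>p. ?\<phi> y (snd p)) * right_pot t (\<lambda>p. ?\<phi> y (snd p))"
        by (rule local_on_cong[where J = "slice_idx t"])
          (auto intro!: local_on_times local_on_slice_weight local_on_left_pot local_on_right_pot simp: slice_idx_iff)
      then show "g y * (slice_weight t y * left_pot t y * right_pot t y) = indicator B (?\<phi> y) * ?D (?\<phi> y)"
        unfolding slice_density_eq g_def by simp
    qed
    also have "\<dots> = (\<integral>\<^sup>+z. indicator B z * ?D z \<partial>distr (lebPi (Pair t ` ?J)) (lebPi ?J) ?\<phi>)"
      using B measurable_slice_density \<phi>[OF order_refl] unfolding idx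
      by (subst nn_integral_distr) auto
    also have "\<dots> = (\<integral>\<^sup>+z. indicator B z * ?D z \<partial>lebPi ?J)"
      by (subst distr_PiM_lborel_reindex) (auto simp: inj_on_def)
    also have "ennreal expo_prod * (ennreal C * \<dots>) / ennreal m = ennreal C' * (\<integral>\<^sup>+z. indicator B z * ?D z \<partial>lebPi ?J)"
      unfolding C'_def using m(2) C(1) expo_prod_pos
      by (simp add: divide_ennreal_def inverse_ennreal divide_inverse ennreal_mult mult_ac)
    also have "\<dots> = (\<integral>\<^sup>+z. ennreal C' * (indicator B z * ?D z) \<partial>lebPi ?J)"
      using B measurable_slice_density by (intro nn_integral_cmult[symmetric]) auto
    also have "\<dots> = (\<integral>\<^sup>+z. ennreal (C' * indicator (weyl_chamber (L t)) z * slice_density \<alpha> \<eta> \<theta> M N t z) * indicator B z \<partial>lebPi ?J)"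
      using C' by (intro nn_integral_cong) (simp add: mult.assoc ennreal_mult' mult_ac)
    also have "\<dots> = emeasure (density (lebPi ?J) (\<lambda>y. ennreal (C' * indicator (weyl_chamber (L t)) y * slice_density \<alpha> \<eta> \<theta> M N t y))) B"
    proof (rule emeasure_density[symmetric, OF _ B])
      have "(\<lambda>y. ennreal C' * ?D y) \<in> borel_measurable (lebPi ?J)" using measurable_slice_density by simp
      then show "(\<lambda>y. ennreal (C' * indicator (weyl_chamber (L t)) y * slice_density \<alpha> \<eta> \<theta> M N t y)) \<in> borel_measurable (lebPi ?J)"
        using C' by (simp add: mult.assoc ennreal_mult')
    qed
    finally show "emeasure (distr limit_measure (lebPi ?J) ?\<phi>) B =
      emeasure (density (lebPi ?J) (\<lambda>y. ennreal (C' * indicator (weyl_chamber (L t)) y * slice_density \<alpha> \<eta> \<theta> M N t y))) B" .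
  qed simp
  then show ?thesis using C' by blast
qed

lemma integral_limit_measure:
  fixes f :: "(int \<times> nat \<Rightarrow> real) \<Rightarrow> real"
  assumes "f \<in> borel_measurable \<nu>"
  shows "integral\<^sup>L limit_measure f = (\<integral>x. indicator ok_set x * f x \<partial>\<nu>) / measure \<nu> ok_set"
proof -
  have "limit_measure = density \<nu> (\<lambda>x. ennreal (indicator ok_set x / measure \<nu> ok_set))"
    unfolding limit_measure_def uniform_measure_def emeasure_ok_set(1)
  proof (rule arg_cong[where f = "density \<nu>"], rule ext)
    show "indicator ok_set x / ennreal (measure \<nu> ok_set) = ennreal (indicator ok_set x / measure \<nu> ok_set)" for x
      using emeasure_ok_set(2) divide_ennreal[of 1 "measure \<nu> ok_set"] by (cases "x \<in> ok_set") simp_all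
  qed
  then have "integral\<^sup>L limit_measure f = (\<integral>x. indicator ok_set x / measure \<nu> ok_set * f x \<partial>\<nu>)"
    using assms ok_set_measurable by (simp add: integral_density)
  then show ?thesis by simp
qed

end

theorem mainTheorem3:
  fixes \<alpha> \<eta> \<theta> :: real and M N :: nat
  assumes "\<alpha> \<ge> 0" and "\<eta> > 0" and "\<theta> > 0" and "1 \<le> M" and "M \<le> N"
  shows "\<exists>\<mu>. prob_space \<mu> \<and> sets \<mu> = sets (PiM (arr_idx M N) (\<lambda>_. lborel)) \<and>
    (\<forall>f :: (int \<times> nat \<Rightarrow> real) \<Rightarrow> real.
       continuous_on (PiE (arr_idx M N) (\<lambda>_. UNIV)) f \<longrightarrow>
       bounded (f ` PiE (arr_idx M N) (\<lambda>_. UNIV)) \<longrightarrow>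
       f \<in> borel_measurable (PiM (arr_idx M N) (\<lambda>_. lborel)) \<longrightarrow>
       ((\<lambda>\<epsilon>. pp_expect \<epsilon> \<alpha> \<eta> \<theta> M N f) \<longlongrightarrow> integral\<^sup>L \<mu> f) (at_right 0)) \<and>
    (AE x in \<mu>. limit_array_ok M N x) \<and>
    (\<forall>t. - int M + 1 \<le> t \<and> t \<le> int N - 1 \<longrightarrow>
       (\<exists>C>0. distr \<mu> (PiM {1..Lt M N t} (\<lambda>_. lborel)) (\<lambda>x. \<lambda>i\<in>{1..Lt M N t}. x (t, i)) =
              density (PiM {1..Lt M N t} (\<lambda>_. lborel))
                (\<lambda>y. ennreal (C * indicator (weyl_chamber (Lt M N t)) y * slice_density \<alpha> \<eta> \<theta> M N t y))))"
proof -
  interpret plane_partition_limit \<alpha> \<eta> \<theta> M N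
    using assms by unfold_locales
  show ?thesis
  proof (intro exI[of _ limit_measure] conjI allI impI)
    show "prob_space limit_measure"
      unfolding limit_measure_def
      by (rule prob_space_uniform_measure) (use emeasure_ok_set in auto)
    show "sets limit_measure = sets (lebPi (arr_idx M N))"
      by (simp add: limit_measure_def sets_\<nu>)
    show "AE x in limit_measure. limit_array_ok M N x"
      unfolding limit_measure_def
      by (rule AE_uniform_measureI[OF ok_set_measurable]) (simp add: ok_set_def)
    fix f :: "(int \<times> nat \<Rightarrow> real) \<Rightarrow> real"
    assume f: "continuous_on (Pi\<^sub>E (arr_idx M N) (\<lambda>_. UNIV)) f"
      "bounded (f ` Pi\<^sub>E (arr_idx M N) (\<lambda>_. UNIV))" "f \<in> borel_measurable (lebPi (arr_idx M N))"
    have "f \<in> borel_measurable \<nu>" using f(3) by (simp add: measurable_cong_sets[OF sets_\<nu> refl])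
    then show "((\<lambda>\<epsilon>. pp_expect \<epsilon> \<alpha> \<eta> \<theta> M N f) \<longlongrightarrow> integral\<^sup>L limit_measure f) (at_right 0)"
      using pp_expect_tendsto[OF f] by (simp add: integral_limit_measure)
  next
    fix t :: int assume "- int M + 1 \<le> t \<and> t \<le> int N - 1"
    then show "\<exists>C>0. distr limit_measure (lebPi {1..L t}) (\<lambda>x. \<lambda>i\<in>{1..L t}. x (t, i)) =
      density (lebPi {1..L t})
        (\<lambda>y. ennreal (C * indicator (weyl_chamber (L t)) y * slice_density \<alpha> \<eta> \<theta> M N t y))"
      by (intro slice_marginal) auto
  qed
qed

end
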